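(* Fix an integer $k\ge 2$. Let $T\subset\mathcal{F}_k$ be a tree in the $1$-skeleton of $\mathcal{F}_k$ whose vertex set is the set of all vertices of the triangulation $\mathcal{F}_k$. Let $\tilde T$ be a lift of $T$ to the Farey triangulation $\mathcal{F}$ and let $\{\frac{p_i}{q_i}: i\in\Lambda\}\subset\hat{\mathbb{Q}}$ be the set of vertices of $\tilde T$. For each $i\in\Lambda$ choose arbitrarily a primitive element $g_i\in\mathcal{P}(\frac{p_i}{q_i})$. Then $P_k$ is the normal closure in $F_2$ of $\{g_i^k: i\in\Lambda\}$.
   Context: $F_2=\langle a,b\rangle$ is the free group on $a,b$; an element is primitive if it belongs to some two-element generating set; $P_k\subset F_2$ is the subgroup generated by the $k$-th powers of all primitive elements. $\mathrm{ab}:F_2\to\mathbb{Z}^2$ is the abelianization with $a\mapsto(1,0)$, $b\mapsto(0,1)$. $\hat{\mathbb{Q}}=\mathbb{Q}\cup\{\frac10\}$. For $\frac pq\in\hat{\mathbb{Q}}$ with $p,q$ relatively prime integers, $\mathcal{P}(\frac pq)$ is the set of primitive elements $g\in F_2$ with $\mathrm{ab}(g)=\pm(p,q)$ (this is the union of one primitive conjugacy class and the class of the inverses). The Farey triangulation $\mathcal{F}$ is the triangulation of the hyperbolic plane with ideal vertex set $\hat{\mathbb{Q}}$, with vertices included as points of $\mathcal{F}$, in which $\frac pq$ and $\frac rs$ (in lowest terms) are joined by an edge iff $|ps-qr|=1$, the triangles being the triples of pairwise adjacent vertices. $\mathrm{SL}(2,\mathbb{Z})$ acts on it by Möbius transformations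 $z\mapsto\frac{m_{11}z+m_{12}}{m_{21}z+m_{22}}$. $D\mathcal{O}_k\subset\mathrm{SL}(2,\mathbb{Z})$ denotes the normal closure of $\begin{pmatrix}1&k\\0&1\end{pmatrix}$ in $\mathrm{SL}(2,\mathbb{Z})$, and $\mathcal{F}_k=\mathcal{F}/D\mathcal{O}_k$ is the quotient triangulated surface; its vertices (resp. edges, triangles) are the $D\mathcal{O}_k$-orbits of vertices (resp. edges, triangles) of $\mathcal{F}$. A lift of $T$ to $\mathcal{F}$ is a connected subgraph $\tilde T$ of the $1$-skeleton of $\mathcal{F}$ that the quotient map $\mathcal{F}\to\mathcal{F}_k$ carries isomorphically onto $T$. *)

theory Defs
  imports
    "HOL-Algebra.Generated_Groups"
    "HOL-Algebra.Group_Action"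
    "HOL-Analysis.Determinants"
begin

section \<open>Normal closures\<close>

definition normal_closure :: "('a, 'b) monoid_scheme \<Rightarrow> 'a set \<Rightarrow> 'a set" where
  "normal_closure G S = \<Inter> {N. N \<lhd> G \<and> S \<subseteq> N}"

lemma (in group) carrier_normal: "carrier G \<lhd> G"
  by (simp add: normal_inv_iff subgroup_self)

lemma (in group) normal_closure_normal:
  assumes "S \<subseteq> carrier G"
  shows "normal_closure G S \<lhd> G"
proof -
  have ne: "carrier G \<in> {N. N \<lhd> G \<and> S \<subseteq> N}"
    using assms carrier_normal by simp
  have "subgroup (\<Inter> {N. N \<lhd> G \<and> S \<subseteq> N}) G"
    using ne by (intro subgroups_Inter) (auto intro: normal_imp_subgroup)
  moreover have "x \<otimes> h \<otimes> inv x \<in> \<Inter> {N. N \<lhd> G \<and> S \<subseteq> N}"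
    if "x \<in> carrier G" "h \<in> \<Inter> {N. N \<lhd> G \<and> S \<subseteq> N}" for x h
    using that by (auto intro: normal.inv_op_closed2)
  ultimately show ?thesis
    unfolding normal_closure_def by (simp add: normal_inv_iff)
qed


section \<open>The free group of rank two\<close>

text \<open>
  The letter \<open>(x, True)\<close> stands for the generator \<open>x\<close> and \<open>(x, False)\<close> for its inverse.
  Elements of the free group are the reduced words.
\<close>

datatype gen = GenA | GenB

type_synonym letter = "gen \<times> bool"

definition flip :: "letter \<Rightarrow> letter" where
  "flip l = (fst l, \<not> snd l)"

definition reduced :: "letter list \<Rightarrow> bool" where
  "reduced w \<longleftrightarrow> successively (\<lambda>l m. m \<noteq> flip l) w"

fun cons_red :: "letter \<Rightarrow> letter list \<Rightarrow> letter list" where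
  "cons_red l [] = [l]"
| "cons_red l (m # w) = (if m = flip l then w else l # m # w)"

definition F2 :: "letter list monoid" where
  "F2 = \<lparr>carrier = {w. reduced w}, monoid.mult = foldr cons_red, one = []\<rparr>"

definition gen_a :: "letter list" where
  "gen_a = [(GenA, True)]"

definition gen_b :: "letter list" where
  "gen_b = [(GenB, True)]"

lemma flip_flip [simp]: "flip (flip l) = l"
  by (simp add: flip_def)

lemma flip_neq [simp]: "flip l \<noteq> l" "l \<noteq> flip l"
  by (auto simp: flip_def prod_eq_iff)

lemma reduced_Nil [simp]: "reduced []"
  by (simp add: reduced_def)

lemma reduced_Cons:
  "reduced (l # w) \<longleftrightarrow> reduced w \<and> (w \<noteq> [] \<longrightarrow> hd w \<noteq> flip l)"
  by (cases w) (auto simp: reduced_def)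

lemma reduced_cons_red: "reduced w \<Longrightarrow> reduced (cons_red l w)"
  by (cases w) (auto simp: reduced_Cons)

lemma reduced_foldr: "reduced w \<Longrightarrow> reduced (foldr cons_red u w)"
  by (induction u) (auto simp: reduced_cons_red)

lemma cons_red_flip: "reduced w \<Longrightarrow> cons_red (flip l) (cons_red l w) = w"
proof (cases w)
  case (Cons m v)
  then show "reduced w \<Longrightarrow> cons_red (flip l) (cons_red l w) = w"
    by (cases v) (auto simp: reduced_Cons)
qed auto

lemma cons_red_flip': "reduced w \<Longrightarrow> cons_red l (cons_red (flip l) w) = w"
  using cons_red_flip[of w "flip l"] by simp

lemma foldr_cons_red:
  "reduced w \<Longrightarrow> foldr cons_red (cons_red l u) w = cons_red l (foldr cons_red u w)"
  by (cases u) (auto simp: cons_red_flip' reduced_foldr)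

lemma foldr_assoc:
  "reduced w \<Longrightarrow> foldr cons_red (foldr cons_red u v) w = foldr cons_red u (foldr cons_red v w)"
  by (induction u) (auto simp: foldr_cons_red)

lemma foldr_Nil: "reduced w \<Longrightarrow> foldr cons_red w [] = w"
proof (induction w)
  case (Cons l w)
  then show ?case by (cases w) (auto simp: reduced_Cons)
qed simp

lemma foldr_inverse:
  "reduced x \<Longrightarrow> foldr cons_red (foldr cons_red (rev (map flip w)) []) (foldr cons_red w x) = x"
proof (induction w)
  case (Cons l w)
  have "foldr cons_red (rev (map flip w) @ [flip l]) []
      = foldr cons_red (foldr cons_red (rev (map flip w)) []) [flip l]"
    using foldr_assoc[of "[flip l]" "rev (map flip w)" "[]"]
    by (simp add: reduced_Cons)
  with Cons show ?case
    by (simp add: foldr_assoc reduced_Cons reduced_foldr reduced_cons_red cons_red_flip)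
qed simp

lemma group_F2: "group F2"
proof (rule groupI)
  fix x assume x: "x \<in> carrier F2"
  then have "foldr cons_red (foldr cons_red (rev (map flip x)) []) x = []"
    using foldr_inverse[of "[]" x] by (simp add: F2_def foldr_Nil)
  then show "\<exists>y\<in>carrier F2. y \<otimes>\<^bsub>F2\<^esub> x = \<one>\<^bsub>F2\<^esub>"
    by (intro bexI[of _ "foldr cons_red (rev (map flip x)) []"])
      (simp_all add: F2_def reduced_foldr)
qed (simp_all add: F2_def reduced_foldr foldr_assoc)

lemma inv_letter: "inv\<^bsub>F2\<^esub> [l] = [flip l]"
  by (rule group.inv_equality[OF group_F2]) (simp_all add: F2_def reduced_Cons)

lemma generate_F2: "generate F2 {gen_a, gen_b} = carrier F2"
proof -
  have letter: "[l] \<in> generate F2 {gen_a, gen_b}" for l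
  proof -
    obtain x s where l: "l = (x, s)" by (cases l)
    have "[(x, True)] \<in> {gen_a, gen_b}"
      by (cases x) (simp_all add: gen_a_def gen_b_def)
    then have "[(x, True)] \<in> generate F2 {gen_a, gen_b}"
      and "inv\<^bsub>F2\<^esub> [(x, True)] \<in> generate F2 {gen_a, gen_b}"
      by (auto intro: generate.incl generate.inv)
    then show ?thesis
      by (cases s) (simp_all add: l inv_letter flip_def)
  qed
  have "w \<in> generate F2 {gen_a, gen_b}" if "reduced w" for w
    using that
  proof (induction w)
    case Nil
    show ?case using generate.one[of F2] by (simp add: F2_def)
  next
    case (Cons l w)
    then have "[l] \<otimes>\<^bsub>F2\<^esub> w \<in> generate F2 {gen_a, gen_b}"
      by (auto intro: generate.eng letter simp: reduced_Cons)
    also have "[l] \<otimes>\<^bsub>F2\<^esub> w = l # w"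
      using Cons.prems by (cases w) (auto simp: F2_def reduced_Cons)
    finally show ?case .
  qed
  moreover have "generate F2 {gen_a, gen_b} \<subseteq> carrier F2"
    by (rule group.generate_incl[OF group_F2])
      (simp add: F2_def gen_a_def gen_b_def reduced_Cons)
  ultimately show ?thesis by (auto simp: F2_def)
qed


section \<open>Primitive elements and abelianization\<close>

definition primitive :: "letter list \<Rightarrow> bool" where
  "primitive g \<longleftrightarrow>
     (\<exists>S \<subseteq> carrier F2. card S = 2 \<and> g \<in> S \<and> generate F2 S = carrier F2)"

definition prim_power_subgroup :: "nat \<Rightarrow> letter list set" where
  "prim_power_subgroup k = generate F2 {g [^]\<^bsub>F2\<^esub> k |g. primitive g}"

definition exponent_sum :: "gen \<Rightarrow> letter list \<Rightarrow> int" where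
  "exponent_sum x w =
     (\<Sum>l\<leftarrow>w. if fst l = x then (if snd l then 1 else - 1) else 0)"

definition ab :: "letter list \<Rightarrow> int \<times> int" where
  "ab w = (exponent_sum GenA w, exponent_sum GenB w)"

lemma ab_gen: "ab gen_a = (1, 0)" "ab gen_b = (0, 1)"
  by (simp_all add: ab_def exponent_sum_def gen_a_def gen_b_def)

lemma exponent_sum_mult:
  "exponent_sum x (u \<otimes>\<^bsub>F2\<^esub> v) = exponent_sum x u + exponent_sum x v"
proof -
  have "exponent_sum x (cons_red l w) = exponent_sum x [l] + exponent_sum x w" for l w
    by (cases w) (auto simp: exponent_sum_def flip_def)
  then show ?thesis
    by (induction u) (simp_all add: F2_def exponent_sum_def)
qed

lemma ab_mult:
  "ab (u \<otimes>\<^bsub>F2\<^esub> v) = (fst (ab u) + fst (ab v), snd (ab u) + snd (ab v))"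
  by (simp add: ab_def exponent_sum_mult)


section \<open>The extended rationals\<close>

text \<open>\<open>None\<close> is the point \<open>1/0\<close>.\<close>

type_synonym qhat = "rat option"

definition qfrac :: "int \<Rightarrow> int \<Rightarrow> qhat" where
  "qfrac p q = (if q = 0 then None else Some (of_int p / of_int q))"

lemma qfrac_surj: "\<exists>p q. coprime p q \<and> x = qfrac p q"
proof (cases x)
  case None
  then show ?thesis
    by (intro exI[of _ 1] exI[of _ 0]) (simp add: qfrac_def)
next
  case (Some r)
  obtain p q where pq: "quotient_of r = (p, q)" by fastforce
  then have "coprime p q" "q > 0" "r = of_int p / of_int q"
    by (auto simp: quotient_of_coprime quotient_of_denom_pos quotient_of_div)
  then show ?thesis
    by (intro exI[of _ p] exI[of _ q]) (simp add: qfrac_def Some)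
qed

definition prim_class :: "qhat \<Rightarrow> letter list set" where
  "prim_class x = {g. primitive g \<and>
     (\<exists>p q. coprime p q \<and> x = qfrac p q \<and> (ab g = (p, q) \<or> ab g = (- p, - q)))}"


section \<open>The action of $SL(2,Z)$\<close>

definition SL2Z :: "(int^2^2) monoid" where
  "SL2Z = \<lparr>carrier = {A. det A = 1}, monoid.mult = (**), one = mat 1\<rparr>"

lemma group_SL2Z: "group SL2Z"
proof (rule groupI)
  fix A assume "A \<in> carrier SL2Z"
  then have d: "A$1$1 * A$2$2 - A$1$2 * A$2$1 = 1"
    by (simp add: SL2Z_def det_2)
  let ?B = "vector [vector [A$2$2, - (A$1$2)], vector [- (A$2$1), A$1$1]] :: int^2^2"
  have "?B ** A = mat 1"
    using d by (simp add: vec_eq_iff forall_2 matrix_matrix_mult_def sum_2 mat_def algebra_simps)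
  moreover have "det ?B = 1"
    using d by (simp add: det_2 algebra_simps)
  ultimately show "\<exists>B\<in>carrier SL2Z. B \<otimes>\<^bsub>SL2Z\<^esub> A = \<one>\<^bsub>SL2Z\<^esub>"
    by (intro bexI[of _ ?B]) (simp_all add: SL2Z_def)
qed (simp_all add: SL2Z_def det_mul matrix_mul_assoc)

definition DO :: "nat \<Rightarrow> (int^2^2) set" where
  "DO k = normal_closure SL2Z {vector [vector [1, int k], vector [0, 1]]}"

fun moebius :: "int^2^2 \<Rightarrow> qhat \<Rightarrow> qhat" where
  "moebius M None = qfrac (M$1$1) (M$2$1)"
| "moebius M (Some z) =
     (let d = of_int (M$2$1) * z + of_int (M$2$2)
      in if d = 0 then None else Some ((of_int (M$1$1) * z + of_int (M$1$2)) / d))"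

lemma moebius_qfrac:
  assumes "coprime p q" and "det M = 1"
  shows "moebius M (qfrac p q) = qfrac (M$1$1 * p + M$1$2 * q) (M$2$1 * p + M$2$2 * q)"
proof (cases "q = 0")
  case True
  with assms have "p = 1 \<or> p = - 1" by auto
  with True show ?thesis by (auto simp: qfrac_def)
next
  case False
  have eq: "of_int c * (of_int p / of_int q) + of_int d = (of_int (c * p + d * q) / of_int q :: rat)"
    for c d using False by (simp add: field_simps)
  have "moebius M (qfrac p q) = moebius M (Some (of_int p / of_int q))"
    using False by (simp add: qfrac_def)
  then show ?thesis
    using False unfolding moebius.simps Let_def eq
    by (simp add: qfrac_def del: of_int_add of_int_mult)
qed


section \<open>Graphs\<close>

text \<open>
  Undirected multigraphs, possibly infinite: an edge \<open>e\<close> joins the vertices in \<open>ends G e\<close>,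
  and is a loop if this set is a singleton.
\<close>

record ('v, 'e) mgraph =
  verts :: "'v set"
  edges :: "'e set"
  ends :: "'e \<Rightarrow> 'v set"

definition subgraph :: "('v, 'e) mgraph \<Rightarrow> ('v, 'e) mgraph \<Rightarrow> bool" where
  "subgraph H G \<longleftrightarrow> verts H \<subseteq> verts G \<and> edges H \<subseteq> edges G \<and>
     (\<forall>e\<in>edges H. ends H e = ends G e \<and> ends H e \<subseteq> verts H)"

text \<open>
  A walk from \<open>u\<close> to \<open>w\<close> is recorded as the list of its steps,
  each step being the edge traversed together with the vertex reached.
\<close>

fun walk :: "('v, 'e) mgraph \<Rightarrow> 'v \<Rightarrow> ('e \<times> 'v) list \<Rightarrow> 'v \<Rightarrow> bool" where
  "walk G u [] w \<longleftrightarrow> u \<in> verts G \<and> u = w"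
| "walk G u ((e, v) # p) w \<longleftrightarrow>
     u \<in> verts G \<and> e \<in> edges G \<and> ends G e = {u, v} \<and> walk G v p w"

definition connected_graph :: "('v, 'e) mgraph \<Rightarrow> bool" where
  "connected_graph G \<longleftrightarrow>
     verts G \<noteq> {} \<and> (\<forall>u\<in>verts G. \<forall>w\<in>verts G. \<exists>p. walk G u p w)"

text \<open>Loops are cycles of length one, and two parallel edges form a cycle of length two.\<close>

definition cycle :: "('v, 'e) mgraph \<Rightarrow> 'v \<Rightarrow> ('e \<times> 'v) list \<Rightarrow> bool" where
  "cycle G u p \<longleftrightarrow>
     p \<noteq> [] \<and> walk G u p u \<and> distinct (map fst p) \<and> distinct (map snd p)"

definition tree :: "('v, 'e) mgraph \<Rightarrow> bool" where
  "tree G \<longleftrightarrow> connected_graph G \<and> \<not> (\<exists>u p. cycle G u p)"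

definition graph_iso ::
    "('v \<Rightarrow> 'w) \<Rightarrow> ('e \<Rightarrow> 'f) \<Rightarrow> ('v, 'e) mgraph \<Rightarrow> ('w, 'f) mgraph \<Rightarrow> bool" where
  "graph_iso \<phi> \<psi> G H \<longleftrightarrow>
     bij_betw \<phi> (verts G) (verts H) \<and> bij_betw \<psi> (edges G) (edges H) \<and>
     (\<forall>e\<in>edges G. ends H (\<psi> e) = \<phi> ` ends G e)"


section \<open>The Farey graph and its quotients\<close>

definition farey_adj :: "qhat \<Rightarrow> qhat \<Rightarrow> bool" where
  "farey_adj x y \<longleftrightarrow> (\<exists>p q r s. coprime p q \<and> coprime r s \<and>
     x = qfrac p q \<and> y = qfrac r s \<and> \<bar>p * s - q * r\<bar> = 1)"

text \<open>
  Only the 1-skeletons of the Farey triangulation and of its quotients are needed.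
  An edge of the Farey triangulation is identified with its set of endpoints.
\<close>

definition farey :: "(qhat, qhat set) mgraph" where
  "farey = \<lparr>verts = UNIV, edges = {{x, y} |x y. farey_adj x y}, ends = (\<lambda>e. e)\<rparr>"

definition vertex_orbit :: "nat \<Rightarrow> qhat \<Rightarrow> qhat set" where
  "vertex_orbit k = orbit (SL2Z\<lparr>carrier := DO k\<rparr>) moebius"

definition edge_orbit :: "nat \<Rightarrow> qhat set \<Rightarrow> qhat set set" where
  "edge_orbit k = orbit (SL2Z\<lparr>carrier := DO k\<rparr>) (\<lambda>M e. moebius M ` e)"

text \<open>
  The endpoints of an orbit of edges are the orbits of the endpoints of its members; as the
  members are translates of one another, these are the orbits of the two endpoints of any one
  of them.
\<close>

definition farey_quotient :: "nat \<Rightarrow> (qhat set, qhat set set) mgraph" where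
  "farey_quotient k =
     \<lparr>verts = vertex_orbit k ` verts farey,
      edges = edge_orbit k ` edges farey,
      ends = (\<lambda>E. vertex_orbit k ` \<Union> E)\<rparr>"

definition is_lift ::
    "nat \<Rightarrow> (qhat, qhat set) mgraph \<Rightarrow> (qhat set, qhat set set) mgraph \<Rightarrow> bool" where
  "is_lift k L T \<longleftrightarrow> subgraph L farey \<and> connected_graph L \<and>
     graph_iso (vertex_orbit k) (edge_orbit k) L T"

end

theory Submission
  imports Defs
begin

text \<open>
  An oriented edge of the Farey triangulation is a matrix in $SL(2,Z)$ up to sign: its columns are
  the two ends of the edge. Two moves, multiplications on the right by fixed matrices of orders two
  and three up to sign, lead from any edge to any other: \<open>Cross\<close> reverses the edge,
  and \<open>Turn\<close> passes to the next edge of the same triangle. As $PSL(2,Z)$ is the free product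
  of the cyclic groups generated by the two moves, any two maps of a set that have orders two and
  three up to an equivalence relation extend to an action of all matrices (\<open>act_eq_if_matrix_eq\<close>).
  This is the simple connectivity of the Farey triangulation, and it is used in two ways.

  On the side of the free group, pairs of elements of any group, taken up to simultaneous
  conjugation and simultaneous inversion, carry such an action, with
  $(g,h) \mapsto (h, g^{-1})$ for \<open>Cross\<close> and $(g,h) \mapsto (h, (gh)^{-1})$ for \<open>Turn\<close>.
  Nielsen's method (\<open>nielsen_pairs\<close>) shows that every generating pair of $F_2$ of determinant one
  is equivalent to an image of $(a,b)$. Let $N$ be the normal closure of the given
  powers and apply the action to the images of $a$, $b$ in $F_2/N$. Whether the $k$-th power of a
  primitive element lies in $N$ then depends on its slope only (\<open>torsion_same_vertex\<close>).
  Call the slope good if it does. The vertices of $L$ are good by construction. If $v$ is good,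
  the $k$-th power of the parabolic element fixing $v$ takes a pair $(x,y)$ with $x^k = 1$ to
  $(x, x^k y) = (x, y)$, hence it fixes the class of the images of $(a,b)$ in $F_2/N$. The elements
  of $D\mathcal{O}_k$ fixing this class form a subgroup $H$, and $H$ preserves goodness. It remains
  to see that the $H$-translates of the vertices of $L$ are all of $\hat{Q}$
  (\<open>H_transitive_on_lifts\<close>).

  This is where the topology of the quotient surface enters. Suppose that some vertex is not
  reached from $L$ by $H$. The edges with one reached and one unreached end are crossed by a
  line that enters and leaves triangle after triangle. No translate of an edge of $L$ is crossed,
  because the stabilisers of the vertices of $L$ in $D\mathcal{O}_k$ lie in $\pm H$. In the
  quotient surface the line is either injective on triangles or closes up to a circuit at
  its shortest repetition; in both cases the edges that it crosses form a nonempty set which avoids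
  the tree and meets each triangle in zero or two edges (\<open>ex_even_set_along_line\<close>). Such a
  set is a cocycle modulo two. Pulled back to the simply connected Farey triangulation
  it is the coboundary of a two-valued function on the vertices. Since $D\mathcal{O}_k$ is
  generated by elements with a fixed vertex, this function is $D\mathcal{O}_k$-invariant. It is
  constant along $L$, and $L$ meets all orbits of vertices, so it is constant and the set is empty
  (\<open>even_set_avoiding_edges_empty\<close>), a contradiction.
\<close>

section \<open>Integer matrices up to sign\<close>

definition mat2 :: "int \<Rightarrow> int \<Rightarrow> int \<Rightarrow> int \<Rightarrow> int^2^2" where
  "mat2 a b c d = vector [vector [a, b], vector [c, d]]"

lemma mat2_nth [simp]:
  "mat2 a b c d $ 1 $ 1 = a" "mat2 a b c d $ 1 $ 2 = b"
  "mat2 a b c d $ 2 $ 1 = c" "mat2 a b c d $ 2 $ 2 = d"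
  by (simp_all add: mat2_def)

lemma mat2_eta: "mat2 (M$1$1) (M$1$2) (M$2$1) (M$2$2) = M"
  by (simp add: vec_eq_iff forall_2)

lemma mat2_cases [cases type]:
  obtains a b c d where "M = mat2 a b c d"
  using mat2_eta[of M] by metis

lemma mat2_eq_iff [simp]:
  "mat2 a b c d = mat2 a' b' c' d' \<longleftrightarrow> a = a' \<and> b = b' \<and> c = c' \<and> d = d'"
  by (auto simp: vec_eq_iff forall_2)

lemma mat2_mult [simp]:
  "mat2 a b c d ** mat2 a' b' c' d'
    = mat2 (a * a' + b * c') (a * b' + b * d') (c * a' + d * c') (c * b' + d * d')"
  by (simp add: vec_eq_iff forall_2 matrix_matrix_mult_def sum_2)

lemma mat2_uminus [simp]: "- mat2 a b c d = mat2 (- a) (- b) (- c) (- d)"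
  by (simp add: vec_eq_iff forall_2)

lemma mat2_one: "mat 1 = mat2 1 0 0 1"
  by (simp add: vec_eq_iff forall_2 mat_def)

lemma det_mat2 [simp]: "det (mat2 a b c d) = a * d - b * c"
  by (simp add: det_2)

lemma matrix_mult_uminus [simp]:
  fixes A B :: "int^2^2"
  shows "(- A) ** B = - (A ** B)" "A ** (- B) = - (A ** B)"
  by (cases A, cases B, simp)+

lemma det_uminus2 [simp]: "det (- A) = det (A :: int^2^2)"
  by (cases A) simp

definition upto_sign :: "int^2^2 \<Rightarrow> int^2^2 \<Rightarrow> bool" (infix "=\<^sub>\<plusminus>" 50) where
  "M =\<^sub>\<plusminus> M' \<longleftrightarrow> M' = M \<or> M' = - M"

lemma upto_sign_refl [simp]: "M =\<^sub>\<plusminus> M"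
  by (simp add: upto_sign_def)

lemma upto_sign_sym: "M =\<^sub>\<plusminus> M' \<Longrightarrow> M' =\<^sub>\<plusminus> M"
  by (auto simp: upto_sign_def)

lemma upto_sign_trans: "M =\<^sub>\<plusminus> M' \<Longrightarrow> M' =\<^sub>\<plusminus> M'' \<Longrightarrow> M =\<^sub>\<plusminus> M''"
  by (auto simp: upto_sign_def)

lemma upto_sign_minus: "- M =\<^sub>\<plusminus> M"
  by (simp add: upto_sign_def)

lemma upto_sign_mult: "A =\<^sub>\<plusminus> A' \<Longrightarrow> B =\<^sub>\<plusminus> B' \<Longrightarrow> A ** B =\<^sub>\<plusminus> A' ** B'"
  by (auto simp: upto_sign_def)

lemma upto_sign_det: "M =\<^sub>\<plusminus> M' \<Longrightarrow> det M' = det M"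
  by (auto simp: upto_sign_def)

section \<open>Words in the moves and their matrices\<close>

datatype farey_move = Cross | Turn

text \<open>
  If the edge has columns $u$, $v$, then \<open>Cross\<close> gives the edge with columns $v$, $-u$, and
  \<open>Turn\<close> the one with columns $v$, $-u-v$. The third vertex of the triangle to which \<open>Turn\<close>
  belongs is thus $u+v$.
\<close>

fun move_matrix :: "farey_move \<Rightarrow> int^2^2" where
  "move_matrix Cross = mat2 0 (- 1) 1 0"
| "move_matrix Turn = mat2 0 (- 1) 1 (- 1)"

fun word_matrix :: "farey_move list \<Rightarrow> int^2^2" where
  "word_matrix [] = mat 1"
| "word_matrix (m # w) = move_matrix m ** word_matrix w"

lemma det_move_matrix [simp]: "det (move_matrix m) = 1"
  by (cases m) auto

lemma det_word_matrix [simp]: "det (word_matrix w) = 1"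
  by (induction w) (auto simp: det_mul)

lemma word_matrix_append: "word_matrix (v @ w) = word_matrix v ** word_matrix w"
  by (induction v) (auto simp: matrix_mul_assoc)

fun inv_word :: "farey_move list \<Rightarrow> farey_move list" where
  "inv_word [] = []"
| "inv_word (Cross # w) = inv_word w @ [Cross]"
| "inv_word (Turn # w) = inv_word w @ [Turn, Turn]"

text \<open>
  Only up to sign, because \<open>Cross\<close> squares to minus the identity.
\<close>

lemma word_matrix_inv_word:
  "word_matrix (w @ inv_word w) =\<^sub>\<plusminus> mat 1"
  "word_matrix (inv_word w @ w) =\<^sub>\<plusminus> mat 1"
proof -
  have cancel: "word_matrix (u @ v @ u') =\<^sub>\<plusminus> word_matrix (u @ u')"
    if "word_matrix v =\<^sub>\<plusminus> mat 1" for u v u'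
    using upto_sign_mult[OF upto_sign_refl upto_sign_mult[OF that upto_sign_refl]]
    by (simp add: word_matrix_append)
  have letters: "word_matrix [Cross, Cross] =\<^sub>\<plusminus> mat 1" "word_matrix [Turn, Turn, Turn] =\<^sub>\<plusminus> mat 1"
    by (simp_all add: mat2_one upto_sign_def)
  show "word_matrix (w @ inv_word w) =\<^sub>\<plusminus> mat 1"
  proof (induction w rule: inv_word.induct)
    case (2 w)
    from upto_sign_trans[OF cancel[OF this, of "[Cross]" "[Cross]"]] letters(1)
    show ?case by (simp del: word_matrix.simps(2))
  next
    case (3 w)
    from upto_sign_trans[OF cancel[OF this, of "[Turn]" "[Turn, Turn]"]] letters(2)
    show ?case by (simp del: word_matrix.simps(2))
  qed simp
  show "word_matrix (inv_word w @ w) =\<^sub>\<plusminus> mat 1"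
  proof (induction w rule: inv_word.induct)
    case (2 w)
    from upto_sign_trans[OF cancel[OF letters(1), of "inv_word w" w] this]
    show ?case by (simp del: word_matrix.simps(2))
  next
    case (3 w)
    from upto_sign_trans[OF cancel[OF letters(2), of "inv_word w" w] this]
    show ?case by (simp del: word_matrix.simps(2))
  qed simp
qed

section \<open>The modular group is a free product\<close>

text \<open>
  Normal forms of the free product of a group of order two and a group of order three:
  \<open>(a, l, b)\<close> stands for an optional \<open>Cross\<close>, followed by one or two \<open>Turn\<close>s and a \<open>Cross\<close>
  for each entry of \<open>l\<close>, and a final power of \<open>Turn\<close> with exponent \<open>b < 3\<close>.
\<close>

fun nf_word :: "bool \<times> bool list \<times> nat \<Rightarrow> farey_move list" where
  "nf_word (a, l, b) = (if a then [Cross] else []) @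
     concat (map (\<lambda>t. if t then [Turn, Turn, Cross] else [Turn, Cross]) l) @ replicate b Turn"

fun nf_cons :: "farey_move \<Rightarrow> bool \<times> bool list \<times> nat \<Rightarrow> bool \<times> bool list \<times> nat" where
  "nf_cons Cross (a, l, b) = (\<not> a, l, b)"
| "nf_cons Turn (True, l, b) = (False, False # l, b)"
| "nf_cons Turn (False, False # l, b) = (False, True # l, b)"
| "nf_cons Turn (False, True # l, b) = (True, l, b)"
| "nf_cons Turn (False, [], b) = (False, [], if b = 2 then 0 else Suc b)"

lemma nf_cons_bound: "snd (snd n) < 3 \<Longrightarrow> snd (snd (nf_cons m n)) < 3"
  by (induction m n rule: nf_cons.induct) auto

definition normal_form :: "farey_move list \<Rightarrow> bool \<times> bool list \<times> nat" where
  "normal_form w = foldr nf_cons w (False, [], 0)"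

lemma normal_form_bound: "snd (snd (normal_form w)) < 3"
  by (induction w) (auto simp: normal_form_def nf_cons_bound)

text \<open>
  The relation is a partial equivalence: \<open>x \<approx> x\<close> expresses membership in the set on which
  the moves act.
\<close>

locale modular_action =
  fixes eq :: "'x \<Rightarrow> 'x \<Rightarrow> bool" (infix "\<approx>" 50)
    and move :: "farey_move \<Rightarrow> 'x \<Rightarrow> 'x"
  assumes eq_sym: "x \<approx> y \<Longrightarrow> y \<approx> x"
    and eq_trans: "x \<approx> y \<Longrightarrow> y \<approx> z \<Longrightarrow> x \<approx> z"
    and move_cong: "x \<approx> y \<Longrightarrow> move m x \<approx> move m y"
    and cross_cross: "x \<approx> x \<Longrightarrow> move Cross (move Cross x) \<approx> x"
    and turn_turn_turn: "x \<approx> x \<Longrightarrow> move Turn (move Turn (move Turn x)) \<approx> x"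
begin

fun act :: "farey_move list \<Rightarrow> 'x \<Rightarrow> 'x" where
  "act [] x = x"
| "act (m # w) x = act w (move m x)"

lemma act_append: "act (v @ w) x = act w (act v x)"
  by (induction v arbitrary: x) auto

lemma act_cong: "x \<approx> y \<Longrightarrow> act w x \<approx> act w y"
  by (induction w arbitrary: x y) (auto simp: move_cong)

lemma act_nf_cons:
  assumes "x \<approx> x" "snd (snd n) < 3"
  shows "act (m # nf_word n) x \<approx> act (nf_word (nf_cons m n)) x"
  using assms
proof (induction m n rule: nf_cons.induct)
  case (1 a l b)
  then show ?case
    by (cases a) (auto simp: act_append intro!: act_cong cross_cross move_cong)
next
  case (5 b)
  then have "b = 0 \<or> b = 1 \<or> b = 2" by auto
  then show ?case
    using 5 by (auto simp: numeral_2_eq_2 intro!: turn_turn_turn move_cong)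
next
  case (4 l b)
  then show ?case
    by (auto simp: act_append intro!: act_cong move_cong turn_turn_turn)
qed (auto simp: act_append intro!: act_cong move_cong)

text \<open>
  The normal form is computed from the word alone, so the same normal form serves all actions.
  Comparing an arbitrary action with the action on matrices is the way in which freeness is proved.
\<close>

lemma act_normal_form: "x \<approx> x \<Longrightarrow> act w x \<approx> act (nf_word (normal_form w)) x"
proof (induction w arbitrary: x)
  case Nil
  then show ?case by (simp add: normal_form_def)
next
  case (Cons m w)
  have "normal_form (m # w) = nf_cons m (normal_form w)"
    by (simp add: normal_form_def)
  then show ?case
    using eq_trans[OF _ act_nf_cons] Cons move_cong normal_form_bound
    by (simp del: nf_word.simps)
qed

end

interpretation sl2: modular_action "(=\<^sub>\<plusminus>)" "\<lambda>m M. M ** move_matrix m"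
proof
  show "M ** move_matrix Cross ** move_matrix Cross =\<^sub>\<plusminus> M"
    and "M ** move_matrix Turn ** move_matrix Turn ** move_matrix Turn =\<^sub>\<plusminus> M" for M
    by (cases M, simp add: upto_sign_def)+
qed (auto intro: upto_sign_sym upto_sign_trans upto_sign_mult)

lemma sl2_act: "sl2.act w M = M ** word_matrix w"
  by (induction w arbitrary: M) (auto simp: matrix_mul_assoc)

text \<open>
  The blocks \<open>[Turn, Turn, Cross]\<close> and \<open>[Turn, Cross]\<close> are, up to sign, the two elementary
  unipotent matrices with nonnegative entries. Products of these have nonnegative
  entries and differ from the identity as soon as there is at least one factor.
\<close>

lemma word_matrix_turns:
  assumes "C = concat (map (\<lambda>t. if t then [Turn, Turn, Cross] else [Turn, Cross]) l)"
  shows "\<exists>p q r s. word_matrix C =\<^sub>\<plusminus> mat2 p q r s \<and> p > 0 \<and> q \<ge> 0 \<and> r \<ge> 0 \<and> s > 0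
    \<and> (l \<noteq> [] \<longrightarrow> q + r > 0)"
  unfolding assms
proof (induction l)
  case Nil
  show ?case
    by (rule exI[of _ 1], rule exI[of _ 0], rule exI[of _ 0], rule exI[of _ 1])
      (simp add: mat2_one)
next
  case (Cons t l)
  then obtain p q r s where *: "word_matrix (concat (map (\<lambda>t. if t then [Turn, Turn, Cross] else [Turn, Cross]) l)) =\<^sub>\<plusminus> mat2 p q r s"
     "p > 0" "q \<ge> 0" "r \<ge> 0" "s > 0" by blast
  show ?case
  proof (cases t)
    case True
    have "mat2 1 1 0 1 =\<^sub>\<plusminus> word_matrix [Turn, Turn, Cross]"
      by (simp add: mat2_one upto_sign_def)
    from upto_sign_mult[OF upto_sign_sym[OF this] *(1)]
    show ?thesis using True *(2-)
      by (intro exI[of _ "p + r"] exI[of _ "q + s"] exI[of _ r] exI[of _ s])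
        (simp add: word_matrix_append[symmetric] del: word_matrix.simps(2))
  next
    case False
    have "mat2 1 0 1 1 =\<^sub>\<plusminus> word_matrix [Turn, Cross]"
      by (simp add: mat2_one upto_sign_def)
    from upto_sign_mult[OF upto_sign_sym[OF this] *(1)]
    show ?thesis using False *(2-)
      by (intro exI[of _ p] exI[of _ q] exI[of _ "p + r"] exI[of _ "q + s"])
        (simp add: word_matrix_append[symmetric] del: word_matrix.simps(2))
  qed
qed

text \<open>
  Ping-pong: moving the initial \<open>Cross\<close> and the final \<open>Turn\<close>s to the other side would make a
  nonnegative matrix equal up to sign to one of the six matrices \<open>Cross\<close>$^i$ \<open>Turn\<close>$^j$. Five
  of these have entries of both signs, and the remaining one is the identity.
\<close>

lemma normal_form_trivial:
  assumes "word_matrix w =\<^sub>\<plusminus> mat 1"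
  shows "normal_form w = (False, [], 0)"
proof -
  obtain a l b where n: "normal_form w = (a, l, b)" by (metis prod_cases3)
  define C where "C = concat (map (\<lambda>t. if t then [Turn, Turn, Cross] else [Turn, Cross]) l)"
  obtain p q r s where C: "word_matrix C =\<^sub>\<plusminus> mat2 p q r s"
    and pos: "p > 0" "q \<ge> 0" "r \<ge> 0" "s > 0" "l \<noteq> [] \<Longrightarrow> q + r > 0"
    using word_matrix_turns[OF C_def] by blast
  have "word_matrix w =\<^sub>\<plusminus> word_matrix (nf_word (a, l, b))"
    using sl2.act_normal_form[of "mat 1" w] by (simp add: sl2_act n)
  also have "nf_word (a, l, b) = (if a then [Cross] else []) @ C @ replicate b Turn"
    by (simp add: C_def)
  finally have "(if a then move_matrix Cross else mat 1) ** (word_matrix C ** word_matrix (replicate b Turn)) =\<^sub>\<plusminus> mat 1"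
    using assms by (auto simp: word_matrix_append intro: upto_sign_trans upto_sign_sym split: if_splits)
  then have *: "(if a then move_matrix Cross else mat 1) ** (mat2 p q r s ** word_matrix (replicate b Turn)) =\<^sub>\<plusminus> mat 1"
    using upto_sign_mult[OF upto_sign_refl[of "if a then move_matrix Cross else mat 1"]
       upto_sign_mult[OF upto_sign_sym[OF C] upto_sign_refl[of "word_matrix (replicate b Turn)"]]]
    by (rule upto_sign_trans[rotated])
  have "b = 0 \<or> b = 1 \<or> b = 2"
    using normal_form_bound[of w] n by auto
  then have "\<not> a" "b = 0" "q + r = 0"
    using * pos(1-4) by (cases a; auto simp: mat2_one upto_sign_def numeral_2_eq_2)+
  then show ?thesis using n pos by fastforce
qed

theorem (in modular_action) act_trivial:
  assumes "x \<approx> x" "word_matrix w =\<^sub>\<plusminus> mat 1"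
  shows "act w x \<approx> x"
  using act_normal_form[OF assms(1), of w] normal_form_trivial[OF assms(2)] by simp

corollary (in modular_action) act_eq_if_matrix_eq:
  assumes "x \<approx> x" "word_matrix v =\<^sub>\<plusminus> word_matrix w"
  shows "act v x \<approx> act w x"
proof -
  have "word_matrix (inv_word w @ v) =\<^sub>\<plusminus> mat 1"
    using upto_sign_mult[OF upto_sign_refl[of "word_matrix (inv_word w)"] assms(2)]
      upto_sign_trans[OF _ word_matrix_inv_word(2)]
    by (simp add: word_matrix_append)
  then have "act (inv_word w @ v) (act w x) \<approx> act w x"
    using act_trivial act_cong assms(1) by blast
  moreover have "act v (act (w @ inv_word w) x) \<approx> act v x"
    using act_trivial act_cong word_matrix_inv_word(1) assms(1) by blast
  ultimately show ?thesis
    using eq_trans[OF eq_sym[of "act v (act (w @ inv_word w) x)" "act v x"], of "act w x"]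
    by (simp add: act_append)
qed

text \<open>
  The Euclidean algorithm on the lower row: multiplying by a power of the shear
  reduces the lower right entry modulo the lower left one, and \<open>Cross\<close> exchanges the two.
\<close>

lemma ex_word_matrix:
  assumes "det M = 1"
  shows "\<exists>w. M =\<^sub>\<plusminus> word_matrix w"
proof -
  define S where "S = {M. \<exists>w. M =\<^sub>\<plusminus> word_matrix w}"
  have mult: "M \<in> S" if w: "M ** word_matrix w \<in> S" for M w
  proof -
    obtain v where "M ** word_matrix w =\<^sub>\<plusminus> word_matrix v" using w by (auto simp: S_def)
    from upto_sign_mult[OF this upto_sign_refl[of "word_matrix (inv_word w)"]]
    have "M ** word_matrix (w @ inv_word w) =\<^sub>\<plusminus> word_matrix (v @ inv_word w)"
      by (simp add: word_matrix_append matrix_mul_assoc)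
    moreover have "M =\<^sub>\<plusminus> M ** word_matrix (w @ inv_word w)"
      using upto_sign_mult[OF upto_sign_refl[of M] upto_sign_sym[OF word_matrix_inv_word(1)[of w]]]
      by simp
    ultimately have "M =\<^sub>\<plusminus> word_matrix (v @ inv_word w)"
      by (rule upto_sign_trans[rotated])
    then show ?thesis unfolding S_def by blast
  qed
  have shift: "mat2 a b c d \<in> S" if "mat2 a (b + n * a) c (d + n * c) \<in> S" for a b c d n :: int
    using that
  proof (induction n arbitrary: b d rule: int_induct[where k = 0])
    case (step1 n)
    from step1.prems have "mat2 a (b + a) c (d + c) \<in> S"
      by (simp add: step1.IH algebra_simps)
    then show ?case
      using mult[of "mat2 a b c d" "[Turn, Turn, Cross]"] by (simp add: mat2_one add.commute)
  next
    case (step2 n)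
    from step2.prems have "mat2 a (b - a) c (d - c) \<in> S"
      by (simp add: step2.IH algebra_simps)
    then have "- mat2 a (b - a) c (d - c) \<in> S"
      unfolding S_def mem_Collect_eq using upto_sign_trans[OF upto_sign_minus] by metis
    then show ?case
      using mult[of "mat2 a b c d" "[Cross, Turn]"] by (simp add: mat2_one)
  qed simp
  have "mat2 a b c d \<in> S" if "a * d - b * c = 1" for a b c d
    using that
  proof (induction "nat \<bar>c\<bar>" arbitrary: a b c d rule: less_induct)
    case less
    show ?case
    proof (cases "c = 0")
      case True
      then have "a = 1 \<and> d = 1 \<or> a = -1 \<and> d = -1"
        using less.prems by (auto simp: zmult_eq_1_iff)
      then have "mat2 a (b + (- b * a) * a) c (d + (- b * a) * c) \<in> S"
        using True unfolding S_def mem_Collect_eq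
        by (intro exI[of _ "[]"]) (auto simp: mat2_one upto_sign_def algebra_simps)
      then show ?thesis by (rule shift)
    next
      case False
      define n where "n = - (d div c)"
      have "d + n * c = d mod c" by (simp add: n_def minus_div_mult_eq_mod)
      then have "nat \<bar>d + n * c\<bar> < nat \<bar>c\<bar>" using False abs_mod_less[of c d] by simp
      then have "mat2 (b + n * a) (- a) (d + n * c) (- c) \<in> S"
        using less.prems by (intro less.hyps) (auto simp: algebra_simps)
      then have "mat2 a (b + n * a) c (d + n * c) \<in> S"
        using mult[of "mat2 a (b + n * a) c (d + n * c)" "[Cross]"] by (simp add: mat2_one)
      then show ?thesis by (rule shift)
    qed
  qed
  then have "M \<in> S" using assms by (cases M) simp
  then show ?thesis by (simp add: S_def)
qed


section \<open>Even sets of edges\<close>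

text \<open>
  The situation of a quotient of the Farey triangulation in which no edge is glued to its own
  reverse and no triangle is glued to itself by a rotation.
\<close>

locale free_modular_action = modular_action +
  assumes cross_free: "\<not> x \<approx> move Cross x"
    and turn_free: "\<not> x \<approx> move Turn x"
begin

abbreviation "C \<equiv> move Cross"
abbreviation "R \<equiv> move Turn"

lemma eq_refl1: "x \<approx> y \<Longrightarrow> x \<approx> x"
  using eq_sym eq_trans by blast

definition same_triangle :: "'a \<Rightarrow> 'a \<Rightarrow> bool" where
  "same_triangle x y \<longleftrightarrow> x \<approx> y \<or> x \<approx> R y \<or> x \<approx> R (R y)"

lemma same_triangle_sym: "x \<approx> x \<Longrightarrow> y \<approx> y \<Longrightarrow> same_triangle x y \<Longrightarrow> same_triangle y x"
  unfolding same_triangle_def by (meson eq_sym eq_trans move_cong turn_turn_turn)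

lemma same_triangle_trans:
  "y \<approx> y \<Longrightarrow> z \<approx> z \<Longrightarrow> same_triangle x y \<Longrightarrow> same_triangle y z \<Longrightarrow> same_triangle x z"
  unfolding same_triangle_def by (meson eq_trans move_cong turn_turn_turn)

lemma turn_turn_free: "x \<approx> x \<Longrightarrow> \<not> x \<approx> R (R x)"
  by (meson eq_sym eq_trans move_cong turn_free turn_turn_turn)

text \<open>
  A set of unoriented edges that contains zero or two edges of each triangle, in other
  words a cocycle modulo two.
\<close>

definition even_set :: "'a set \<Rightarrow> bool" where
  "even_set S \<longleftrightarrow> (\<forall>x\<in>S. x \<approx> x) \<and> (\<forall>x y. x \<approx> y \<longrightarrow> x \<in> S \<longrightarrow> y \<in> S) \<and>
     (\<forall>x. x \<approx> x \<longrightarrow> (C x \<in> S \<longleftrightarrow> x \<in> S)) \<and>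
     (\<forall>x. x \<approx> x \<longrightarrow> (R (R x) \<in> S \<longleftrightarrow> (x \<in> S) \<noteq> (R x \<in> S)))"

text \<open>
  The edges \<open>d i\<close>, visited in the order given by \<open>\<sigma>\<close>, lead into pairwise different
  triangles, and the strand leaves the triangle of \<open>d i\<close> through \<open>d (\<sigma> i)\<close>. As no triangle is
  visited twice, the triangle of \<open>d i\<close> contains exactly these two edges of the strand.
\<close>

lemma even_set_strand:
  fixes d :: "'i \<Rightarrow> 'a"
  assumes bij: "bij_betw \<sigma> I I"
    and d: "\<And>i. i \<in> I \<Longrightarrow> d i \<approx> d i"
    and step: "\<And>i. i \<in> I \<Longrightarrow> C (d (\<sigma> i)) \<approx> R (d i) \<or> C (d (\<sigma> i)) \<approx> R (R (d i))"
    and inj: "\<And>i j. i \<in> I \<Longrightarrow> j \<in> I \<Longrightarrow> same_triangle (d i) (d j) \<Longrightarrow> i = j"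
  shows "even_set {x. \<exists>i\<in>I. x \<approx> d i \<or> x \<approx> C (d i)}"
proof -
  define S where "S = {x. \<exists>i\<in>I. x \<approx> d i \<or> x \<approx> C (d i)}"
  have \<sigma>: "\<sigma> i \<in> I" if "i \<in> I" for i
    using bij that by (auto simp: bij_betw_def)
  have cl: "x \<in> S \<longleftrightarrow> y \<in> S" if "x \<approx> y" for x y
    using that eq_sym eq_trans unfolding S_def by blast
  have pattern: "d i \<in> S" "R (d i) \<in> S \<longleftrightarrow> R (d i) \<approx> C (d (\<sigma> i))"
    "R (R (d i)) \<in> S \<longleftrightarrow> R (R (d i)) \<approx> C (d (\<sigma> i))" if i: "i \<in> I" for i
  proof -
    have *: "x \<approx> d i \<or> x \<approx> C (d (\<sigma> i))" if "x \<in> S" "same_triangle x (d i)" for x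
    proof -
      from \<open>x \<in> S\<close> obtain j where j: "j \<in> I" "x \<approx> d j \<or> x \<approx> C (d j)" by (auto simp: S_def)
      from j(2) show ?thesis
      proof
        assume x: "x \<approx> d j"
        then have "same_triangle (d j) (d i)"
          using that(2) d i j by (meson eq_refl1 same_triangle_def same_triangle_sym same_triangle_trans)
        with x show ?thesis using inj i j by blast
      next
        assume x: "x \<approx> C (d j)"
        obtain j' where j': "j' \<in> I" "j = \<sigma> j'"
          using bij j(1) by (metis bij_betw_def imageE)
        then have "same_triangle x (d j')"
          using x step[of j'] eq_trans unfolding same_triangle_def by blast
        then have "same_triangle (d j') (d i)"
          using that(2) d i j' by (meson x eq_refl1 same_triangle_sym same_triangle_trans)
        with x j' show ?thesis using inj i by blast
      qed
    qed
    show "d i \<in> S" using i d by (auto simp: S_def)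
    have r: "R (d i) \<approx> R (d i)" "R (R (d i)) \<approx> R (R (d i))" using d i move_cong by blast+
    show "R (d i) \<in> S \<longleftrightarrow> R (d i) \<approx> C (d (\<sigma> i))"
      using *[of "R (d i)"] r turn_free eq_sym \<sigma>[OF i]
      by (auto simp: S_def same_triangle_def)
    show "R (R (d i)) \<in> S \<longleftrightarrow> R (R (d i)) \<approx> C (d (\<sigma> i))"
      using *[of "R (R (d i))"] r turn_turn_free d i eq_sym \<sigma>[OF i]
      by (auto simp: S_def same_triangle_def)
  qed
  \<comment> \<open>Of the two other edges of the triangle of d i, exactly one is the exit of the strand.\<close>
  have even_at: "R (R (d i)) \<in> S \<longleftrightarrow> \<not> R (d i) \<in> S" if i: "i \<in> I" for i
    using step[OF i] pattern[OF i] turn_free[of "R (d i)"] eq_sym eq_trans by metis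
  have "R (R x) \<in> S \<longleftrightarrow> (x \<in> S) \<noteq> (R x \<in> S)" if x: "x \<approx> x" for x
  proof -
    have "\<exists>i\<in>I. same_triangle x (d i)" if y: "y \<in> S" "same_triangle x y" for y
    proof -
      from y obtain i where i: "i \<in> I" "y \<approx> d i \<or> y \<approx> C (d i)" by (auto simp: S_def)
      then obtain i' where i': "i' \<in> I" "i = \<sigma> i'"
        using bij by (metis bij_betw_def imageE)
      have "\<exists>i\<in>I. same_triangle y (d i)"
        using i i' step[of i'] eq_trans unfolding same_triangle_def by blast
      moreover have "y \<approx> y" using i(2) eq_refl1 by blast
      ultimately show ?thesis using y(2) d same_triangle_trans by blast
    qed
    moreover have "same_triangle x x" "same_triangle x (R x)" "same_triangle x (R (R x))"
      using x turn_turn_turn eq_sym move_cong unfolding same_triangle_def by blast+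
    ultimately consider "x \<notin> S \<and> R x \<notin> S \<and> R (R x) \<notin> S"
      | i where "i \<in> I" "same_triangle x (d i)" by blast
    then show ?thesis
    proof cases
      case 2
      have RRR: "R (R (R (d i))) \<approx> d i" "R (R (R (R (d i)))) \<approx> R (d i)"
        using d 2 turn_turn_turn move_cong by blast+
      from 2(2) consider "x \<approx> d i" | "x \<approx> R (d i)" | "x \<approx> R (R (d i))"
        by (auto simp: same_triangle_def)
      then show ?thesis
      proof cases
        case 1
        then have "R x \<approx> R (d i)" "R (R x) \<approx> R (R (d i))" using move_cong by blast+
        with 1 show ?thesis using even_at[OF 2(1)] pattern(1)[OF 2(1)] cl by metis
      next
        case 2
        then have "R x \<approx> R (R (d i))" "R (R x) \<approx> d i" using RRR move_cong eq_trans by blast+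
        with 2 show ?thesis using even_at[OF \<open>i \<in> I\<close>] pattern(1)[OF \<open>i \<in> I\<close>] cl by metis
      next
        case 3
        then have "R x \<approx> d i" "R (R x) \<approx> R (d i)" using RRR move_cong eq_trans by blast+
        with 3 show ?thesis using even_at[OF \<open>i \<in> I\<close>] pattern(1)[OF \<open>i \<in> I\<close>] cl by metis
      qed
    qed auto
  qed
  moreover have "C x \<in> S \<longleftrightarrow> x \<in> S" if x: "x \<approx> x" for x
    using cross_cross[OF x] move_cong eq_sym eq_trans x d cross_cross unfolding S_def mem_Collect_eq by meson
  moreover have "x \<approx> x" if "x \<in> S" for x
    using that eq_refl1 by (auto simp: S_def)
  ultimately show ?thesis
    using cl unfolding even_set_def S_def[symmetric] by blast
qed

text \<open>
  A line either visits each triangle at most once, or contains a shortest stretch between two visits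
  to the same triangle; closing this stretch up gives a strand without repetitions.
\<close>

theorem ex_even_set_along_line:
  fixes d :: "int \<Rightarrow> 'a"
  assumes d: "\<And>i. d i \<approx> d i"
    and step: "\<And>i. C (d (i + 1)) \<approx> R (d i) \<or> C (d (i + 1)) \<approx> R (R (d i))"
  shows "\<exists>S. even_set S \<and> S \<noteq> {} \<and> (\<forall>x\<in>S. \<exists>i. x \<approx> d i \<or> x \<approx> C (d i))"
proof (cases "\<exists>i j. i < j \<and> same_triangle (d i) (d j)")
  case False
  then have "i = j" if "same_triangle (d i) (d j)" for i j
    using that d same_triangle_sym by (metis linorder_neqE)
  moreover have "bij_betw (\<lambda>i::int. i + 1) UNIV UNIV"
    by (rule bij_betw_byWitness[where f' = "\<lambda>i. i - 1"]) auto
  ultimately have "even_set {x. \<exists>i\<in>UNIV. x \<approx> d i \<or> x \<approx> C (d i)}"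
    using d step by (intro even_set_strand) auto
  then show ?thesis using d by blast
next
  case True
  define n where "n = (LEAST n. \<exists>i. n > 0 \<and> same_triangle (d i) (d (i + int n)))"
  have "\<exists>n i. n > 0 \<and> same_triangle (d i) (d (i + int n))"
  proof -
    from True obtain i j where "i < j" "same_triangle (d i) (d j)" by blast
    then have "nat (j - i) > 0 \<and> same_triangle (d i) (d (i + int (nat (j - i))))" by simp
    then show ?thesis by blast
  qed
  from LeastI_ex[OF this] obtain i0 where n: "n > 0" "same_triangle (d i0) (d (i0 + int n))"
    unfolding n_def by blast
  have minimal: "m \<ge> n" if "m > 0" "same_triangle (d i) (d (i + int m))" for i m
    unfolding n_def by (rule Least_le) (use that in blast)
  \<comment> \<open>The stretch starts after the edge i0, since the visits at i0 and at i0 + n concern the same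
    triangle and only one of them may be kept.\<close>
  define I where "I = {i0 + 1 .. i0 + int n}"
  define \<sigma> where "\<sigma> = (\<lambda>i. if i = i0 + int n then i0 + 1 else i + 1)"
  have inj: "i = j" if "i \<in> I" "j \<in> I" "same_triangle (d i) (d j)" for i j
  proof -
    have no: False if "i < j" "i \<in> I" "j \<in> I" "same_triangle (d i) (d j)" for i j
      using minimal[of "nat (j - i)" i] that by (auto simp: I_def)
    show ?thesis using no that same_triangle_sym d by (metis linorder_neqE)
  qed
  have bij: "bij_betw \<sigma> I I"
    by (rule bij_betw_byWitness[where f' = "\<lambda>i. if i = i0 + 1 then i0 + int n else i - 1"])
      (use n(1) in \<open>auto simp: I_def \<sigma>_def\<close>)
  have "C (d (\<sigma> i)) \<approx> R (d i) \<or> C (d (\<sigma> i)) \<approx> R (R (d i))" if "i \<in> I" for i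
  proof (cases "i = i0 + int n")
    case True
    let ?z = "d (i0 + int n)"
    have "same_triangle (C (d (i0 + 1))) (d i0)"
      using step[of i0] by (auto simp: same_triangle_def)
    then have "same_triangle (C (d (i0 + 1))) ?z"
      using n(2) d same_triangle_trans by blast
    \<comment> \<open>It remains to exclude that the circuit leaves the common triangle through the edge by which it
      comes back: this would identify an edge with its reverse, turn back inside a triangle, or give a shorter
      repetition, according as n is one, two or larger.\<close>
    moreover have "\<not> C (d (i0 + 1)) \<approx> ?z"
    proof
      assume a: "C (d (i0 + 1)) \<approx> ?z"
      then have b: "d (i0 + 1) \<approx> C ?z"
        using cross_cross[OF d] move_cong eq_sym eq_trans by blast
      show False
      proof (cases "n = 1")
        case True
        then show False using b cross_free by simp
      next
        case False
        have "same_triangle (d (i0 + 1)) (d (i0 + int n - 1))"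
          using b step[of "i0 + int n - 1"] eq_trans by (auto simp: same_triangle_def)
        then have "n = 2" using inj[of "i0 + 1" "i0 + int n - 1"] n False by (auto simp: I_def)
        then show False
          using step[of "i0 + 1"] b turn_free turn_turn_free d eq_trans
          by (metis add.assoc of_nat_numeral one_add_one)
      qed
    qed
    ultimately show ?thesis using True by (auto simp: same_triangle_def \<sigma>_def)
  qed (use step in \<open>auto simp: \<sigma>_def\<close>)
  then have "even_set {x. \<exists>i\<in>I. x \<approx> d i \<or> x \<approx> C (d i)}"
    using bij inj d by (intro even_set_strand) auto
  moreover have "d (i0 + 1) \<in> {x. \<exists>i\<in>I. x \<approx> d i \<or> x \<approx> C (d i)}"
    using n(1) d by (auto simp: I_def intro!: bexI[of _ "i0 + 1"])
  ultimately show ?thesis by blast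
qed

end


section \<open>Vertices, shears and twists\<close>

definition vertex :: "int^2^2 \<Rightarrow> qhat" where
  "vertex M = qfrac (M$1$1) (M$2$1)"

lemma vertex_mat2: "vertex (mat2 a b c d) = qfrac a c"
  by (simp add: vertex_def)

lemma qfrac_uminus: "qfrac (- p) (- q) = qfrac p q"
  by (simp add: qfrac_def)

lemma qfrac_eq_iff:
  assumes "coprime p q" "coprime p' q'"
  shows "qfrac p q = qfrac p' q' \<longleftrightarrow> p' = p \<and> q' = q \<or> p' = - p \<and> q' = - q"
proof
  assume eq: "qfrac p q = qfrac p' q'"
  have cross: "p * q' = p' * q"
  proof (cases "q = 0 \<or> q' = 0")
    case True
    then show ?thesis using eq by (auto simp: qfrac_def split: if_splits)
  next
    case False
    then have "(of_int (p * q') :: rat) = of_int (p' * q)"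
      using eq by (simp add: qfrac_def frac_eq_eq)
    then show ?thesis by (simp only: of_int_eq_iff)
  qed
  have "p dvd p'"
    using assms(1) cross by (metis coprime_dvd_mult_left_iff dvd_triv_left)
  moreover have "p' dvd p"
    using assms(2) cross by (metis coprime_dvd_mult_left_iff dvd_triv_left)
  ultimately have p: "p' = p \<or> p' = - p"
    by (metis zdvd_antisym_abs abs_eq_iff)
  have "q dvd q'"
    using assms(1) cross by (metis coprime_commute coprime_dvd_mult_right_iff dvd_triv_right)
  moreover have "q' dvd q"
    using assms(2) cross by (metis coprime_commute coprime_dvd_mult_right_iff dvd_triv_right)
  ultimately have q: "q' = q \<or> q' = - q"
    by (metis zdvd_antisym_abs abs_eq_iff)
  show "p' = p \<and> q' = q \<or> p' = - p \<and> q' = - q"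
    using p q cross by (elim disjE; simp; blast)
qed (auto simp: qfrac_uminus)

lemma coprime_column:
  assumes "a * d - b * c = (1 :: int)"
  shows "coprime a c" "coprime b d"
proof -
  have "z dvd 1" if "z dvd a" "z dvd c" for z
    unfolding assms[symmetric] using that by (intro dvd_diff dvd_mult2 dvd_mult)
  then show "coprime a c" by (simp add: coprime_def)
  have "z dvd 1" if "z dvd b" "z dvd d" for z
    unfolding assms[symmetric] using that by (intro dvd_diff dvd_mult2 dvd_mult)
  then show "coprime b d" by (simp add: coprime_def)
qed

lemma vertex_uminus [simp]: "vertex (- M) = vertex M"
  by (cases M) (simp add: vertex_mat2 qfrac_uminus)

lemma vertex_upto_sign: "M =\<^sub>\<plusminus> M' \<Longrightarrow> vertex M' = vertex M"
  by (auto simp: upto_sign_def)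

lemma vertex_mult:
  assumes "det A = 1" "det M = 1"
  shows "vertex (A ** M) = moebius A (vertex M)"
proof (cases A, cases M)
  fix a b c d e f g h
  assume *: "A = mat2 a b c d" "M = mat2 e f g h"
  have "coprime e g" using assms(2) * coprime_column by simp
  then show ?thesis using moebius_qfrac[of e g A] assms(1) * by (simp add: vertex_mat2)
qed

text \<open>
  Both edges start at the far end of the given edge.
\<close>

lemma vertex_turn: "vertex (M ** move_matrix Turn) = vertex (M ** move_matrix Cross)"
  by (cases M) (simp add: vertex_mat2)

lemma ex_vertex:
  assumes "coprime p q"
  obtains M where "det M = 1" "M$1$1 = p" "M$2$1 = q" "vertex M = qfrac p q"
proof -
  obtain u v where "u * p + v * q = 1"
    using bezout_int[of p q] assms by auto
  then have "det (mat2 p (- v) q u) = 1" by (simp add: algebra_simps)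
  then show thesis using that[of "mat2 p (- v) q u"] by (simp add: vertex_mat2)
qed

abbreviation shear :: "int \<Rightarrow> int^2^2" where
  "shear n \<equiv> mat2 1 n 0 1"

text \<open>
  Matrices with the same first column differ by a right factor that fixes the first basis vector.
\<close>

lemma same_vertex_shear:
  assumes "det M = 1" "det M' = 1" "vertex M = vertex M'"
  obtains n where "M' =\<^sub>\<plusminus> M ** shear n"
proof (cases M, cases M')
  fix a b c d a' b' c' d'
  assume *: "M = mat2 a b c d" "M' = mat2 a' b' c' d'"
  have det: "a * d - b * c = 1" "a' * d' - b' * c' = 1" using assms * by simp_all
  have "coprime a c" "coprime a' c'" using det coprime_column by blast+
  then have col: "a' = a \<and> c' = c \<or> a' = - a \<and> c' = - c"
    using assms(3) * by (simp add: vertex_mat2 qfrac_eq_iff)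
  have shear: "\<exists>n. e = b + n * a \<and> f = d + n * c" if "a * f - e * c = 1" for e f
  proof (intro exI conjI)
    \<comment> \<open>The witness is the upper right entry of the inverse of the first matrix times the second.\<close>
    show "e = b + (d * e - b * f) * a" using that det(1) by algebra
    show "f = d + (d * e - b * f) * c" using that det(1) by algebra
  qed
  show thesis
  proof (cases "a' = a \<and> c' = c")
    case True
    then obtain n where "b' = b + n * a \<and> d' = d + n * c" using shear det(2) by blast
    then have "M' = M ** shear n" using * True by (simp add: algebra_simps)
    then show thesis using that upto_sign_refl by metis
  next
    case False
    then have c: "a' = - a" "c' = - c" using col by auto
    then have "a * (- d') - (- b') * c = 1" using det(2) by simp
    then obtain n where "- b' = b + n * a \<and> - d' = d + n * c" using shear by blast
    then have "M ** shear n = - M'" using * c by (simp add: algebra_simps)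
    then have "M' =\<^sub>\<plusminus> M ** shear n" by (simp add: upto_sign_def)
    then show thesis using that by blast
  qed
qed

lemma farey_adj_matrix:
  assumes "farey_adj x y"
  obtains M where "det M = 1" "x = vertex M" "y = vertex (M ** move_matrix Cross)"
proof -
  from assms obtain p q r s where *: "x = qfrac p q" "y = qfrac r s" "\<bar>p * s - q * r\<bar> = 1"
    unfolding farey_adj_def by blast
  show thesis
  proof (cases "p * s - q * r = 1")
    case True
    show thesis
      by (rule that[of "mat2 p r q s"]) (use True * in \<open>simp_all add: vertex_mat2 mult.commute\<close>)
  next
    case False
    then have "q * r - p * s = 1" using * by linarith
    then show thesis
      by (intro that[of "mat2 p (- r) q (- s)"])
        (use * in \<open>simp_all add: vertex_mat2 qfrac_uminus mult.commute\<close>)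
  qed
qed

lemma carrier_SL2Z [simp]: "carrier SL2Z = {A. det A = 1}"
  and mult_SL2Z [simp]: "A \<otimes>\<^bsub>SL2Z\<^esub> B = A ** B"
  and one_SL2Z [simp]: "\<one>\<^bsub>SL2Z\<^esub> = mat 1"
  by (simp_all add: SL2Z_def)

lemma normal_DO: "DO k \<lhd> SL2Z"
  unfolding DO_def
  by (rule group.normal_closure_normal[OF group_SL2Z]) (simp add: det_2)

lemma DO_subgroup: "subgroup (DO k) SL2Z"
  using normal_DO normal_imp_subgroup by blast

lemma DO_det: "\<delta> \<in> DO k \<Longrightarrow> det \<delta> = 1"
  using subgroup.subset[OF DO_subgroup] by auto

text \<open>
  The $k$-th power of the parabolic element that fixes the vertex of \<open>M\<close>.
\<close>

definition twist :: "nat \<Rightarrow> int^2^2 \<Rightarrow> int^2^2" where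
  "twist k M = M ** shear (int k) ** inv\<^bsub>SL2Z\<^esub> M"

lemma SL2Z_inverse:
  assumes "det M = 1"
  shows "inv\<^bsub>SL2Z\<^esub> M ** M = mat 1" "M ** inv\<^bsub>SL2Z\<^esub> M = mat 1" "det (inv\<^bsub>SL2Z\<^esub> M) = 1"
  using assms group.l_inv[OF group_SL2Z, of M] group.r_inv[OF group_SL2Z, of M]
    group.inv_closed[OF group_SL2Z, of M] by auto

lemma twist_mult: "det M = 1 \<Longrightarrow> twist k M ** M = M ** shear (int k)"
  by (simp add: twist_def SL2Z_inverse flip: matrix_mul_assoc)

lemma det_twist [simp]: "det M = 1 \<Longrightarrow> det (twist k M) = 1"
  by (simp add: twist_def det_mul SL2Z_inverse)

lemma twist_in_DO:
  assumes "det M = 1"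
  shows "twist k M \<in> DO k"
proof -
  have "shear (int k) \<in> DO k"
    unfolding DO_def normal_closure_def mat2_def by auto
  then show ?thesis
    using normal.inv_op_closed2[OF normal_DO, of M "shear (int k)" k] assms by (simp add: twist_def)
qed

text \<open>
  The conjugates of the shear are the twists, so $D\mathcal{O}_k$ is not only normally generated,
  but generated by elements each of which fixes a vertex.
\<close>

lemma DO_minimal:
  assumes K: "subgroup K SL2Z" and twists: "\<And>M. det M = 1 \<Longrightarrow> twist k M \<in> K"
  shows "DO k \<subseteq> K"
proof -
  interpret SL2Z: group SL2Z by (rule group_SL2Z)
  let ?T = "{twist k M | M. det M = 1}"
  have T: "?T \<subseteq> carrier SL2Z" by auto
  have "generate SL2Z ?T \<lhd> SL2Z"
  proof (rule SL2Z.normal_generateI[OF T])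
    fix h g assume "h \<in> ?T" and g: "g \<in> carrier SL2Z"
    then obtain M where M: "h = twist k M" "det M = 1" by auto
    have "g \<otimes>\<^bsub>SL2Z\<^esub> h \<otimes>\<^bsub>SL2Z\<^esub> inv\<^bsub>SL2Z\<^esub> g = twist k (g ** M)"
      using g M by (simp add: twist_def matrix_mul_assoc SL2Z.inv_mult_group[of g M, simplified] det_mul)
    moreover have "det (g ** M) = 1" using g M by (simp add: det_mul)
    ultimately show "g \<otimes>\<^bsub>SL2Z\<^esub> h \<otimes>\<^bsub>SL2Z\<^esub> inv\<^bsub>SL2Z\<^esub> g \<in> ?T" by blast
  qed
  moreover have "shear (int k) \<in> generate SL2Z ?T"
  proof -
    have "twist k (mat 1) = shear (int k)"
      using SL2Z.inv_one by (simp add: twist_def)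
    then have "shear (int k) \<in> ?T" by (metis (mono_tags, lifting) det_I mem_Collect_eq)
    then show ?thesis by (rule generate.incl)
  qed
  ultimately have "DO k \<subseteq> generate SL2Z ?T"
    unfolding DO_def normal_closure_def mat2_def by auto
  also have "\<dots> \<subseteq> K"
    using K twists by (intro SL2Z.generate_subgroup_incl) auto
  finally show ?thesis .
qed

lemma inv_mat2:
  assumes "det (mat2 a b c d) = 1"
  shows "inv\<^bsub>SL2Z\<^esub> (mat2 a b c d) = mat2 d (- b) (- c) a"
  using assms by (intro group.inv_equality[OF group_SL2Z]) (auto simp: mat2_one algebra_simps)

lemma twist_mat2:
  assumes "det (mat2 a b c d) = 1"
  shows "twist k (mat2 a b c d) = mat2 (1 - int k * a * c) (int k * a\<^sup>2) (- int k * c\<^sup>2) (1 + int k * a * c)"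
  using assms by (simp add: twist_def inv_mat2 power2_eq_square algebra_simps)

text \<open>
  $D\mathcal{O}_k$ lies in the principal congruence subgroup of level \<open>k\<close>.
\<close>

lemma DO_cong:
  assumes "\<delta> \<in> DO k"
  shows "int k dvd \<delta>$1$1 - 1" "int k dvd \<delta>$1$2" "int k dvd \<delta>$2$1" "int k dvd \<delta>$2$2 - 1"
proof -
  define K :: "(int^2^2) set" where "K = {A. det A = 1 \<and> int k dvd A$1$1 - 1 \<and> int k dvd A$1$2 \<and> int k dvd A$2$1 \<and> int k dvd A$2$2 - 1}"
  have "subgroup K SL2Z"
  proof (rule group.subgroupI[OF group_SL2Z])
    show "K \<noteq> {}" by (auto simp: K_def mat2_one intro!: exI[of _ "mat2 1 0 0 1"])
    show "inv\<^bsub>SL2Z\<^esub> A \<in> K" if "A \<in> K" for A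
      using that by (cases A) (auto simp: K_def inv_mat2 mult.commute)
    show "A \<otimes>\<^bsub>SL2Z\<^esub> B \<in> K" if A: "A \<in> K" and B: "B \<in> K" for A B
    proof (cases A, cases B)
      fix a b c d e f g h
      assume *: "A = mat2 a b c d" "B = mat2 e f g h"
      have eqs: "a * e + b * g - 1 = (a - 1) * e + (e - 1) + b * g"
        "c * f + d * h - 1 = c * f + (d - 1) * h + (h - 1)"
        by (simp_all add: algebra_simps)
      have "int k dvd a * e + b * g - 1" "int k dvd c * f + d * h - 1"
        unfolding eqs using A B * by (auto simp: K_def intro!: dvd_add)
      moreover have "det (A ** B) = 1" using A B by (simp add: K_def det_mul)
      ultimately show ?thesis
        using A B * by (simp add: K_def dvd_add)
    qed
  qed (auto simp: K_def)
  moreover have "twist k M \<in> K" if "det M = 1" for M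
  proof (cases M)
    case (1 a b c d)
    have "det (twist k M) = 1" using that by simp
    then show ?thesis using that 1 by (auto simp: K_def twist_mat2)
  qed
  ultimately have "DO k \<subseteq> K" by (rule DO_minimal)
  with assms show "int k dvd \<delta>$1$1 - 1" "int k dvd \<delta>$1$2" "int k dvd \<delta>$2$1" "int k dvd \<delta>$2$2 - 1"
    by (auto simp: K_def)
qed


text \<open>
  Equality of oriented edges in the quotient surface.
\<close>

definition DO_equiv :: "nat \<Rightarrow> int^2^2 \<Rightarrow> int^2^2 \<Rightarrow> bool" where
  "DO_equiv k M M' \<longleftrightarrow> det M = 1 \<and> (\<exists>\<delta>\<in>DO k. M' =\<^sub>\<plusminus> \<delta> ** M)"

lemma one_in_subgroup: "subgroup H SL2Z \<Longrightarrow> mat 1 \<in> H"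
  and mult_in_subgroup: "subgroup H SL2Z \<Longrightarrow> A \<in> H \<Longrightarrow> B \<in> H \<Longrightarrow> A ** B \<in> H"
  and inv_in_subgroup: "subgroup H SL2Z \<Longrightarrow> A \<in> H \<Longrightarrow> inv\<^bsub>SL2Z\<^esub> A \<in> H"
  using subgroup.one_closed[of H SL2Z] subgroup.m_closed[of H SL2Z] subgroup.m_inv_closed[of H SL2Z]
  by auto

lemma DO_equiv_upto_sign: "M' =\<^sub>\<plusminus> M \<Longrightarrow> det M = 1 \<Longrightarrow> DO_equiv k M M'"
  using one_in_subgroup[OF DO_subgroup] unfolding DO_equiv_def by force

text \<open>
  Modulo \<open>k\<close> an element of $D\mathcal{O}_k$ acts trivially, whereas both \<open>Cross\<close> and \<open>Turn\<close>
  replace the first column of a matrix by its second. The columns would agree up to sign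
  modulo \<open>k\<close>, and the determinant would be divisible by \<open>k\<close>.
\<close>

lemma free_modular_action_DO:
  assumes "k \<ge> 2"
  shows "free_modular_action (DO_equiv k) (\<lambda>m M. M ** move_matrix m)"
proof
  have no_column: False
    if "DO_equiv k (mat2 a b c d) (mat2 b b' d d')" for a b c d b' d'
  proof -
    from that obtain \<delta> where det: "a * d - b * c = 1"
      and \<delta>: "\<delta> \<in> DO k" "mat2 b b' d d' =\<^sub>\<plusminus> \<delta> ** mat2 a b c d"
      by (auto simp: DO_equiv_def)
    obtain x y z w where xyzw: "\<delta> = mat2 x y z w" by (cases \<delta>)
    have dv: "int k dvd x - 1" "int k dvd y" "int k dvd z" "int k dvd w - 1"
      using DO_cong[OF \<delta>(1)] xyzw by auto
    have "b = x * a + y * c \<and> d = z * a + w * c \<or> - b = x * a + y * c \<and> - d = z * a + w * c"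
      using \<delta>(2) xyzw by (auto simp: upto_sign_def)
    then have "(a * z) * a + (a * c) * (w - 1) - (c * a) * (x - 1) - (c * c) * y \<in> {1, - 1}"
    proof
      assume "b = x * a + y * c \<and> d = z * a + w * c"
      then have bd: "b = x * a + y * c" "d = z * a + w * c" by auto
      show ?thesis using det unfolding bd by (simp add: algebra_simps)
    next
      assume "- b = x * a + y * c \<and> - d = z * a + w * c"
      then have bd: "b = - (x * a + y * c)" "d = - (z * a + w * c)" by auto
      show ?thesis using det unfolding bd by (simp add: algebra_simps)
    qed
    moreover have "int k dvd (a * z) * a + (a * c) * (w - 1) - (c * a) * (x - 1) - (c * c) * y"
      using dv by (intro dvd_add dvd_diff) auto
    ultimately have "int k dvd 1" by auto
    then show False using assms by simp
  qed
  show "\<not> DO_equiv k M (M ** move_matrix Cross)" "\<not> DO_equiv k M (M ** move_matrix Turn)" for M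
    by (cases M; simp; blast intro: no_column)+
next
  fix M M' :: "int^2^2"
  assume "DO_equiv k M M'"
  then obtain \<delta> where \<delta>: "\<delta> \<in> DO k" "M' =\<^sub>\<plusminus> \<delta> ** M" "det M = 1"
    by (auto simp: DO_equiv_def)
  have "inv\<^bsub>SL2Z\<^esub> \<delta> ** M' =\<^sub>\<plusminus> inv\<^bsub>SL2Z\<^esub> \<delta> ** (\<delta> ** M)"
    by (intro upto_sign_mult \<delta> upto_sign_refl)
  then have "M =\<^sub>\<plusminus> inv\<^bsub>SL2Z\<^esub> \<delta> ** M'"
    using SL2Z_inverse[OF DO_det[OF \<delta>(1)]] upto_sign_sym[of _ M] by (simp add: matrix_mul_assoc)
  moreover have "det M' = 1"
    using upto_sign_det[OF \<delta>(2)] DO_det[OF \<delta>(1)] \<delta>(3) by (simp add: det_mul)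
  ultimately show "DO_equiv k M' M"
    using inv_in_subgroup[OF DO_subgroup \<delta>(1)] by (auto simp: DO_equiv_def)
next
  fix M M' M'' :: "int^2^2"
  assume "DO_equiv k M M'" "DO_equiv k M' M''"
  then obtain \<delta> \<delta>' where \<delta>: "\<delta> \<in> DO k" "M' =\<^sub>\<plusminus> \<delta> ** M" "det M = 1" "\<delta>' \<in> DO k" "M'' =\<^sub>\<plusminus> \<delta>' ** M'"
    by (auto simp: DO_equiv_def)
  have "M'' =\<^sub>\<plusminus> \<delta>' ** \<delta> ** M"
    using upto_sign_trans[OF \<delta>(5) upto_sign_mult[OF upto_sign_refl \<delta>(2)]] by (simp add: matrix_mul_assoc)
  then show "DO_equiv k M M''"
    using mult_in_subgroup[OF DO_subgroup \<delta>(4,1)] \<delta>(3) by (auto simp: DO_equiv_def)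
next
  fix M M' m
  assume "DO_equiv k M M'"
  then show "DO_equiv k (M ** move_matrix m) (M' ** move_matrix m)"
    using upto_sign_mult[OF _ upto_sign_refl[of "move_matrix m"]]
    unfolding DO_equiv_def det_mul det_move_matrix matrix_mul_assoc by fastforce
next
  fix M assume "DO_equiv k M M"
  then have "det M = 1" by (simp add: DO_equiv_def)
  then show "DO_equiv k (M ** move_matrix Cross ** move_matrix Cross) M"
    "DO_equiv k (M ** move_matrix Turn ** move_matrix Turn ** move_matrix Turn) M"
    using upto_sign_sym[OF sl2.cross_cross[of M]] upto_sign_sym[OF sl2.turn_turn_turn[of M]]
    by (simp_all add: DO_equiv_upto_sign det_mul del: move_matrix.simps)
qed

text \<open>
  Simple connectivity of the Farey triangulation for coefficients modulo two: a cocycle \<open>S\<close>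
  is a coboundary. The value \<open>s M\<close> belongs to the initial vertex of the edge \<open>M\<close>; since both moves
  lead to an edge starting at the far end of \<open>M\<close>, both change it by the value of \<open>S\<close> at \<open>M\<close>.
\<close>

lemma ex_potential:
  assumes neg: "\<And>M. det M = 1 \<Longrightarrow> - M \<in> S \<longleftrightarrow> M \<in> S"
    and cross: "\<And>M. det M = 1 \<Longrightarrow> M ** move_matrix Cross \<in> S \<longleftrightarrow> M \<in> S"
    and turn: "\<And>M. det M = 1 \<Longrightarrow> M ** move_matrix Turn ** move_matrix Turn \<in> S \<longleftrightarrow>
      (M \<in> S) \<noteq> (M ** move_matrix Turn \<in> S)"
  obtains s :: "int^2^2 \<Rightarrow> bool"
  where "\<And>M M'. det M = 1 \<Longrightarrow> M =\<^sub>\<plusminus> M' \<Longrightarrow> s M' = s M"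
    and "\<And>M m. det M = 1 \<Longrightarrow> s (M ** move_matrix m) \<longleftrightarrow> s M \<noteq> (M \<in> S)"
proof -
  \<comment> \<open>The moves act on pairs of an edge and a bit, and the cocycle condition is what makes the third
    power of Turn trivial on the bit.\<close>
  define eq where "eq = (\<lambda>(M, s) (M', s'). det M = 1 \<and> M =\<^sub>\<plusminus> M' \<and> s = (s'::bool))"
  define move where "move = (\<lambda>m (M, s). (M ** move_matrix m, s \<noteq> (M \<in> S)))"
  have S_eq: "M' \<in> S \<longleftrightarrow> M \<in> S" if "det M = 1" "M =\<^sub>\<plusminus> M'" for M M'
    using that neg by (auto simp: upto_sign_def)
  interpret modular_action eq move
  proof
    fix x y z m
    show "eq x y \<Longrightarrow> eq y x"
      using upto_sign_sym[of "fst x" "fst y"]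
      by (cases x; cases y) (auto simp: eq_def dest: upto_sign_det)
    show "eq x y \<Longrightarrow> eq y z \<Longrightarrow> eq x z"
      using upto_sign_trans[of "fst x" "fst y" "fst z"]
      by (cases x; cases y; cases z) (auto simp: eq_def)
    show "eq x y \<Longrightarrow> eq (move m x) (move m y)"
      using S_eq[of "fst x" "fst y"] upto_sign_mult[of "fst x" "fst y" "move_matrix m" "move_matrix m"]
      by (cases x; cases y) (auto simp: eq_def move_def det_mul simp del: move_matrix.simps)
    show "eq (move Cross (move Cross x)) x" if "eq x x"
      using that cross sl2.cross_cross[of "fst x"]
      by (auto simp: eq_def move_def det_mul simp del: move_matrix.simps)
    show "eq (move Turn (move Turn (move Turn x))) x" if "eq x x"
      using that turn sl2.turn_turn_turn[of "fst x"]
      by (auto simp: eq_def move_def det_mul simp del: move_matrix.simps)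
  qed
  define x0 where "x0 = (mat 1 :: int^2^2, False)"
  have x0: "eq x0 x0" by (simp add: eq_def x0_def)
  have fst_move: "fst (move m x) = fst x ** move_matrix m"
    and snd_move: "snd (move m x) = (snd x \<noteq> (fst x \<in> S))" for m x
    by (simp_all add: move_def split: prod.splits)
  have fst_act: "fst (act w x) = fst x ** word_matrix w" for w x
    by (induction w arbitrary: x) (simp_all add: fst_move matrix_mul_assoc)
  define s where "s = (\<lambda>M. snd (act (SOME w. M =\<^sub>\<plusminus> word_matrix w) x0))"
  have s: "s M = snd (act w x0)" if "M =\<^sub>\<plusminus> word_matrix w" for M w
  proof -
    have "M =\<^sub>\<plusminus> word_matrix (SOME w. M =\<^sub>\<plusminus> word_matrix w)" using that by (rule someI)
    then have "eq (act (SOME w. M =\<^sub>\<plusminus> word_matrix w) x0) (act w x0)"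
      by (rule act_eq_if_matrix_eq[OF x0 upto_sign_trans[OF upto_sign_sym that]])
    then show ?thesis by (auto simp: s_def eq_def split: prod.splits)
  qed
  show thesis
  proof (rule that)
    fix M M' :: "int^2^2" assume "det M = 1" "M =\<^sub>\<plusminus> M'"
    then obtain w where "M =\<^sub>\<plusminus> word_matrix w" using ex_word_matrix by blast
    from s[OF upto_sign_trans[OF upto_sign_sym[OF \<open>M =\<^sub>\<plusminus> M'\<close>] this]] s[OF this]
    show "s M' = s M" by simp
  next
    fix M :: "int^2^2" and m assume det: "det M = 1"
    then obtain w where w: "M =\<^sub>\<plusminus> word_matrix w" using ex_word_matrix by blast
    then have "M ** move_matrix m =\<^sub>\<plusminus> word_matrix (w @ [m])"
      using upto_sign_mult[OF w upto_sign_refl] by (simp add: word_matrix_append)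
    then have "s (M ** move_matrix m) = snd (act (w @ [m]) x0)" by (rule s)
    also have "\<dots> = (snd (act w x0) \<noteq> (fst (act w x0) \<in> S))"
      by (simp add: act_append snd_move)
    also have "\<dots> = (s M \<noteq> (M \<in> S))"
      using s[OF w] S_eq[OF det w] by (simp add: fst_act) (simp add: x0_def)
    finally show "s (M ** move_matrix m) \<longleftrightarrow> s M \<noteq> (M \<in> S)" .
  qed
qed

lemma ex_biinfinite_chain:
  assumes "x \<in> B"
    and succ: "\<And>x. x \<in> B \<Longrightarrow> \<exists>y\<in>B. r x y" and pred: "\<And>y. y \<in> B \<Longrightarrow> \<exists>x\<in>B. r x y"
  shows "\<exists>d :: int \<Rightarrow> 'a. \<forall>i. d i \<in> B \<and> r (d i) (d (i + 1))"
proof -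
  obtain f where f: "\<And>x. x \<in> B \<Longrightarrow> f x \<in> B \<and> r x (f x)" using succ by metis
  obtain g where g: "\<And>y. y \<in> B \<Longrightarrow> g y \<in> B \<and> r (g y) y" using pred by metis
  have fB: "(f ^^ n) x \<in> B" and gB: "(g ^^ n) x \<in> B" for n
    by (induction n) (auto simp: assms(1) f g)
  define d where "d = (\<lambda>i::int. if i \<ge> 0 then (f ^^ nat i) x else (g ^^ nat (- i)) x)"
  have "r (d i) (d (i + 1))" for i
  proof (cases "i \<ge> 0")
    case True
    then have "nat (i + 1) = Suc (nat i)" by simp
    then show ?thesis using f[OF fB] True by (simp add: d_def)
  next
    case False
    then have "nat (- i) = Suc (nat (- (i + 1)))" by simp
    then have "d i = g ((g ^^ nat (- (i + 1))) x)" using False by (simp add: d_def)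
    moreover have "d (i + 1) = (g ^^ nat (- (i + 1))) x" using False by (simp add: d_def)
    ultimately show ?thesis using g[OF gB] by simp
  qed
  then show ?thesis using fB gB by (intro exI[of _ d]) (simp add: d_def)
qed


lemma ex_shear_in_subgroup:
  assumes H: "subgroup H SL2Z" and M: "det M = 1" "twist k M \<in> H"
  shows "\<exists>\<eta>\<in>H. \<eta> ** M = M ** shear (int k * j)"
proof (induction j rule: int_induct[where k = 0])
  case base
  show ?case using one_in_subgroup[OF H] by (intro bexI[of _ "mat 1"]) (simp_all flip: mat2_one)
next
  case (step1 j)
  then obtain \<eta> where \<eta>: "\<eta> \<in> H" "\<eta> ** M = M ** shear (int k * j)" by blast
  have "\<eta> ** twist k M ** M = \<eta> ** M ** shear (int k)"
    using M by (simp add: twist_mult flip: matrix_mul_assoc)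
  also have "\<dots> = M ** (shear (int k * j) ** shear (int k))"
    using \<eta> by (simp only: matrix_mul_assoc)
  also have "\<dots> = M ** shear (int k * (j + 1))" by (simp add: algebra_simps)
  finally show ?case using mult_in_subgroup[OF H \<eta>(1) M(2)] by blast
next
  case (step2 j)
  then obtain \<eta> where \<eta>: "\<eta> \<in> H" "\<eta> ** M = M ** shear (int k * j)" by blast
  let ?t = "inv\<^bsub>SL2Z\<^esub> (twist k M)"
  have t: "?t ** M = M ** shear (- int k)"
  proof -
    have "M ** shear (- int k) = ?t ** twist k M ** (M ** shear (- int k))"
      using M SL2Z_inverse(1)[of "twist k M"] by simp
    also have "\<dots> = ?t ** (twist k M ** M) ** shear (- int k)"
      by (simp only: matrix_mul_assoc)
    also have "\<dots> = ?t ** M ** (shear (int k) ** shear (- int k))"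
      using M by (simp only: twist_mult matrix_mul_assoc)
    also have "\<dots> = ?t ** M" by (simp flip: mat2_one)
    finally show ?thesis by simp
  qed
  have "\<eta> ** ?t ** M = \<eta> ** M ** shear (- int k)"
    using t by (simp flip: matrix_mul_assoc)
  also have "\<dots> = M ** (shear (int k * j) ** shear (- int k))"
    using \<eta> by (simp only: matrix_mul_assoc)
  also have "\<dots> = M ** shear (int k * (j - 1))" by (simp add: algebra_simps)
  finally show ?case using mult_in_subgroup[OF H \<eta>(1) inv_in_subgroup[OF H M(2)]] by blast
qed

text \<open>
  Comparison modulo \<open>k\<close> with the identity, to which \<open>\<delta>\<close> is congruent, shows that the exponent of the
  shear is divisible by \<open>k\<close>. The minus sign can occur only if \<open>k\<close> divides 2.
\<close>

lemma DO_vertex_stabilizer: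
  assumes \<delta>: "\<delta> \<in> DO k" and M: "det M = 1" "vertex (\<delta> ** M) = vertex M"
  obtains j where "\<delta> ** M =\<^sub>\<plusminus> M ** shear (int k * j)"
proof -
  obtain n where n: "\<delta> ** M =\<^sub>\<plusminus> M ** shear n"
    using same_vertex_shear[of M "\<delta> ** M"] M DO_det[OF \<delta>] by (auto simp: det_mul)
  obtain a b c d where abcd: "M = mat2 a b c d" by (cases M)
  obtain x y z w where xyzw: "\<delta> = mat2 x y z w" by (cases \<delta>)
  have det: "a * d - b * c = 1" using M abcd by simp
  have dv: "int k dvd x - 1" "int k dvd y" "int k dvd z" "int k dvd w - 1"
    using DO_cong[OF \<delta>] xyzw by auto
  define e f g h where "e = (x - 1) * a + y * c" and "f = (x - 1) * b + y * d"
    and "g = z * a + (w - 1) * c" and "h = z * b + (w - 1) * d"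
  have dvs: "int k dvd e" "int k dvd f" "int k dvd g" "int k dvd h"
    unfolding e_def f_def g_def h_def using dv by auto
  have "\<delta> ** M = mat2 (a + e) (b + f) (c + g) (d + h)"
    by (simp add: abcd xyzw e_def f_def g_def h_def algebra_simps)
  have n_eq: "n = (a * n) * d - b * (c * n)"
  proof -
    have "n = n * (a * d - b * c)" using det by simp
    then show ?thesis by (simp add: algebra_simps)
  qed
  from \<open>\<delta> ** M = _\<close> consider "a + e = a \<and> c + g = c \<and> b + f = a * n + b \<and> d + h = c * n + d"
    | "a + e = - a \<and> c + g = - c \<and> b + f = - (a * n + b) \<and> d + h = - (c * n + d)"
    using n abcd by (fastforce simp: upto_sign_def)
  then have "int k dvd n"
  proof cases
    case 1
    then have "int k dvd a * n" "int k dvd c * n" using dvs by auto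
    then show ?thesis using n_eq by (metis dvd_diff dvd_mult dvd_mult2)
  next
    case 2
    then have eqs: "2 * a = - e" "2 * c = - g" "a * n = - f - 2 * b" "c * n = - h - 2 * d" by auto
    \<comment> \<open>The first columns force k to divide 2, and then the multiples of 2 in the second columns vanish modulo k.\<close>
    have "2 = (2 * a) * d - b * (2 * c)" using det by simp
    also have "\<dots> = b * g - e * d" unfolding eqs by simp
    finally have "int k dvd 2" using dvs by (metis dvd_diff dvd_mult dvd_mult2)
    then have "int k dvd a * n" "int k dvd c * n" unfolding eqs using dvs by auto
    then show ?thesis using n_eq by (metis dvd_diff dvd_mult dvd_mult2)
  qed
  then show thesis using n that by (metis dvdE)
qed


section \<open>The translates of the lifted tree reach every vertex\<close>

text \<open>
  \<open>L\<close> is a connected subgraph of the Farey triangulation that contains exactly one vertex of each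
  orbit of $D\mathcal{O}_k$, and \<open>H\<close> a subgroup that contains the twists at the vertices of \<open>L\<close>.
\<close>

locale farey_lift =
  fixes k :: nat and L :: "(qhat, qhat set) mgraph" and H :: "(int^2^2) set"
  assumes k: "k \<ge> 2"
    and L: "subgraph L farey" "connected_graph L"
    and inj: "\<And>u v \<delta>. u \<in> verts L \<Longrightarrow> v \<in> verts L \<Longrightarrow> \<delta> \<in> DO k \<Longrightarrow> moebius \<delta> u = v \<Longrightarrow> u = v"
    and cover: "\<And>x. \<exists>\<delta>\<in>DO k. \<exists>v\<in>verts L. x = moebius \<delta> v"
    and H: "subgroup H SL2Z" "H \<subseteq> DO k"
    and twists: "\<And>M. det M = 1 \<Longrightarrow> vertex M \<in> verts L \<Longrightarrow> twist k M \<in> H"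
begin

interpretation free_modular_action "DO_equiv k" "\<lambda>m M. M ** move_matrix m"
  using k by (rule free_modular_action_DO)

definition reached :: "int^2^2 \<Rightarrow> bool" where
  "reached M \<longleftrightarrow> (\<exists>\<gamma>\<in>H. vertex (\<gamma> ** M) \<in> verts L)"

lemma H_det: "\<gamma> \<in> H \<Longrightarrow> det \<gamma> = 1"
  using H(2) DO_det by blast

lemma reached_vertex:
  assumes "det M = 1" "det M' = 1" "vertex M = vertex M'"
  shows "reached M \<longleftrightarrow> reached M'"
  unfolding reached_def using assms by (simp add: vertex_mult H_det cong: bex_cong_simp)

text \<open>
  A translate of \<open>L\<close> by $D\mathcal{O}_k$ is reached entirely or not at all: if \<open>\<gamma>\<delta>\<close> takes a
  vertex of \<open>L\<close> into \<open>L\<close>, it fixes that vertex, because \<open>L\<close> contains only one vertex of each orbit.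
  Being in the stabiliser, it is up to sign a power of a twist, hence an element of \<open>H\<close>.
\<close>

lemma reached_translate:
  assumes \<delta>: "\<delta> \<in> DO k" and M: "det M = 1" "vertex M \<in> verts L"
    and M': "det M' = 1" "vertex M' \<in> verts L" and r: "reached (\<delta> ** M)"
  shows "reached (\<delta> ** M')"
proof -
  from r obtain \<gamma> where \<gamma>: "\<gamma> \<in> H" "vertex (\<gamma> ** \<delta> ** M) \<in> verts L"
    by (auto simp: reached_def matrix_mul_assoc)
  have \<gamma>\<delta>: "\<gamma> ** \<delta> \<in> DO k" using \<gamma> \<delta> H(2) mult_in_subgroup[OF DO_subgroup] by blast
  have "vertex (\<gamma> ** \<delta> ** M) = vertex M"
    using inj[OF M(2) \<gamma>(2) \<gamma>\<delta>] vertex_mult[OF DO_det[OF \<gamma>\<delta>] M(1)] by simp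
  then obtain j where j: "\<gamma> ** \<delta> ** M =\<^sub>\<plusminus> M ** shear (int k * j)"
    using DO_vertex_stabilizer[OF \<gamma>\<delta> M(1)] by blast
  obtain \<eta> where \<eta>: "\<eta> \<in> H" "\<eta> ** M = M ** shear (int k * j)"
    using ex_shear_in_subgroup[OF H(1) M(1) twists[OF M]] by blast
  have "\<gamma> ** \<delta> =\<^sub>\<plusminus> \<eta>"
    using upto_sign_mult[OF j upto_sign_refl[of "inv\<^bsub>SL2Z\<^esub> M"]] SL2Z_inverse(2)[OF M(1)]
    unfolding \<eta>(2)[symmetric] by (simp flip: matrix_mul_assoc)
  then have "inv\<^bsub>SL2Z\<^esub> \<eta> ** (\<gamma> ** \<delta>) ** M' =\<^sub>\<plusminus> inv\<^bsub>SL2Z\<^esub> \<eta> ** \<eta> ** M'"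
    by (intro upto_sign_mult upto_sign_refl)
  then have "vertex (inv\<^bsub>SL2Z\<^esub> \<eta> ** \<gamma> ** (\<delta> ** M')) = vertex M'"
    using SL2Z_inverse(1)[OF H_det[OF \<eta>(1)]] vertex_upto_sign by (fastforce simp: matrix_mul_assoc)
  then show ?thesis
    using M'(2) mult_in_subgroup[OF H(1) inv_in_subgroup[OF H(1) \<eta>(1)] \<gamma>(1)]
    unfolding reached_def by metis
qed

lemma walk_invariant:
  assumes "walk L u p w" "P u"
    and "\<And>x y. P x \<Longrightarrow> x \<in> verts L \<Longrightarrow> y \<in> verts L \<Longrightarrow> {x, y} \<in> edges L \<Longrightarrow> P y"
  shows "P w"
  using assms(1,2)
proof (induction p arbitrary: u)
  case (Cons ev p)
  obtain e v where ev: "ev = (e, v)" by (cases ev)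
  have e: "e \<in> edges L" "ends L e = {u, v}" "walk L v p w" "u \<in> verts L"
    using Cons.prems ev by auto
  then have "ends L e = e" "ends L e \<subseteq> verts L"
    using L(1) by (auto simp: subgraph_def farey_def)
  then have "P v" using assms(3)[of u v] e Cons.prems by auto
  then show ?case using Cons.IH e by blast
qed simp

lemma edge_matrix:
  assumes "{x, y} \<in> edges L"
  obtains M where "det M = 1" "x = vertex M" "y = vertex (M ** move_matrix Cross)"
proof -
  obtain x' y' where "{x, y} = {x', y'}" "farey_adj x' y'"
    using assms L(1) by (auto simp: subgraph_def farey_def)
  moreover from this obtain M where "det M = 1" "x' = vertex M" "y' = vertex (M ** move_matrix Cross)"
    using farey_adj_matrix by blast
  ultimately show thesis
    using that[of M] that[of "M ** move_matrix Cross"] vertex_upto_sign[OF sl2.cross_cross[of M]]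
    by (auto simp: doubleton_eq_iff det_mul simp del: move_matrix.simps)
qed

abbreviation (input) cross where "cross M \<equiv> M ** move_matrix Cross"
abbreviation (input) turn where "turn M \<equiv> M ** move_matrix Turn"

definition bichromatic :: "(int^2^2) set" where
  "bichromatic = {M. det M = 1 \<and> reached M \<and> \<not> reached (cross M)}"

text \<open>
  The Farey graph is connected, so somewhere a reached vertex is joined to an unreached one.
\<close>

lemma bichromatic_nonempty:
  assumes "det M0 = 1" "\<not> reached M0"
  shows "bichromatic \<noteq> {}"
proof
  assume empty: "bichromatic = {}"
  obtain v where "v \<in> verts L" using L(2) by (auto simp: connected_graph_def)
  moreover obtain p q where "coprime p q" "v = qfrac p q" using qfrac_surj by blast
  ultimately obtain M1 where M1: "det M1 = 1" "vertex M1 \<in> verts L"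
    using ex_vertex by metis
  have step: "reached (M ** move_matrix m)" if "det M = 1" "reached M" for M m
  proof -
    have "reached (cross M)" using that empty by (auto simp: bichromatic_def)
    moreover have "reached (turn M) = reached (cross M)"
      using that by (intro reached_vertex) (simp_all add: det_mul vertex_turn del: move_matrix.simps)
    ultimately show ?thesis by (cases m) auto
  qed
  have all: "reached (M ** word_matrix w)" if "det M = 1" "reached M" for M w
    using that
  proof (induction w arbitrary: M)
    case (Cons m w)
    have "reached (M ** move_matrix m ** word_matrix w)"
      using Cons.prems step by (intro Cons.IH) (simp_all add: det_mul)
    then show ?case by (simp add: matrix_mul_assoc)
  qed simp
  have "reached M1"
    using M1 one_in_subgroup[OF H(1)] by (auto simp: reached_def intro!: bexI[of _ "mat 1"])
  obtain w where w: "inv\<^bsub>SL2Z\<^esub> M1 ** M0 =\<^sub>\<plusminus> word_matrix w"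
    using ex_word_matrix[of "inv\<^bsub>SL2Z\<^esub> M1 ** M0"] SL2Z_inverse[OF M1(1)] assms(1) by (auto simp: det_mul)
  have "M1 ** (inv\<^bsub>SL2Z\<^esub> M1 ** M0) =\<^sub>\<plusminus> M1 ** word_matrix w"
    by (intro upto_sign_mult w upto_sign_refl)
  then have "vertex (M1 ** word_matrix w) = vertex M0"
    using SL2Z_inverse(2)[OF M1(1)] vertex_upto_sign by (fastforce simp: matrix_mul_assoc)
  then have "reached M0"
    using all[OF M1(1) \<open>reached M1\<close>, of w] reached_vertex[of "M1 ** word_matrix w" M0] M1(1) assms(1)
    by (simp add: det_mul)
  then show False using assms(2) by simp
qed

lemma vertex_turn_turn_turn: "vertex (turn (turn (turn M))) = vertex M"
  and vertex_cross_cross: "vertex (cross (cross M)) = vertex M"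
  using sl2.turn_turn_turn[of M] sl2.cross_cross[of M] vertex_upto_sign by (metis upto_sign_refl)+

text \<open>
  The edge \<open>M'\<close> is reached from \<open>M\<close> by traversing the triangle of \<open>M\<close>: the reverse of \<open>M'\<close> is
  one of the two other edges of this triangle.
\<close>

definition next_edge :: "int^2^2 \<Rightarrow> int^2^2 \<Rightarrow> bool" where
  "next_edge M M' \<longleftrightarrow> DO_equiv k (cross M') (turn M) \<or> DO_equiv k (cross M') (turn (turn M))"

text \<open>
  The third vertex of the triangle is reached or not. In either case exactly one of the two other
  edges has ends of both kinds, and it is taken with its reached end first.
\<close>

lemma next_edge_exists:
  assumes "M \<in> bichromatic"
  shows "\<exists>M'\<in>bichromatic. next_edge M M'"
proof -
  have M: "det M = 1" "reached M" "\<not> reached (cross M)" using assms by (auto simp: bichromatic_def)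
  have eq: "DO_equiv k (cross (cross N)) N" if "det N = 1" for N
    using that upto_sign_sym[OF sl2.cross_cross[of N]]
    by (intro DO_equiv_upto_sign) (simp_all add: det_mul del: move_matrix.simps)
  note [simp] = det_mul and [simp del] = move_matrix.simps
  show ?thesis
  proof (cases "reached (turn (turn M))")
    case True
    have "reached (cross (turn M))"
      using True reached_vertex[of "cross (turn M)" "turn (turn M)"] M(1) by (simp add: vertex_turn)
    moreover have "\<not> reached (cross (cross (turn M)))"
      using M reached_vertex[of "cross (cross (turn M))" "cross M"] by (simp add: vertex_cross_cross vertex_turn)
    ultimately have "cross (turn M) \<in> bichromatic" using M(1) by (simp add: bichromatic_def)
    then show ?thesis using eq M(1) by (intro bexI[of _ "cross (turn M)"]) (auto simp: next_edge_def)
  next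
    case False
    have "reached (cross (turn (turn M)))"
      using M(1,2) reached_vertex[of "cross (turn (turn M))" M] vertex_turn_turn_turn[of M] by (simp add: vertex_turn)
    moreover have "\<not> reached (cross (cross (turn (turn M))))"
      using False M(1) reached_vertex[of "cross (cross (turn (turn M)))" "turn (turn M)"] by (simp add: vertex_cross_cross)
    ultimately have "cross (turn (turn M)) \<in> bichromatic" using M(1) by (simp add: bichromatic_def)
    then show ?thesis using eq M(1)
      by (intro bexI[of _ "cross (turn (turn M))"]) (auto simp: next_edge_def)
  qed
qed

lemma previous_edge_exists:
  assumes "M \<in> bichromatic"
  shows "\<exists>M'\<in>bichromatic. next_edge M' M"
proof -
  have M: "det M = 1" "reached M" "\<not> reached (cross M)" using assms by (auto simp: bichromatic_def)
  have eq: "DO_equiv k N (turn (turn (turn N)))" if "det N = 1" for N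
    using that sl2.turn_turn_turn[of N]
    by (intro DO_equiv_upto_sign) (simp_all add: det_mul del: move_matrix.simps)
  note [simp] = det_mul and [simp del] = move_matrix.simps
  show ?thesis
  proof (cases "reached (turn (turn (cross M)))")
    case True
    have "\<not> reached (cross (turn (turn (cross M))))"
      using M(1,3) reached_vertex[of "cross (turn (turn (cross M)))" "cross M"] vertex_turn_turn_turn[of "cross M"]
      by (simp add: vertex_turn)
    then have "turn (turn (cross M)) \<in> bichromatic" using M(1) True by (simp add: bichromatic_def)
    then show ?thesis using eq M(1)
      by (intro bexI[of _ "turn (turn (cross M))"]) (auto simp: next_edge_def)
  next
    case False
    have "reached (turn (cross M))"
      using M(1,2) reached_vertex[of "turn (cross M)" M] by (simp add: vertex_turn vertex_cross_cross)
    moreover have "\<not> reached (cross (turn (cross M)))"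
      using False M(1) reached_vertex[of "cross (turn (cross M))" "turn (turn (cross M))"] by (simp add: vertex_turn)
    ultimately have "turn (cross M) \<in> bichromatic" using M(1) by (simp add: bichromatic_def)
    then show ?thesis using eq M(1)
      by (intro bexI[of _ "turn (cross M)"]) (auto simp: next_edge_def)
  qed
qed

text \<open>
  An edge of the quotient cannot be represented both by an edge joining two vertices of \<open>L\<close> and by
  one with a reached and an unreached end, as translates of \<open>L\<close> are reached entirely or not at all.
\<close>

lemma edge_not_bichromatic:
  assumes "det M = 1" "vertex M \<in> verts L" "vertex (cross M) \<in> verts L"
    and "M' \<in> bichromatic" "DO_equiv k M M' \<or> DO_equiv k M (cross M')"
  shows False
proof -
  have M': "det M' = 1" "reached M'" "\<not> reached (cross M')"
    using assms(4) by (auto simp: bichromatic_def)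
  note [simp] = det_mul DO_det and [simp del] = move_matrix.simps
  have translate: "reached (\<delta> ** M) \<longleftrightarrow> reached (\<delta> ** cross M)" if "\<delta> \<in> DO k" for \<delta>
    using that assms(1-3) reached_translate by (metis det_move_matrix det_mul mult_1)
  from assms(5) show False
  proof
    assume "DO_equiv k M M'"
    then obtain \<delta> where \<delta>: "\<delta> \<in> DO k" "M' =\<^sub>\<plusminus> \<delta> ** M" by (auto simp: DO_equiv_def)
    have "cross M' =\<^sub>\<plusminus> \<delta> ** cross M"
      using upto_sign_mult[OF \<delta>(2) upto_sign_refl] by (simp add: matrix_mul_assoc)
    then have "reached (cross M') \<longleftrightarrow> reached (\<delta> ** cross M)"
      using \<delta>(1) M'(1) assms(1) by (intro reached_vertex) (auto dest: vertex_upto_sign)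
    moreover have "reached M' \<longleftrightarrow> reached (\<delta> ** M)"
      using \<delta> M'(1) assms(1) by (intro reached_vertex) (auto dest: vertex_upto_sign)
    ultimately show False using M' translate[OF \<delta>(1)] by blast
  next
    assume "DO_equiv k M (cross M')"
    then obtain \<delta> where \<delta>: "\<delta> \<in> DO k" "cross M' =\<^sub>\<plusminus> \<delta> ** M" by (auto simp: DO_equiv_def)
    have "cross (cross M') =\<^sub>\<plusminus> \<delta> ** cross M"
      using upto_sign_mult[OF \<delta>(2) upto_sign_refl] by (simp add: matrix_mul_assoc)
    then have "reached M' \<longleftrightarrow> reached (\<delta> ** cross M)"
      using \<delta>(1) M'(1) assms(1) vertex_cross_cross[of M'] by (intro reached_vertex) (auto dest: vertex_upto_sign)
    moreover have "reached (cross M') \<longleftrightarrow> reached (\<delta> ** M)"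
      using \<delta> M'(1) assms(1) by (intro reached_vertex) (auto dest: vertex_upto_sign)
    ultimately show False using M' translate[OF \<delta>(1)] by blast
  qed
qed

text \<open>
  The quotient surface has no cohomology in degree one modulo two: the potential of the cocycle
  is invariant under each twist, which fixes a vertex, and therefore under $D\mathcal{O}_k$. If the
  cocycle vanishes on \<open>L\<close>, the potential is constant on \<open>L\<close>, and hence everywhere.
\<close>

lemma even_set_avoiding_edges_empty:
  assumes S: "even_set S"
    and avoid: "\<And>M. M \<in> S \<Longrightarrow> vertex M \<in> verts L \<Longrightarrow> vertex (cross M) \<in> verts L \<Longrightarrow> False"
  shows "S = {}"
proof -
  note [simp] = det_mul DO_det and [simp del] = move_matrix.simps
  have refl: "DO_equiv k M M" if "det M = 1" for M
    using that by (simp add: DO_equiv_upto_sign)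
  have S_eq: "M \<in> S \<longleftrightarrow> M' \<in> S" if "DO_equiv k M M'" for M M'
    using S that eq_sym[OF that] unfolding even_set_def by blast
  obtain s :: "int^2^2 \<Rightarrow> bool" where s_sign: "\<And>M M'. det M = 1 \<Longrightarrow> M =\<^sub>\<plusminus> M' \<Longrightarrow> s M' = s M"
    and s_move: "\<And>M m. det M = 1 \<Longrightarrow> s (M ** move_matrix m) \<longleftrightarrow> s M \<noteq> (M \<in> S)"
  proof (rule ex_potential[of S])
    fix M :: "int^2^2" assume M: "det M = 1"
    show "- M \<in> S \<longleftrightarrow> M \<in> S"
      by (rule S_eq) (simp add: DO_equiv_upto_sign M upto_sign_def)
    show "cross M \<in> S \<longleftrightarrow> M \<in> S" "turn (turn M) \<in> S \<longleftrightarrow> (M \<in> S) \<noteq> (turn M \<in> S)"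
      using S refl[OF M] unfolding even_set_def by blast+
  qed blast
  \<comment> \<open>The shear consists of two turns and a crossing; along these the potential changes by the sum of
    the cocycle over the three edges of a triangle, which is zero.\<close>
  have s_shear1: "s (M ** shear 1) = s M" if M: "det M = 1" for M
  proof -
    have "M ** shear 1 =\<^sub>\<plusminus> cross (turn (turn M))"
      by (cases M) (simp add: upto_sign_def move_matrix.simps)
    then have "s (M ** shear 1) = s (cross (turn (turn M)))"
      using M by (intro s_sign[symmetric]) auto
    then show ?thesis
      using M S refl[OF M] unfolding even_set_def by (auto simp: s_move)
  qed
  have s_shear: "s (M ** shear n) = s M" if M: "det M = 1" for M n
  proof (induction n rule: int_induct[where k = 0])
    case (step1 n)
    have "M ** shear (n + 1) = M ** shear n ** shear 1"
      by (simp add: algebra_simps flip: matrix_mul_assoc)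
    then show ?case using step1 s_shear1[of "M ** shear n"] M by simp
  next
    case (step2 n)
    have "M ** shear n = M ** shear (n - 1) ** shear 1"
      by (simp flip: matrix_mul_assoc)
    then show ?case using step2 s_shear1[of "M ** shear (n - 1)"] M by simp
  qed (simp flip: mat2_one)
  have s_vertex: "s M = s M'" if M: "det M = 1" "det M' = 1" "vertex M = vertex M'" for M M'
  proof -
    obtain n where "M' =\<^sub>\<plusminus> M ** shear n" using same_vertex_shear[OF M] by blast
    from s_sign[OF _ this] s_shear[OF M(1), of n] M show ?thesis by simp
  qed
  \<comment> \<open>The difference of the potential and its translate is constant, because S is invariant.
    It vanishes at the vertex that the twist fixes.\<close>
  have s_twist: "s (\<delta> ** M) = s M" if \<delta>: "\<delta> \<in> DO k" "\<delta> = twist k N" and M: "det M = 1" "det N = 1" for \<delta> M N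
  proof -
    have word: "(s (\<delta> ** A ** word_matrix w) = s (A ** word_matrix w)) = (s (\<delta> ** A) = s A)" if "det A = 1" for A w
      using that
    proof (induction w arbitrary: A)
      case (Cons m w)
      have "A \<in> S \<longleftrightarrow> \<delta> ** A \<in> S"
        using \<delta>(1) Cons.prems by (intro S_eq) (auto simp: DO_equiv_def intro!: bexI[of _ \<delta>])
      then have "(s (\<delta> ** (A ** move_matrix m)) = s (A ** move_matrix m)) = (s (\<delta> ** A) = s A)"
        using \<delta>(1) Cons.prems by (auto simp: matrix_mul_assoc s_move)
      then show ?case using Cons.IH[of "A ** move_matrix m"] Cons.prems by (simp add: matrix_mul_assoc)
    qed simp
    obtain w where w: "inv\<^bsub>SL2Z\<^esub> N ** M =\<^sub>\<plusminus> word_matrix w"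
      using ex_word_matrix[of "inv\<^bsub>SL2Z\<^esub> N ** M"] SL2Z_inverse[OF M(2)] M(1) by auto
    have M_w: "M =\<^sub>\<plusminus> N ** word_matrix w"
      using upto_sign_mult[OF upto_sign_refl[of N] w] SL2Z_inverse(2)[OF M(2)] by (simp add: matrix_mul_assoc)
    have "\<delta> ** N = N ** shear (int k)" using twist_mult[OF M(2)] \<delta>(2) by simp
    then have "s (\<delta> ** N) = s N" using s_shear M(2) by simp
    then have "s (\<delta> ** (N ** word_matrix w)) = s (N ** word_matrix w)"
      using word[OF M(2), of w] by (simp add: matrix_mul_assoc)
    then show ?thesis
      using s_sign[OF _ M_w] s_sign[OF _ upto_sign_mult[OF upto_sign_refl[of \<delta>] M_w]] M(1) \<delta>(1) by simp
  qed
  have s_DO: "s (\<delta> ** M) = s M" if "\<delta> \<in> DO k" "det M = 1" for \<delta> M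
  proof -
    define K where "K = {\<delta> \<in> DO k. \<forall>M. det M = 1 \<longrightarrow> s (\<delta> ** M) = s M}"
    have "subgroup K SL2Z"
    proof (rule group.subgroupI[OF group_SL2Z])
      show "K \<noteq> {}" using one_in_subgroup[OF DO_subgroup, of k] by (auto simp: K_def)
      show "inv\<^bsub>SL2Z\<^esub> \<delta> \<in> K" if "\<delta> \<in> K" for \<delta>
      proof -
        have "s (inv\<^bsub>SL2Z\<^esub> \<delta> ** M) = s M" if M: "det M = 1" for M
        proof -
          have "s (\<delta> ** (inv\<^bsub>SL2Z\<^esub> \<delta> ** M)) = s (inv\<^bsub>SL2Z\<^esub> \<delta> ** M)"
            using \<open>\<delta> \<in> K\<close> M SL2Z_inverse(3)[of \<delta>] DO_det[of \<delta> k] by (auto simp: K_def)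
          then show ?thesis using \<open>\<delta> \<in> K\<close> SL2Z_inverse(2)[of \<delta>] DO_det[of \<delta> k] by (simp add: matrix_mul_assoc K_def)
        qed
        then show ?thesis using that inv_in_subgroup[OF DO_subgroup] by (simp add: K_def)
      qed
      show "\<delta> \<otimes>\<^bsub>SL2Z\<^esub> \<delta>' \<in> K" if "\<delta> \<in> K" "\<delta>' \<in> K" for \<delta> \<delta>'
        using that mult_in_subgroup[OF DO_subgroup] by (auto simp: K_def simp flip: matrix_mul_assoc)
    qed (auto simp: K_def)
    moreover have "twist k N \<in> K" if "det N = 1" for N
      using that twist_in_DO s_twist by (simp add: K_def)
    ultimately have "DO k \<subseteq> K" by (rule DO_minimal)
    then show ?thesis using that by (auto simp: K_def)
  qed
  obtain v0 where v0: "v0 \<in> verts L" using L(2) by (auto simp: connected_graph_def)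
  obtain p q where "coprime p q" "v0 = qfrac p q" using qfrac_surj by blast
  then obtain M0 where M0: "det M0 = 1" "vertex M0 = v0" using ex_vertex by metis
  have s_L: "\<forall>M. det M = 1 \<longrightarrow> vertex M = v \<longrightarrow> s M = s M0" if v: "v \<in> verts L" for v
  proof -
    obtain w where "walk L v0 w v" using L(2) v v0 by (auto simp: connected_graph_def)
    then show ?thesis
    proof (rule walk_invariant)
      show "\<forall>M. det M = 1 \<longrightarrow> vertex M = v0 \<longrightarrow> s M = s M0" using s_vertex M0 by metis
      fix x y
      assume IH: "\<forall>M. det M = 1 \<longrightarrow> vertex M = x \<longrightarrow> s M = s M0"
        and xy: "x \<in> verts L" "y \<in> verts L" "{x, y} \<in> edges L"
      obtain M where M: "det M = 1" "x = vertex M" "y = vertex (cross M)"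
        using edge_matrix[OF xy(3)] by blast
      have "M \<notin> S" using avoid[of M] xy M by blast
      then have "s (cross M) = s M0" using IH M s_move[of M Cross] by simp
      then show "\<forall>N. det N = 1 \<longrightarrow> vertex N = y \<longrightarrow> s N = s M0"
        using s_vertex[of "cross M"] M by auto
    qed
  qed
  have s_const: "s M = s M0" if M: "det M = 1" for M
  proof -
    obtain \<delta> v where \<delta>: "\<delta> \<in> DO k" "v \<in> verts L" "vertex M = moebius \<delta> v" using cover by blast
    obtain p q where "coprime p q" "v = qfrac p q" using qfrac_surj by blast
    then obtain N where N: "det N = 1" "vertex N = v" using ex_vertex by metis
    have "s M = s (\<delta> ** N)"
      using M N \<delta> by (intro s_vertex) (auto simp: vertex_mult)
    also have "\<dots> = s N" using s_DO \<delta> N by simp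
    also have "\<dots> = s M0" using s_L \<delta> N by simp
    finally show ?thesis .
  qed
  show ?thesis
  proof (rule ccontr)
    assume "S \<noteq> {}"
    then obtain M where "M \<in> S" "det M = 1" using S by (auto simp: even_set_def DO_equiv_def)
    then show False using s_move[of M Cross] s_const[of M] s_const[of "cross M"] by simp
  qed
qed

text \<open>
  Otherwise the line across the edges with one reached and one unreached end would yield
  a nonempty even set in the quotient surface that avoids the image of \<open>L\<close>.
\<close>

theorem H_transitive_on_lifts:
  "\<exists>\<gamma>\<in>H. \<exists>v\<in>verts L. x = moebius \<gamma> v"
proof -
  obtain p q where "coprime p q" "x = qfrac p q" using qfrac_surj by blast
  then obtain M where M: "det M = 1" "vertex M = x" using ex_vertex by metis
  have "reached M"
  proof (rule ccontr)
    assume "\<not> reached M"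
    then obtain M1 where "M1 \<in> bichromatic" using bichromatic_nonempty M by blast
    from ex_biinfinite_chain[of M1 bichromatic next_edge, OF this next_edge_exists previous_edge_exists]
    obtain d :: "int \<Rightarrow> int^2^2" where d: "\<And>i. d i \<in> bichromatic" "\<And>i. next_edge (d i) (d (i + 1))"
      by blast
    have "DO_equiv k (d i) (d i)" for i
      using d(1)[of i] by (auto simp: bichromatic_def intro: DO_equiv_upto_sign)
    then obtain S where S: "even_set S" "S \<noteq> {}"
      "\<And>M. M \<in> S \<Longrightarrow> \<exists>i. DO_equiv k M (d i) \<or> DO_equiv k M (cross (d i))"
      using ex_even_set_along_line[of d] d(2) unfolding next_edge_def by blast
    have "S = {}"
    proof (rule even_set_avoiding_edges_empty[OF S(1)])
      fix M assume M: "M \<in> S" "vertex M \<in> verts L" "vertex (cross M) \<in> verts L"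
      then have "det M = 1" using S(1) by (auto simp: even_set_def DO_equiv_def)
      with M S(3)[OF M(1)] d(1) show False using edge_not_bichromatic by blast
    qed
    with S(2) show False by simp
  qed
  then obtain \<gamma> where \<gamma>: "\<gamma> \<in> H" "vertex (\<gamma> ** M) \<in> verts L" by (auto simp: reached_def)
  have "moebius (inv\<^bsub>SL2Z\<^esub> \<gamma>) (vertex (\<gamma> ** M)) = vertex (inv\<^bsub>SL2Z\<^esub> \<gamma> ** (\<gamma> ** M))"
    using SL2Z_inverse(3) H_det[OF \<gamma>(1)] M(1) by (simp add: vertex_mult det_mul)
  also have "\<dots> = x"
    using SL2Z_inverse(1)[OF H_det[OF \<gamma>(1)]] M(2) by (simp add: matrix_mul_assoc)
  finally show ?thesis using \<gamma> inv_in_subgroup[OF H(1)] by metis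
qed

end


section \<open>Pairs of elements of a group\<close>

context group
begin

definition conj_by :: "'a \<Rightarrow> 'a \<Rightarrow> 'a" where
  "conj_by x y = x \<otimes> y \<otimes> inv x"

lemma conj_by_closed [simp]: "x \<in> carrier G \<Longrightarrow> y \<in> carrier G \<Longrightarrow> conj_by x y \<in> carrier G"
  by (simp add: conj_by_def)

lemma conj_by_mult:
  "x \<in> carrier G \<Longrightarrow> y \<in> carrier G \<Longrightarrow> z \<in> carrier G \<Longrightarrow>
    conj_by x (y \<otimes> z) = conj_by x y \<otimes> conj_by x z"
  by (simp add: conj_by_def m_assoc inv_solve_left)

lemma conj_by_inv:
  "x \<in> carrier G \<Longrightarrow> y \<in> carrier G \<Longrightarrow> conj_by x (inv y) = inv (conj_by x y)"
  by (simp add: conj_by_def inv_mult_group m_assoc)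

lemma conj_by_conj_by:
  "x \<in> carrier G \<Longrightarrow> y \<in> carrier G \<Longrightarrow> z \<in> carrier G \<Longrightarrow> conj_by x (conj_by y z) = conj_by (x \<otimes> y) z"
  by (simp add: conj_by_def inv_mult_group m_assoc)

lemma conj_by_one [simp]: "y \<in> carrier G \<Longrightarrow> conj_by \<one> y = y"
  by (simp add: conj_by_def)

lemma conj_by_pow:
  "x \<in> carrier G \<Longrightarrow> y \<in> carrier G \<Longrightarrow> conj_by x (y [^] (n::nat)) = conj_by x y [^] n"
  by (induction n) (simp_all add: conj_by_mult, simp add: conj_by_def)

text \<open>
  The moves on pairs that correspond, under abelianization, to multiplication of the matrix with
  columns $g$, $h$ by the matrices of the moves.
\<close>

fun pair_move :: "farey_move \<Rightarrow> 'a \<times> 'a \<Rightarrow> 'a \<times> 'a" where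
  "pair_move Cross (g, h) = (h, inv g)"
| "pair_move Turn (g, h) = (h, inv (g \<otimes> h))"

text \<open>
  Inversion of both elements is included since \<open>Cross\<close> squares to it. Conjugation is included since
  \<open>Turn\<close> takes the inverted pair to $(h^{-1}, hg)$, which is not the inverted pair $(h^{-1}, gh)$
  of the image of $(g,h)$, but its conjugate by $h$.
\<close>

definition pair_eq :: "'a \<times> 'a \<Rightarrow> 'a \<times> 'a \<Rightarrow> bool" where
  "pair_eq = (\<lambda>(g, h) (g', h'). g \<in> carrier G \<and> h \<in> carrier G \<and> (\<exists>x\<in>carrier G.
     g' = conj_by x g \<and> h' = conj_by x h \<or> g' = conj_by x (inv g) \<and> h' = conj_by x (inv h)))"

lemma pair_eq_iff:
  "pair_eq (g, h) (g', h') \<longleftrightarrow> g \<in> carrier G \<and> h \<in> carrier G \<and> (\<exists>x\<in>carrier G.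
     g' = conj_by x g \<and> h' = conj_by x h \<or> g' = conj_by x (inv g) \<and> h' = conj_by x (inv h))"
  by (simp add: pair_eq_def)

lemma pair_eq_refl_iff: "pair_eq P P \<longleftrightarrow> fst P \<in> carrier G \<and> snd P \<in> carrier G"
  by (cases P) (auto simp: pair_eq_iff intro!: bexI[of _ \<one>])

lemma pair_eq_sym:
  assumes "pair_eq P P'"
  shows "pair_eq P' P"
proof -
  obtain g h g' h' where P: "P = (g, h)" "P' = (g', h')" by (cases P, cases P')
  then obtain x where x: "g \<in> carrier G" "h \<in> carrier G" "x \<in> carrier G"
    "g' = conj_by x g \<and> h' = conj_by x h \<or> g' = conj_by x (inv g) \<and> h' = conj_by x (inv h)"
    using assms by (auto simp: pair_eq_iff)
  have *: "conj_by (inv x) (conj_by x y) = y" "conj_by (inv x) (inv (conj_by x (inv y))) = y"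
    if "y \<in> carrier G" for y
    using that x(3) by (simp_all add: conj_by_conj_by flip: conj_by_inv)
  show ?thesis unfolding P pair_eq_iff
    using x * by (intro conjI bexI[of _ "inv x"]) auto
qed

lemma pair_eq_trans:
  assumes "pair_eq P P'" "pair_eq P' P''"
  shows "pair_eq P P''"
proof -
  obtain g h g' h' g'' h'' where P: "P = (g, h)" "P' = (g', h')" "P'' = (g'', h'')"
    by (cases P, cases P', cases P'')
  then obtain x y where x: "g \<in> carrier G" "h \<in> carrier G" "x \<in> carrier G"
    "g' = conj_by x g \<and> h' = conj_by x h \<or> g' = conj_by x (inv g) \<and> h' = conj_by x (inv h)"
    and y: "y \<in> carrier G"
    "g'' = conj_by y g' \<and> h'' = conj_by y h' \<or> g'' = conj_by y (inv g') \<and> h'' = conj_by y (inv h')"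
    using assms by (auto simp: pair_eq_iff)
  show ?thesis unfolding P pair_eq_iff
    using x y by (intro conjI bexI[of _ "y \<otimes> x"]) (auto simp: conj_by_inv conj_by_conj_by)
qed

lemma pair_move_cong:
  assumes "pair_eq P P'"
  shows "pair_eq (pair_move m P) (pair_move m P')"
proof -
  obtain g h g' h' where P: "P = (g, h)" "P' = (g', h')" by (cases P, cases P')
  then obtain x where x: "g \<in> carrier G" "h \<in> carrier G" "x \<in> carrier G"
    "g' = conj_by x g \<and> h' = conj_by x h \<or> g' = conj_by x (inv g) \<and> h' = conj_by x (inv h)"
    using assms by (auto simp: pair_eq_iff)
  show ?thesis
  proof (cases m)
    case Cross
    then show ?thesis using x P
      by (auto simp: pair_eq_iff conj_by_inv intro!: bexI[of _ x])
  next
    case Turn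
    from x(4) show ?thesis
    proof
      assume "g' = conj_by x g \<and> h' = conj_by x h"
      then show ?thesis using Turn x P
        by (auto simp: pair_eq_iff conj_by_inv conj_by_mult intro!: bexI[of _ x])
    next
      assume *: "g' = conj_by x (inv g) \<and> h' = conj_by x (inv h)"
      \<comment> \<open>Conjugation by h restores the order of the factors in the inverted pair.\<close>
      have "conj_by h (inv h) = inv h" "conj_by h (g \<otimes> h) = h \<otimes> g"
        using x by (simp_all add: conj_by_def m_assoc)
      then have "h' = conj_by (x \<otimes> h) (inv h)" "conj_by (x \<otimes> h) (g \<otimes> h) = conj_by x (h \<otimes> g)"
        using * x by (simp_all flip: conj_by_conj_by)
      moreover have "inv (g' \<otimes> h') = conj_by x (h \<otimes> g)"
        using * x by (simp add: inv_mult_group flip: conj_by_mult conj_by_inv)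
      ultimately show ?thesis using Turn x P
        by (auto simp: pair_eq_iff intro!: bexI[of _ "x \<otimes> h"])
    qed
  qed
qed

sublocale pairs: modular_action pair_eq pair_move
proof
  fix P assume P: "pair_eq P P"
  show "pair_eq (pair_move Cross (pair_move Cross P)) P"
    using P by (cases P) (auto simp: pair_eq_iff intro!: bexI[of _ \<one>])
  have "pair_move Turn (pair_move Turn (pair_move Turn P)) = P"
    using P by (cases P) (simp add: pair_eq_iff inv_mult_group m_assoc)
  then show "pair_eq (pair_move Turn (pair_move Turn (pair_move Turn P))) P" using P by simp
qed (use pair_eq_sym pair_eq_trans pair_move_cong in blast)+

end

section \<open>Lengths in the free group\<close>

text \<open>
  The length of the longest common prefix, which is the Gromov product of two vertices of the Cayley
  tree of $F_2$ with respect to the identity.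
\<close>

fun lcp :: "letter list \<Rightarrow> letter list \<Rightarrow> nat" where
  "lcp (l # u) (m # v) = (if l = m then Suc (lcp u v) else 0)"
| "lcp _ _ = 0"

lemma lcp_commute: "lcp u v = lcp v u"
  by (induction u v rule: lcp.induct) auto

lemma lcp_le: "lcp u v \<le> length u" "lcp u v \<le> length v"
  by (induction u v rule: lcp.induct) auto

lemma lcp_ultrametric: "min (lcp u v) (lcp v w) \<le> lcp u w"
proof (induction u w arbitrary: v rule: lcp.induct)
  case (1 l u m w)
  then show ?case by (cases v) auto
next
  case ("2_1" v) then show ?case by (cases v) auto
next
  case ("2_2" v) then show ?case by auto
qed

lemma lcp_ge_iff: "n \<le> lcp u v \<longleftrightarrow> n \<le> length u \<and> n \<le> length v \<and> take n u = take n v"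
proof (induction u v arbitrary: n rule: lcp.induct)
  case (1 l u m v)
  then show ?case by (cases n) auto
qed auto

interpretation F2: group F2
  by (rule group_F2)

lemma carrier_F2 [simp]: "carrier F2 = {w. reduced w}"
  and mult_F2: "u \<otimes>\<^bsub>F2\<^esub> v = foldr cons_red u v"
  and one_F2 [simp]: "\<one>\<^bsub>F2\<^esub> = []"
  by (simp_all add: F2_def)

lemma reduced_rev_flip: "reduced w \<Longrightarrow> reduced (rev (map flip w))"
  unfolding reduced_def successively_rev successively_map
  by (erule successively_mono) (metis flip_flip)

lemma inv_F2: "reduced w \<Longrightarrow> inv\<^bsub>F2\<^esub> w = rev (map flip w)"
  using foldr_inverse[of "[]" w] reduced_rev_flip[of w]
  by (intro F2.inv_equality) (auto simp: mult_F2 foldr_Nil)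

lemma length_inv_F2 [simp]: "reduced w \<Longrightarrow> length (inv\<^bsub>F2\<^esub> w) = length w"
  by (simp add: inv_F2)

lemma length_mult_F2:
  assumes "reduced u" "reduced v"
  shows "length (u \<otimes>\<^bsub>F2\<^esub> v) + 2 * lcp (inv\<^bsub>F2\<^esub> u) v = length u + length v"
  using assms
proof (induction u arbitrary: v rule: rev_induct)
  case (snoc l u)
  have u: "reduced u" "u \<noteq> [] \<Longrightarrow> l \<noteq> flip (last u)"
    using snoc.prems(1) by (auto simp: reduced_def successively_append_iff)
  show ?case
  proof (cases "\<exists>v'. v = flip l # v'")
    case True
    then obtain v' where v': "v = flip l # v'" by blast
    then have "reduced v'" using snoc.prems(2) by (simp add: reduced_Cons)
    then show ?thesis using snoc.IH[OF u(1), of v'] v' snoc.prems(1) u(1)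
      by (simp add: mult_F2 inv_F2)
  next
    case False
    then have "cons_red l v = l # v" by (cases v) auto
    moreover from this have "reduced (l # v)" using reduced_cons_red[OF snoc.prems(2), of l] by simp
    moreover have "lcp (rev (map flip u)) (l # v) = 0"
      using u(2) by (cases u rule: rev_cases) auto
    moreover have "lcp (flip l # rev (map flip u)) v = 0"
      using False by (cases v) auto
    ultimately show ?thesis using snoc.IH[OF u(1), of "l # v"] snoc.prems(1) u(1)
      by (simp add: mult_F2 inv_F2)
  qed
qed (simp add: mult_F2 inv_F2 foldr_Nil)

text \<open>
  If at least half of a reduced word cancelled against itself, either its middle letter would be
  its own inverse or its two middle letters would be inverse to each other.
\<close>

lemma lcp_inv_self:
  assumes "reduced w" "w \<noteq> []"
  shows "2 * lcp (inv\<^bsub>F2\<^esub> w) w < length w"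
proof (rule ccontr)
  assume c: "\<not> ?thesis"
  define i where "i = (length w - 1) div 2"
  have i: "i < length w" "i < lcp (inv\<^bsub>F2\<^esub> w) w"
    using c assms(2) unfolding i_def by (cases w; simp)+
  have "take (lcp (inv\<^bsub>F2\<^esub> w) w) (inv\<^bsub>F2\<^esub> w) = take (lcp (inv\<^bsub>F2\<^esub> w) w) w"
    using lcp_ge_iff[of "lcp (inv\<^bsub>F2\<^esub> w) w"] by blast
  then have "(inv\<^bsub>F2\<^esub> w) ! i = w ! i" using i by (metis nth_take)
  then have flip_i: "flip (w ! (length w - Suc i)) = w ! i"
    using i assms(1) by (simp add: inv_F2 rev_nth)
  show False
  proof (cases "odd (length w)")
    case True
    then have "length w - Suc i = i" using assms(2) by (auto simp: i_def elim!: oddE)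
    then show False using flip_i by simp
  next
    case False
    then obtain b where b: "length w = 2 * b" by (auto elim: evenE)
    then obtain c where "b = Suc c" using assms(2) by (cases b) auto
    then have "length w - Suc i = Suc i" "Suc i < length w"
      using b by (simp_all add: i_def)
    then have "w ! Suc i \<noteq> flip (w ! i)"
      using assms(1) by (auto simp: reduced_def successively_conv_nth)
    then show False using flip_i \<open>length w - Suc i = Suc i\<close> by (metis flip_flip)
  qed
qed


lemma lcp_self: "lcp w w = length w"
  by (induction w) auto

lemma inv_neq_self: "reduced w \<Longrightarrow> w \<noteq> [] \<Longrightarrow> inv\<^bsub>F2\<^esub> w \<noteq> w"
  using lcp_inv_self[of w] lcp_self[of w] by auto

definition cancel :: "letter list \<Rightarrow> letter list \<Rightarrow> nat" where
  "cancel u v = lcp (inv\<^bsub>F2\<^esub> u) v"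

lemma length_mult_cancel:
  "reduced u \<Longrightarrow> reduced v \<Longrightarrow> length (u \<otimes>\<^bsub>F2\<^esub> v) + 2 * cancel u v = length u + length v"
  by (simp add: cancel_def length_mult_F2)

lemma reduced_mult_F2 [simp]: "reduced u \<Longrightarrow> reduced v \<Longrightarrow> reduced (u \<otimes>\<^bsub>F2\<^esub> v)"
  and reduced_inv_F2 [simp]: "reduced u \<Longrightarrow> reduced (inv\<^bsub>F2\<^esub> u)"
  using F2.m_closed F2.inv_closed by auto

text \<open>
  If the cancellations on the two sides of \<open>v\<close> do not use up \<open>v\<close>, then the product with \<open>w\<close>
  still ends in the part of \<open>v\<close> that is relevant for the cancellation against \<open>z\<close>. In terms of
  common prefixes this is the ultrametric inequality.
\<close>

lemma cancel_mult_left: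
  assumes r: "reduced w" "reduced v" "reduced z" and c: "cancel w v + cancel v z < length v"
  shows "cancel (w \<otimes>\<^bsub>F2\<^esub> v) z = cancel v z"
proof -
  let ?w = "inv\<^bsub>F2\<^esub> (w \<otimes>\<^bsub>F2\<^esub> v)" and ?v = "inv\<^bsub>F2\<^esub> v"
  have "length (w \<otimes>\<^bsub>F2\<^esub> v \<otimes>\<^bsub>F2\<^esub> ?v) + 2 * lcp ?w ?v = length (w \<otimes>\<^bsub>F2\<^esub> v) + length ?v"
    using r by (intro length_mult_F2) auto
  moreover have "w \<otimes>\<^bsub>F2\<^esub> v \<otimes>\<^bsub>F2\<^esub> ?v = w" using r by (simp add: F2.m_assoc)
  moreover have "length (w \<otimes>\<^bsub>F2\<^esub> v) + 2 * cancel w v = length w + length v"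
    using r by (intro length_mult_cancel)
  ultimately have "lcp ?w ?v = length v - cancel w v" using r by simp
  then have "lcp ?v z < lcp ?w ?v" using c by (simp add: cancel_def)
  moreover have "min (lcp ?w ?v) (lcp ?v z) \<le> lcp ?w z" "min (lcp ?v ?w) (lcp ?w z) \<le> lcp ?v z"
    by (rule lcp_ultrametric)+
  ultimately show ?thesis by (simp add: cancel_def lcp_commute[of ?v ?w])
qed

section \<open>Nielsen reduction for generating pairs\<close>

definition nielsen_reduced :: "letter list set \<Rightarrow> bool" where
  "nielsen_reduced \<Sigma> \<longleftrightarrow>
     (\<forall>x\<in>\<Sigma>. reduced x \<and> x \<noteq> [] \<and> inv\<^bsub>F2\<^esub> x \<in> \<Sigma>) \<and>
     (\<forall>x\<in>\<Sigma>. \<forall>y\<in>\<Sigma>. y \<noteq> inv\<^bsub>F2\<^esub> x \<longrightarrow> 2 * cancel x y \<le> length x \<and> 2 * cancel x y \<le> length y) \<and>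
     (\<forall>x\<in>\<Sigma>. \<forall>y\<in>\<Sigma>. \<forall>z\<in>\<Sigma>. y \<noteq> inv\<^bsub>F2\<^esub> x \<longrightarrow> z \<noteq> inv\<^bsub>F2\<^esub> y \<longrightarrow>
        cancel x y + cancel y z < length y)"

text \<open>
  The last factor \<open>x\<close> is recorded because, for Nielsen reduced \<open>\<Sigma>\<close>, the cancellation of the product
  \<open>w\<close> against a further factor depends on \<open>x\<close> alone.
\<close>

inductive reduced_product :: "letter list set \<Rightarrow> nat \<Rightarrow> letter list \<Rightarrow> letter list \<Rightarrow> bool" for \<Sigma> where
  single: "x \<in> \<Sigma> \<Longrightarrow> reduced_product \<Sigma> 1 x x"
| snoc: "reduced_product \<Sigma> n w x \<Longrightarrow> y \<in> \<Sigma> \<Longrightarrow> y \<noteq> inv\<^bsub>F2\<^esub> x \<Longrightarrow>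
    reduced_product \<Sigma> (Suc n) (w \<otimes>\<^bsub>F2\<^esub> y) y"

text \<open>
  Each factor of the product keeps at least one letter, even after cancellation with a further
  factor \<open>z\<close>. For this reason the bound is stated for the length minus the cancellation with \<open>z\<close>.
\<close>

lemma reduced_product_length:
  assumes \<Sigma>: "nielsen_reduced \<Sigma>" and "reduced_product \<Sigma> n w x"
  shows "x \<in> \<Sigma> \<and> reduced w \<and> (\<forall>z\<in>\<Sigma>. z \<noteq> inv\<^bsub>F2\<^esub> x \<longrightarrow> cancel w z = cancel x z \<and> cancel x z + n \<le> length w)"
  using assms(2)
proof induction
  case (single x)
  have "cancel x z + 1 \<le> length x" if "z \<in> \<Sigma>" "z \<noteq> inv\<^bsub>F2\<^esub> x" for z
  proof -
    have "2 * cancel x z \<le> length x" "x \<noteq> []"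
      using \<Sigma> single that by (auto simp: nielsen_reduced_def)
    then show ?thesis by (cases x) auto
  qed
  then show ?case using \<Sigma> single by (auto simp: nielsen_reduced_def)
next
  case (snoc n w x y)
  have y: "reduced y" using \<Sigma> snoc by (auto simp: nielsen_reduced_def)
  have xy: "cancel w y = cancel x y" "cancel x y + n \<le> length w" using snoc by auto
  have "cancel (w \<otimes>\<^bsub>F2\<^esub> y) z = cancel y z \<and> cancel y z + Suc n \<le> length (w \<otimes>\<^bsub>F2\<^esub> y)"
    if z: "z \<in> \<Sigma>" "z \<noteq> inv\<^bsub>F2\<^esub> y" for z
  proof -
    have c: "cancel x y + cancel y z < length y"
      using \<Sigma> snoc z unfolding nielsen_reduced_def by blast
    have "reduced z" using \<Sigma> z by (auto simp: nielsen_reduced_def)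
    then have "cancel (w \<otimes>\<^bsub>F2\<^esub> y) z = cancel y z"
      using c snoc xy(1) y by (intro cancel_mult_left) auto
    then show ?thesis
      using length_mult_cancel[of w y] snoc y xy c by auto
  qed
  then show ?case using snoc y by auto
qed

text \<open>
  An element of length one is a product with a single factor.
\<close>

lemma nielsen_reduced_letter:
  assumes \<Sigma>: "nielsen_reduced \<Sigma>" and w: "w \<in> generate F2 \<Sigma>" "length w = 1"
  shows "w \<in> \<Sigma>"
proof -
  \<comment> \<open>The set of reduced products, together with the identity, is closed under multiplication by the factors.\<close>
  define W where "W = insert [] {w. \<exists>n x. reduced_product \<Sigma> n w x}"
  have red: "reduced w" if "w \<in> W" for w
    using that reduced_product_length[OF \<Sigma>] by (auto simp: W_def)
  have \<Sigma>_red: "reduced x" "inv\<^bsub>F2\<^esub> x \<in> \<Sigma>" if "x \<in> \<Sigma>" for x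
    using that \<Sigma> by (auto simp: nielsen_reduced_def)
  have mult: "w \<otimes>\<^bsub>F2\<^esub> y \<in> W" if wy: "w \<in> W" "y \<in> \<Sigma>" for w y
  proof (cases "w = []")
    case True
    then show ?thesis using wy \<Sigma>_red single[of y \<Sigma>] by (auto simp: W_def mult_F2)
  next
    case False
    then obtain n x where p: "reduced_product \<Sigma> n w x" using wy by (auto simp: W_def)
    show ?thesis
    proof (cases "y = inv\<^bsub>F2\<^esub> x")
      case True
      from p show ?thesis
      proof cases
        case single
        then show ?thesis using True \<Sigma>_red by (simp add: W_def flip: one_F2)
      next
        case (snoc n w')
        then have "w \<otimes>\<^bsub>F2\<^esub> y = w'"
          using True \<Sigma>_red reduced_product_length[OF \<Sigma> snoc(3)] by (simp add: F2.m_assoc)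
        then show ?thesis using snoc by (auto simp: W_def)
      qed
    next
      case False
      then show ?thesis using reduced_product.snoc[OF p wy(2) False] unfolding W_def by blast
    qed
  qed
  have "u \<otimes>\<^bsub>F2\<^esub> w \<in> W" if "w \<in> generate F2 \<Sigma>" "u \<in> W" for u w
    using that
  proof (induction w arbitrary: u rule: generate.induct)
    case one
    then show ?case using red by (simp flip: one_F2)
  next
    case (eng h1 h2)
    have "h1 \<in> carrier F2" "h2 \<in> carrier F2"
      using eng.hyps F2.generate_in_carrier[of \<Sigma>] \<Sigma>_red by auto
    then have "u \<otimes>\<^bsub>F2\<^esub> (h1 \<otimes>\<^bsub>F2\<^esub> h2) = u \<otimes>\<^bsub>F2\<^esub> h1 \<otimes>\<^bsub>F2\<^esub> h2"
      using red[OF eng.prems] by (simp add: F2.m_assoc)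
    then show ?case using eng by simp
  qed (use mult \<Sigma>_red in auto)
  from this[OF w(1), of "[]"] have "w \<in> W"
    using F2.generate_in_carrier[OF _ w(1)] \<Sigma>_red by (auto simp: W_def mult_F2)
  then obtain n x where p: "reduced_product \<Sigma> n w x" using w(2) by (auto simp: W_def)
  have x: "x \<in> \<Sigma>" "reduced x" "x \<noteq> []"
    using reduced_product_length[OF \<Sigma> p] \<Sigma> unfolding nielsen_reduced_def by blast+
  then have "x \<noteq> inv\<^bsub>F2\<^esub> x" using inv_neq_self by metis
  then have "cancel x x + n \<le> length w"
    using reduced_product_length[OF \<Sigma> p] x(1) by blast
  then have n: "n \<le> 1" using w(2) by simp
  from p show ?thesis
  proof cases
    case (snoc n' w')
    then have "n' = 0" using n by simp
    with snoc(3) show ?thesis by cases auto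
  qed auto
qed



text \<open>
  The comparison includes all conjugates of the pairs obtained by the moves: a pair in which a word
  cancels by halves on both sides can be shortened only after a conjugation.
\<close>

definition minimal_pair :: "letter list \<Rightarrow> letter list \<Rightarrow> bool" where
  "minimal_pair x y \<longleftrightarrow> reduced x \<and> reduced y \<and>
     (\<forall>w x' y'. F2.pair_eq (F2.pairs.act w (x, y)) (x', y') \<longrightarrow>
        length x + length y \<le> length x' + length y')"

lemma minimal_pair_move:
  assumes "minimal_pair x y"
  shows "minimal_pair y (inv\<^bsub>F2\<^esub> x)"
  unfolding minimal_pair_def
proof (intro conjI allI impI)
  show "reduced y" "reduced (inv\<^bsub>F2\<^esub> x)" using assms by (auto simp: minimal_pair_def)
  fix w x' y'
  assume "F2.pair_eq (F2.pairs.act w (y, inv\<^bsub>F2\<^esub> x)) (x', y')"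
  then have "F2.pair_eq (F2.pairs.act (Cross # w) (x, y)) (x', y')" by simp
  then have "length x + length y \<le> length x' + length y'"
    using assms unfolding minimal_pair_def by blast
  then show "length y + length (inv\<^bsub>F2\<^esub> x) \<le> length x' + length y'"
    using assms by (simp add: minimal_pair_def)
qed

lemma conj_by_Nil [simp]: "reduced y \<Longrightarrow> F2.conj_by [] y = y"
  using F2.conj_by_one[of y] by simp

text \<open>
  The Nielsen transvections are words in the two moves.
\<close>

lemma pair_eq_mult:
  assumes "reduced x" "reduced y"
  shows "F2.pair_eq (F2.pairs.act [Turn, Cross] (x, y)) (x \<otimes>\<^bsub>F2\<^esub> y, y)"
    and "F2.pair_eq (F2.pairs.act [Turn, Turn, Cross] (x, y)) (x, x \<otimes>\<^bsub>F2\<^esub> y)"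
  using assms by (auto simp: F2.pair_eq_iff F2.inv_mult_group F2.m_assoc intro!: exI[of _ "[]"])

text \<open>
  In each case the two conjugated elements on the right form a pair equivalent to a Nielsen
  transvection of \<open>(x, y)\<close>, so their total length is at least that of \<open>(x, y)\<close>.
\<close>

lemma minimal_pair_conj:
  assumes m: "minimal_pair x y" and q: "reduced q"
  shows "length x \<le> length (F2.conj_by q (x \<otimes>\<^bsub>F2\<^esub> y)) + length (F2.conj_by q y) - length y"
    and "length y \<le> length (F2.conj_by q x) + length (F2.conj_by q (x \<otimes>\<^bsub>F2\<^esub> y)) - length x"
proof -
  have r: "reduced x" "reduced y" using m by (auto simp: minimal_pair_def)
  have min: "length x + length y \<le> length x' + length y'"
    if "F2.pair_eq (F2.pairs.act w (x, y)) P" "F2.pair_eq P (x', y')" for w P x' y'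
    using m F2.pair_eq_trans[OF that] unfolding minimal_pair_def by blast
  have conj: "F2.pair_eq (u, v) (F2.conj_by q u, F2.conj_by q v)" if "reduced u" "reduced v" for u v
    using that q by (auto simp: F2.pair_eq_iff)
  show "length x \<le> length (F2.conj_by q (x \<otimes>\<^bsub>F2\<^esub> y)) + length (F2.conj_by q y) - length y"
    using min[OF pair_eq_mult(1)[OF r] conj] r by simp
  show "length y \<le> length (F2.conj_by q x) + length (F2.conj_by q (x \<otimes>\<^bsub>F2\<^esub> y)) - length x"
    using min[OF pair_eq_mult(2)[OF r] conj] r by simp
qed

lemma minimal_pair_cancel:
  assumes m: "minimal_pair x y"
  shows "2 * cancel x y \<le> length x" "2 * cancel x y \<le> length y"
    "2 * cancel y x \<le> length x" "2 * cancel y x \<le> length y"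
proof -
  have r: "reduced x" "reduced y" using m by (auto simp: minimal_pair_def)
  have "F2.conj_by y (x \<otimes>\<^bsub>F2\<^esub> y) = y \<otimes>\<^bsub>F2\<^esub> x" "F2.conj_by y y = y"
    using r by (simp_all add: F2.conj_by_def F2.m_assoc)
  then have 1: "length x + length y \<le> length (y \<otimes>\<^bsub>F2\<^esub> x) + length y"
    using minimal_pair_conj(1)[OF m r(2)] by simp
  have "F2.conj_by (inv\<^bsub>F2\<^esub> x) (x \<otimes>\<^bsub>F2\<^esub> y) = y \<otimes>\<^bsub>F2\<^esub> x" "F2.conj_by (inv\<^bsub>F2\<^esub> x) x = x"
    using r by (simp_all add: F2.conj_by_def flip: F2.m_assoc)
  then have 2: "length x + length y \<le> length x + length (y \<otimes>\<^bsub>F2\<^esub> x)"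
    using minimal_pair_conj(2)[OF m, of "inv\<^bsub>F2\<^esub> x"] r by simp
  show "2 * cancel y x \<le> length x" "2 * cancel y x \<le> length y"
    using 1 2 length_mult_cancel[OF r(2,1)] by auto
  show "2 * cancel x y \<le> length x" "2 * cancel x y \<le> length y"
    using minimal_pair_conj[OF m, of "[]"] length_mult_cancel[OF r] r by auto
qed

text \<open>
  If one half of \<open>y\<close> cancels against \<open>z\<close> on the left and the other half on the right, then
  $y = pq^{-1}$ and $z = q z' p^{-1}$ with \<open>p\<close>, \<open>q\<close> of equal length. Conjugation by
  $q^{-1}$ turns $zy = qz'q^{-1}$ into $z'$ and does not lengthen \<open>y\<close>.
\<close>

lemma tie_shortening:
  assumes r: "reduced z" "reduced y" and n: "length y = 2 * n" "n > 0"
    and c: "cancel z y = n" "cancel y z = n" and z: "2 * n \<le> length z"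
  obtains q where "reduced q" "length (F2.conj_by q y) \<le> length y"
    "length (F2.conj_by q (z \<otimes>\<^bsub>F2\<^esub> y)) < length z"
proof -
  let ?q = "take n (inv\<^bsub>F2\<^esub> y)"
  have q: "reduced ?q" "length ?q = n"
    using r n reduced_inv_F2[of y] by (auto simp: reduced_def successively_conv_nth)
  have qy: "lcp ?q (inv\<^bsub>F2\<^esub> y) \<ge> n" using q n r by (subst lcp_ge_iff) auto
  define p where "p = y \<otimes>\<^bsub>F2\<^esub> ?q"
  have p: "reduced p" "length p = n"
  proof -
    show "reduced p" using q r by (simp add: p_def)
    have "length p + 2 * lcp (inv\<^bsub>F2\<^esub> y) ?q = length y + length ?q"
      unfolding p_def using r q by (intro length_mult_F2)
    moreover have "lcp (inv\<^bsub>F2\<^esub> y) ?q = n"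
      using qy lcp_le(1)[of ?q "inv\<^bsub>F2\<^esub> y"] q by (simp add: lcp_commute)
    ultimately show "length p = n" using n q by simp
  qed
  have "length (inv\<^bsub>F2\<^esub> ?q \<otimes>\<^bsub>F2\<^esub> p) \<le> 2 * n"
    using length_mult_cancel[of "inv\<^bsub>F2\<^esub> ?q" p] q p by simp
  then have y_conj: "length (F2.conj_by (inv\<^bsub>F2\<^esub> ?q) y) \<le> length y"
    using q r n by (simp add: F2.conj_by_def p_def F2.m_assoc)
  have "lcp p y \<ge> n"
  proof -
    have "length (inv\<^bsub>F2\<^esub> p \<otimes>\<^bsub>F2\<^esub> y) + 2 * lcp (inv\<^bsub>F2\<^esub> (inv\<^bsub>F2\<^esub> p)) y = length (inv\<^bsub>F2\<^esub> p) + length y"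
      using p r by (intro length_mult_F2) auto
    moreover have "inv\<^bsub>F2\<^esub> p \<otimes>\<^bsub>F2\<^esub> y = inv\<^bsub>F2\<^esub> ?q"
      using q r by (simp add: p_def F2.inv_mult_group F2.m_assoc)
    ultimately show ?thesis using q p r n by simp
  qed
  then have "lcp (inv\<^bsub>F2\<^esub> z) p \<ge> n"
    using c(1) lcp_ultrametric[of "inv\<^bsub>F2\<^esub> z" y p] by (simp add: cancel_def lcp_commute)
  then have zp: "length (z \<otimes>\<^bsub>F2\<^esub> p) + n = length z" "lcp (inv\<^bsub>F2\<^esub> z) p = n"
    using length_mult_F2[OF r(1) p(1)] p lcp_le(2)[of "inv\<^bsub>F2\<^esub> z" p] by auto
  have "lcp z (z \<otimes>\<^bsub>F2\<^esub> p) \<ge> n"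
  proof -
    have "length (inv\<^bsub>F2\<^esub> z \<otimes>\<^bsub>F2\<^esub> (z \<otimes>\<^bsub>F2\<^esub> p)) + 2 * lcp (inv\<^bsub>F2\<^esub> (inv\<^bsub>F2\<^esub> z)) (z \<otimes>\<^bsub>F2\<^esub> p)
      = length (inv\<^bsub>F2\<^esub> z) + length (z \<otimes>\<^bsub>F2\<^esub> p)"
      using p r by (intro length_mult_F2) auto
    moreover have "inv\<^bsub>F2\<^esub> z \<otimes>\<^bsub>F2\<^esub> (z \<otimes>\<^bsub>F2\<^esub> p) = p"
      using p r by (simp flip: F2.m_assoc)
    ultimately show ?thesis using zp p r z by simp
  qed
  moreover have "lcp ?q z \<ge> n"
    using qy c(2) lcp_ultrametric[of ?q "inv\<^bsub>F2\<^esub> y" z] by (simp add: cancel_def)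
  ultimately have "lcp ?q (z \<otimes>\<^bsub>F2\<^esub> p) \<ge> n"
    using lcp_ultrametric[of ?q z "z \<otimes>\<^bsub>F2\<^esub> p"] by simp
  then have "length (inv\<^bsub>F2\<^esub> ?q \<otimes>\<^bsub>F2\<^esub> (z \<otimes>\<^bsub>F2\<^esub> p)) < length z"
    using length_mult_cancel[of "inv\<^bsub>F2\<^esub> ?q" "z \<otimes>\<^bsub>F2\<^esub> p"] q p r zp n by (simp add: cancel_def)
  then have "length (F2.conj_by (inv\<^bsub>F2\<^esub> ?q) (z \<otimes>\<^bsub>F2\<^esub> y)) < length z"
    using q r by (simp add: F2.conj_by_def p_def F2.m_assoc)
  then show thesis using that[of "inv\<^bsub>F2\<^esub> ?q"] y_conj q by simp
qed

lemma minimal_pair_no_tie: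
  assumes m: "minimal_pair x y" and ne: "x \<noteq> []" "y \<noteq> []"
  shows "cancel x y + cancel y x < length y" "cancel x y + cancel y x < length x"
proof -
  have r: "reduced x" "reduced y" using m by (auto simp: minimal_pair_def)
  note c = minimal_pair_cancel[OF m]
  show "cancel x y + cancel y x < length y"
  proof (rule ccontr)
    assume "\<not> ?thesis"
    then have t: "length y = 2 * cancel x y" "cancel y x = cancel x y" "cancel x y > 0"
      using c ne by (cases y; auto)+
    obtain q where "reduced q" "length (F2.conj_by q y) \<le> length y"
      "length (F2.conj_by q (x \<otimes>\<^bsub>F2\<^esub> y)) < length x"
      using tie_shortening[OF r t(1,3) refl t(2)] c by auto
    then show False using minimal_pair_conj(1)[OF m, of q] by auto
  qed
  show "cancel x y + cancel y x < length x"
  proof (rule ccontr)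
    assume "\<not> ?thesis"
    then have t: "length x = 2 * cancel y x" "cancel x y = cancel y x" "cancel y x > 0"
      using c ne by (cases x; auto)+
    obtain q where q: "reduced q" "length (F2.conj_by q x) \<le> length x"
      "length (F2.conj_by q (y \<otimes>\<^bsub>F2\<^esub> x)) < length y"
      using tie_shortening[OF r(2,1) t(1,3) refl t(2)] c by auto
    let ?q = "q \<otimes>\<^bsub>F2\<^esub> inv\<^bsub>F2\<^esub> x"
    have "F2.conj_by ?q (x \<otimes>\<^bsub>F2\<^esub> y) = F2.conj_by q (y \<otimes>\<^bsub>F2\<^esub> x)" "F2.conj_by ?q x = F2.conj_by q x"
    proof -
      have "F2.conj_by (inv\<^bsub>F2\<^esub> x) (x \<otimes>\<^bsub>F2\<^esub> y) = y \<otimes>\<^bsub>F2\<^esub> x" "F2.conj_by (inv\<^bsub>F2\<^esub> x) x = x"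
        using r by (simp_all add: F2.conj_by_def flip: F2.m_assoc)
      then show "F2.conj_by ?q (x \<otimes>\<^bsub>F2\<^esub> y) = F2.conj_by q (y \<otimes>\<^bsub>F2\<^esub> x)" "F2.conj_by ?q x = F2.conj_by q x"
        using r q(1) by (simp_all flip: F2.conj_by_conj_by)
    qed
    then show False using minimal_pair_conj(2)[OF m, of ?q] q r by auto
  qed
qed

text \<open>
  The condition on three consecutive factors $x$, $y$, $z$ can fail only if half of \<open>y\<close> cancels on
  either side. If \<open>x = y\<close> or \<open>z = y\<close> this contradicts \<open>lcp_inv_self\<close>. Otherwise \<open>x\<close> and \<open>z\<close> are
  equal or inverse to each other: the first case is a tie, and in the second the first halves of
  $y$ and of $y^{-1}$ are both prefixes of $x^{-1}$, which again contradicts \<open>lcp_inv_self\<close>.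
\<close>

lemma minimal_pair_nielsen_reduced:
  assumes m: "minimal_pair g h" and ne: "g \<noteq> []" "h \<noteq> []"
  shows "nielsen_reduced {g, inv\<^bsub>F2\<^esub> g, h, inv\<^bsub>F2\<^esub> h}"
proof -
  define S where "S = {g, inv\<^bsub>F2\<^esub> g, h, inv\<^bsub>F2\<^esub> h}"
  have r: "reduced g" "reduced h" using m by (auto simp: minimal_pair_def)
  have pairs: "minimal_pair g h" "minimal_pair h (inv\<^bsub>F2\<^esub> g)"
    "minimal_pair (inv\<^bsub>F2\<^esub> g) (inv\<^bsub>F2\<^esub> h)" "minimal_pair (inv\<^bsub>F2\<^esub> h) g"
    using m minimal_pair_move[OF m] minimal_pair_move[OF minimal_pair_move[OF m]]
      minimal_pair_move[OF minimal_pair_move[OF minimal_pair_move[OF m]]] r by simp_all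
  have \<Sigma>: "reduced x \<and> x \<noteq> [] \<and> inv\<^bsub>F2\<^esub> x \<in> S" if "x \<in> S" for x
  proof -
    have "inv\<^bsub>F2\<^esub> x \<noteq> []" if "reduced x" "x \<noteq> []" for x
      using that length_inv_F2[of x] by (metis length_0_conv)
    then show ?thesis using that r ne by (auto simp: S_def)
  qed
  have cases: "y = x \<or> y = inv\<^bsub>F2\<^esub> x \<or> minimal_pair x y \<or> minimal_pair y x" if "x \<in> S" "y \<in> S" for x y
    using that pairs r unfolding S_def by (elim insertE emptyE; simp)
  have self: "2 * cancel x x < length x" if "x \<in> S" for x
    using lcp_inv_self \<Sigma>[OF that] by (simp add: cancel_def)
  have two: "2 * cancel x y \<le> length x \<and> 2 * cancel x y \<le> length y"
    if "x \<in> S" "y \<in> S" "y \<noteq> inv\<^bsub>F2\<^esub> x" for x y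
  proof -
    have "y = x \<or> minimal_pair x y \<or> minimal_pair y x" using cases[OF that(1,2)] that(3) by blast
    then show ?thesis
    proof (elim disjE)
      assume "y = x"
      then show ?thesis using self[OF that(1)] by simp
    next
      assume "minimal_pair x y"
      from minimal_pair_cancel(1,2)[OF this] show ?thesis by blast
    next
      assume "minimal_pair y x"
      from minimal_pair_cancel(3,4)[OF this] show ?thesis by blast
    qed
  qed
  have three: "cancel x y + cancel y z < length y"
    if xyz: "x \<in> S" "y \<in> S" "z \<in> S" "y \<noteq> inv\<^bsub>F2\<^esub> x" "z \<noteq> inv\<^bsub>F2\<^esub> y" for x y z
  proof -
    note xy = two[OF xyz(1,2,4)] and yz = two[OF xyz(2,3,5)]
    have "x = y \<or> z = y \<or> x = z \<or> z = inv\<^bsub>F2\<^esub> x"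
      using xyz r unfolding S_def by (elim insertE emptyE; simp)
    then consider "x = y" | "z = y" | "x = z" "x \<noteq> y" | "z = inv\<^bsub>F2\<^esub> x"
      by blast
    then show ?thesis
    proof cases
      case 1
      then show ?thesis using self[OF xyz(2)] yz by auto
    next
      case 2
      then show ?thesis using self[OF xyz(2)] xy by auto
    next
      case 3
      then have "minimal_pair x y \<or> minimal_pair y x" using cases[OF xyz(1,2)] xyz(4) by blast
      then show ?thesis
      proof
        assume "minimal_pair x y"
        then show ?thesis
          using minimal_pair_no_tie(1)[of x y] \<Sigma>[OF xyz(1)] \<Sigma>[OF xyz(2)] 3 by simp
      next
        assume "minimal_pair y x"
        then show ?thesis
          using minimal_pair_no_tie(2)[of y x] \<Sigma>[OF xyz(1)] \<Sigma>[OF xyz(2)] 3 by simp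
      qed
    next
      case 4
      show ?thesis
      proof (rule ccontr)
        assume "\<not> ?thesis"
        then have "2 * cancel x y = length y" "2 * cancel y z = length y" using xy yz by auto
        moreover have "min (lcp (inv\<^bsub>F2\<^esub> y) (inv\<^bsub>F2\<^esub> x)) (lcp (inv\<^bsub>F2\<^esub> x) y) \<le> lcp (inv\<^bsub>F2\<^esub> y) y"
          by (rule lcp_ultrametric)
        ultimately show False using 4 self[OF xyz(2)] by (simp add: cancel_def)
      qed
    qed
  qed
  have "nielsen_reduced S" unfolding nielsen_reduced_def
    by (intro conjI ballI impI \<Sigma> two three; (simp add: \<Sigma> two)?)
  then show ?thesis by (simp add: S_def)
qed


lemma mult_Nil_F2 [simp]: "reduced u \<Longrightarrow> u \<otimes>\<^bsub>F2\<^esub> [] = u" "[] \<otimes>\<^bsub>F2\<^esub> u = u"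
  using F2.r_one[of u] by (simp_all add: mult_F2)

definition pair_matrix :: "letter list \<times> letter list \<Rightarrow> int^2^2" where
  "pair_matrix P = mat2 (fst (ab (fst P))) (fst (ab (snd P))) (snd (ab (fst P))) (snd (ab (snd P)))"

lemma ab_Nil: "ab [] = (0, 0)"
  by (simp add: ab_def exponent_sum_def)

lemma ab_inv:
  assumes "reduced u"
  shows "ab (inv\<^bsub>F2\<^esub> u) = (- fst (ab u), - snd (ab u))"
proof -
  have "ab (inv\<^bsub>F2\<^esub> u \<otimes>\<^bsub>F2\<^esub> u) = (0, 0)" using assms by (simp add: ab_Nil)
  then show ?thesis by (simp add: ab_mult prod_eq_iff)
qed

lemma ab_conj_by:
  assumes "reduced u" "reduced v"
  shows "ab (F2.conj_by u v) = ab v"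
  using assms by (simp add: F2.conj_by_def ab_mult ab_inv)

lemma pair_matrix_act:
  assumes "F2.pair_eq P P"
  shows "pair_matrix (F2.pairs.act w P) = pair_matrix P ** word_matrix w"
  using assms
proof (induction w arbitrary: P)
  case (Cons m w)
  obtain g h where P: "P = (g, h)" "reduced g" "reduced h"
    using Cons.prems by (cases P) (auto simp: F2.pair_eq_iff)
  have "pair_matrix (F2.pair_move m P) = pair_matrix P ** move_matrix m"
    using P by (cases m) (simp_all add: pair_matrix_def ab_inv ab_mult)
  then show ?case
    using Cons.IH[OF F2.pair_move_cong[OF Cons.prems]] by (simp add: matrix_mul_assoc)
qed simp

lemma pair_matrix_pair_eq: "F2.pair_eq P P' \<Longrightarrow> pair_matrix P =\<^sub>\<plusminus> pair_matrix P'"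
  by (cases P; cases P') (auto simp: F2.pair_eq_iff pair_matrix_def ab_conj_by ab_inv upto_sign_def)

text \<open>
  Stated in terms of all subgroups, so that the invariance under moves and conjugation needs only
  closure properties of subgroups.
\<close>

definition generating_pair :: "letter list \<times> letter list \<Rightarrow> bool" where
  "generating_pair P \<longleftrightarrow> (\<forall>K. subgroup K F2 \<longrightarrow> fst P \<in> K \<longrightarrow> snd P \<in> K \<longrightarrow> K = carrier F2)"

lemma generating_pair_generate:
  assumes "generate F2 {g, h} = carrier F2"
  shows "generating_pair (g, h)"
proof -
  have "carrier F2 \<subseteq> K" if "subgroup K F2" "g \<in> K" "h \<in> K" for K
    using F2.generate_subgroup_incl[of "{g, h}" K] that assms by simp
  then show ?thesis using subgroup.subset[of _ F2] by (force simp: generating_pair_def)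
qed

lemma generating_pair_move:
  assumes P: "generating_pair P" "F2.pair_eq P P"
  shows "generating_pair (F2.pair_move m P)"
  unfolding generating_pair_def
proof (intro allI impI)
  fix K assume K: "subgroup K F2" "fst (F2.pair_move m P) \<in> K" "snd (F2.pair_move m P) \<in> K"
  obtain g h where gh: "P = (g, h)" "reduced g" "reduced h"
    using P(2) by (cases P) (auto simp: F2.pair_eq_iff)
  have inv: "x \<in> K" if "inv\<^bsub>F2\<^esub> x \<in> K" "reduced x" for x
    using subgroup.m_inv_closed[OF K(1) that(1)] that(2) by simp
  have "g \<in> K \<and> h \<in> K"
  proof (cases m)
    case Cross
    then show ?thesis using K gh inv by simp
  next
    case Turn
    then have "g \<otimes>\<^bsub>F2\<^esub> h \<in> K" "h \<in> K" using K gh inv by simp_all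
    then have "g \<otimes>\<^bsub>F2\<^esub> h \<otimes>\<^bsub>F2\<^esub> inv\<^bsub>F2\<^esub> h \<in> K"
      using subgroup.m_closed[OF K(1)] subgroup.m_inv_closed[OF K(1)] by blast
    then show ?thesis using gh \<open>h \<in> K\<close> by (simp add: F2.m_assoc)
  qed
  then show "K = carrier F2" using P(1) K(1) gh by (simp add: generating_pair_def)
qed

lemma generating_pair_act:
  "generating_pair P \<Longrightarrow> F2.pair_eq P P \<Longrightarrow> generating_pair (F2.pairs.act w P)"
  by (induction w arbitrary: P) (simp_all add: generating_pair_move F2.pair_move_cong)

lemma generating_pair_eq:
  assumes P: "generating_pair P" "F2.pair_eq P P'"
  shows "generating_pair P'"
  unfolding generating_pair_def
proof (intro allI impI)
  fix K assume K: "subgroup K F2" "fst P' \<in> K" "snd P' \<in> K"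
  obtain g h where gh: "P = (g, h)" "reduced g" "reduced h"
    using P(2) by (cases P; cases P') (auto simp: F2.pair_eq_iff)
  then obtain x where x: "reduced x"
    "P' = (F2.conj_by x g, F2.conj_by x h) \<or> P' = (inv\<^bsub>F2\<^esub> (F2.conj_by x g), inv\<^bsub>F2\<^esub> (F2.conj_by x h))"
    using P(2) by (cases P') (auto simp: F2.pair_eq_iff F2.conj_by_inv)
  have red: "reduced (F2.conj_by x y)" if "reduced y" for y
    using F2.conj_by_closed[of x y] x(1) that by simp
  have inv: "x \<in> K" if "inv\<^bsub>F2\<^esub> x \<in> K" "reduced x" for x
    using subgroup.m_inv_closed[OF K(1) that(1)] that(2) by simp
  define K' where "K' = {y. reduced y \<and> F2.conj_by x y \<in> K}"
  have "subgroup K' F2"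
  proof (rule F2.subgroupI)
    have "F2.conj_by x [] = []" using x(1) F2.r_inv[of x] by (simp add: F2.conj_by_def)
    then have "[] \<in> K'" using subgroup.one_closed[OF K(1)] by (simp add: K'_def)
    then show "K' \<noteq> {}" by blast
    show "K' \<subseteq> carrier F2" by (auto simp: K'_def)
    show "inv\<^bsub>F2\<^esub> u \<in> K'" if "u \<in> K'" for u
      using that x(1) subgroup.m_inv_closed[OF K(1), of "F2.conj_by x u"]
      by (simp add: K'_def F2.conj_by_inv)
    show "u \<otimes>\<^bsub>F2\<^esub> v \<in> K'" if "u \<in> K'" "v \<in> K'" for u v
      using that x(1) subgroup.m_closed[OF K(1), of "F2.conj_by x u" "F2.conj_by x v"]
      by (simp add: K'_def F2.conj_by_mult)
  qed
  moreover have "g \<in> K'" "h \<in> K'"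
    using x(2) K(2,3) gh inv[OF _ red] by (auto simp: K'_def)
  ultimately have K': "K' = carrier F2" using P(1) gh by (simp add: generating_pair_def)
  have "z \<in> K" if "reduced z" for z
  proof -
    have "F2.conj_by (inv\<^bsub>F2\<^esub> x) z \<in> K'"
      using K' that x(1) F2.conj_by_closed[of "inv\<^bsub>F2\<^esub> x" z] by simp
    then show ?thesis using that x(1) by (simp add: K'_def F2.conj_by_conj_by)
  qed
  then show "K = carrier F2" using subgroup.subset[OF K(1)] by auto
qed

text \<open>
  The abelianizations of the pair generate $Z^2$, so the matrix of the pair has an inverse over the
  integers.
\<close>

lemma generating_pair_det:
  assumes P: "generating_pair (g, h)" and r: "reduced g" "reduced h"
  shows "\<bar>det (pair_matrix (g, h))\<bar> = 1"
proof -
  define K where "K = {w. reduced w \<and> (\<exists>m n. fst (ab w) = m * fst (ab g) + n * fst (ab h)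
    \<and> snd (ab w) = m * snd (ab g) + n * snd (ab h))}"
  have KI: "w \<in> K" if "reduced w" "fst (ab w) = m * fst (ab g) + n * fst (ab h)"
    "snd (ab w) = m * snd (ab g) + n * snd (ab h)" for w m n
    unfolding K_def using that by blast
  have "subgroup K F2"
  proof (rule F2.subgroupI)
    show "K \<subseteq> carrier F2" by (auto simp: K_def)
    have "[] \<in> K" by (rule KI[of _ 0 0]) (simp_all add: ab_Nil)
    then show "K \<noteq> {}" by blast
  next
    fix u assume "u \<in> K"
    then obtain m n where *: "reduced u" "fst (ab u) = m * fst (ab g) + n * fst (ab h)"
      "snd (ab u) = m * snd (ab g) + n * snd (ab h)" by (auto simp: K_def)
    show "inv\<^bsub>F2\<^esub> u \<in> K"
      by (rule KI[of _ "- m" "- n"]) (use * in \<open>simp_all add: ab_inv\<close>)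
    fix v assume "v \<in> K"
    then obtain m' n' where **: "reduced v" "fst (ab v) = m' * fst (ab g) + n' * fst (ab h)"
      "snd (ab v) = m' * snd (ab g) + n' * snd (ab h)" by (auto simp: K_def)
    show "u \<otimes>\<^bsub>F2\<^esub> v \<in> K"
      by (rule KI[of _ "m + m'" "n + n'"]) (use * ** in \<open>simp_all add: ab_mult algebra_simps\<close>)
  qed
  moreover have "g \<in> K" by (rule KI[of _ 1 0]) (use r in simp_all)
  moreover have "h \<in> K" by (rule KI[of _ 0 1]) (use r in simp_all)
  ultimately have "K = carrier F2" using P by (simp add: generating_pair_def)
  then have "gen_a \<in> K" "gen_b \<in> K" by (simp_all add: gen_a_def gen_b_def reduced_Cons)
  then obtain m n m' n' where
    "1 = m * fst (ab g) + n * fst (ab h)" "0 = m * snd (ab g) + n * snd (ab h)"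
    "0 = m' * fst (ab g) + n' * fst (ab h)" "1 = m' * snd (ab g) + n' * snd (ab h)"
    by (auto simp: K_def ab_gen)
  then have "pair_matrix (g, h) ** mat2 m m' n n' = mat 1"
    by (simp add: pair_matrix_def mat2_one mult.commute)
  then have "det (pair_matrix (g, h)) * det (mat2 m m' n n') = 1"
    by (metis det_I det_mul)
  then show ?thesis by (auto simp: zmult_eq_1_iff simp del: det_mat2)
qed

lemma reduced_gens [simp]: "reduced gen_a" "reduced gen_b"
  by (simp_all add: gen_a_def gen_b_def reduced_Cons)

lemma inv_gens: "inv\<^bsub>F2\<^esub> gen_a = [(GenA, False)]" "inv\<^bsub>F2\<^esub> gen_b = [(GenB, False)]"
  by (simp_all add: inv_letter gen_a_def gen_b_def flip_def)

lemma pair_matrix_gens: "pair_matrix (gen_a, gen_b) = mat 1"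
  by (simp add: pair_matrix_def ab_gen mat2_one)

lemma gens_pair_eq: "F2.pair_eq (gen_a, gen_b) (gen_a, gen_b)"
  by (simp add: F2.pair_eq_refl_iff)

text \<open>
  Take a pair of minimal length among those reached from \<open>(g, h)\<close>. Being Nielsen reduced, it
  contains \<open>a\<close> and \<open>b\<close> up to inversion, and the determinant leaves only the four pairs obtained
  from \<open>(a, b)\<close> by repeated application of \<open>Cross\<close>.
\<close>

theorem nielsen_pairs:
  assumes gen: "generating_pair (g, h)" and r: "reduced g" "reduced h"
    and det: "det (pair_matrix (g, h)) = 1"
  shows "\<exists>w. F2.pair_eq (F2.pairs.act w (gen_a, gen_b)) (g, h)"
proof -
  have gh: "F2.pair_eq (g, h) (g, h)" using r by (simp add: F2.pair_eq_refl_iff)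
  define reach where "reach = (\<lambda>P. \<exists>w. F2.pair_eq (F2.pairs.act w (g, h)) P)"
  have "reach (g, h)" unfolding reach_def using gh by (intro exI[of _ "[]"]) simp
  then obtain P where P: "reach P"
    "\<And>P'. reach P' \<Longrightarrow> length (fst P) + length (snd P) \<le> length (fst P') + length (snd P')"
    using ex_has_least_nat[of reach "(g, h)" "\<lambda>P. length (fst P) + length (snd P)"] by blast
  obtain w where w: "F2.pair_eq (F2.pairs.act w (g, h)) P" using P(1) by (auto simp: reach_def)
  obtain x y where xy: "P = (x, y)" by (cases P)
  have PP: "F2.pair_eq P P" using F2.pair_eq_trans[OF F2.pair_eq_sym[OF w] w] .
  then have rxy: "reduced x" "reduced y" using xy by (auto simp: F2.pair_eq_refl_iff)
  have "minimal_pair x y"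
    unfolding minimal_pair_def
  proof (intro conjI allI impI rxy)
    fix v x' y' assume "F2.pair_eq (F2.pairs.act v (x, y)) (x', y')"
    then have "F2.pair_eq (F2.pairs.act (w @ v) (g, h)) (x', y')"
      using F2.pair_eq_trans[OF F2.pairs.act_cong[OF w, of v]] xy by (simp add: F2.pairs.act_append)
    then have "reach (x', y')" by (auto simp: reach_def)
    from P(2)[OF this] show "length x + length y \<le> length x' + length y'" using xy by simp
  qed
  have gen_xy: "generating_pair (x, y)"
    using generating_pair_eq[OF generating_pair_act[OF gen gh] w] xy by simp
  have "pair_matrix (g, h) ** word_matrix w =\<^sub>\<plusminus> pair_matrix (x, y)"
    using pair_matrix_pair_eq[OF w] pair_matrix_act[OF gh, of w] xy by simp
  then have det_xy: "det (pair_matrix (x, y)) = 1"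
    using upto_sign_det[of "pair_matrix (g, h) ** word_matrix w" "pair_matrix (x, y)"] det
    by (simp add: det_mul)
  then have ne: "x \<noteq> []" "y \<noteq> []" by (auto simp: pair_matrix_def ab_Nil)
  let ?\<Sigma> = "{x, inv\<^bsub>F2\<^esub> x, y, inv\<^bsub>F2\<^esub> y}"
  have \<Sigma>: "nielsen_reduced ?\<Sigma>"
    using minimal_pair_nielsen_reduced[OF \<open>minimal_pair x y\<close> ne] .
  have "generate F2 ?\<Sigma> = carrier F2"
  proof -
    have "subgroup (generate F2 ?\<Sigma>) F2"
      using rxy by (intro F2.generate_is_subgroup) auto
    moreover have "x \<in> generate F2 ?\<Sigma>" "y \<in> generate F2 ?\<Sigma>" by (auto intro: generate.incl)
    ultimately show ?thesis using gen_xy by (simp add: generating_pair_def)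
  qed
  then have "gen_a \<in> ?\<Sigma>" "gen_b \<in> ?\<Sigma>"
    using nielsen_reduced_letter[OF \<Sigma>] by (simp_all add: gen_a_def gen_b_def reduced_Cons)
  then have a: "gen_a \<in> {x, inv\<^bsub>F2\<^esub> x} \<or> gen_a \<in> {y, inv\<^bsub>F2\<^esub> y}"
    and b: "gen_b \<in> {x, inv\<^bsub>F2\<^esub> x} \<or> gen_b \<in> {y, inv\<^bsub>F2\<^esub> y}" by auto
  have swap: "z \<in> {u, inv\<^bsub>F2\<^esub> u}" if "u \<in> {z, inv\<^bsub>F2\<^esub> z}" "reduced z" for u z
    using that by auto
  have distinct: "{gen_a, inv\<^bsub>F2\<^esub> gen_a} \<inter> {gen_b, inv\<^bsub>F2\<^esub> gen_b} = {}"
    unfolding inv_gens by (auto simp: gen_a_def gen_b_def)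
  have "x \<in> {gen_a, inv\<^bsub>F2\<^esub> gen_a} \<or> y \<in> {gen_a, inv\<^bsub>F2\<^esub> gen_a}"
    using a swap[OF _ rxy(1)] swap[OF _ rxy(2)] by blast
  moreover have "x \<in> {gen_b, inv\<^bsub>F2\<^esub> gen_b} \<or> y \<in> {gen_b, inv\<^bsub>F2\<^esub> gen_b}"
    using b swap[OF _ rxy(1)] swap[OF _ rxy(2)] by blast
  ultimately have "x \<in> {gen_a, inv\<^bsub>F2\<^esub> gen_a} \<and> y \<in> {gen_b, inv\<^bsub>F2\<^esub> gen_b} \<or>
        x \<in> {gen_b, inv\<^bsub>F2\<^esub> gen_b} \<and> y \<in> {gen_a, inv\<^bsub>F2\<^esub> gen_a}"
    using distinct by blast
  then have "\<exists>v. P = F2.pairs.act v (gen_a, gen_b)"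
  proof
    assume *: "x \<in> {gen_a, inv\<^bsub>F2\<^esub> gen_a} \<and> y \<in> {gen_b, inv\<^bsub>F2\<^esub> gen_b}"
    then have "x = gen_a \<and> y = gen_b \<or> x = inv\<^bsub>F2\<^esub> gen_a \<and> y = inv\<^bsub>F2\<^esub> gen_b"
      using det_xy by (auto simp: pair_matrix_def ab_inv ab_gen)
    then have "P = F2.pairs.act [] (gen_a, gen_b) \<or> P = F2.pairs.act [Cross, Cross] (gen_a, gen_b)"
      using xy by auto
    then show ?thesis by blast
  next
    assume *: "x \<in> {gen_b, inv\<^bsub>F2\<^esub> gen_b} \<and> y \<in> {gen_a, inv\<^bsub>F2\<^esub> gen_a}"
    then have "x = gen_b \<and> y = inv\<^bsub>F2\<^esub> gen_a \<or> x = inv\<^bsub>F2\<^esub> gen_b \<and> y = gen_a"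
      using det_xy by (auto simp: pair_matrix_def ab_inv ab_gen)
    then have "P = F2.pairs.act [Cross] (gen_a, gen_b) \<or> P = F2.pairs.act [Cross, Cross, Cross] (gen_a, gen_b)"
      using xy by auto
    then show ?thesis by blast
  qed
  then obtain v where v: "P = F2.pairs.act v (gen_a, gen_b)" by blast
  have "F2.pair_eq (F2.pairs.act (inv_word w) P) (F2.pairs.act (w @ inv_word w) (g, h))"
    using F2.pairs.act_cong[OF F2.pair_eq_sym[OF w]] by (simp add: F2.pairs.act_append)
  moreover have "F2.pair_eq (F2.pairs.act (w @ inv_word w) (g, h)) (g, h)"
    by (rule F2.pairs.act_trivial[OF gh word_matrix_inv_word(1)])
  ultimately have "F2.pair_eq (F2.pairs.act (v @ inv_word w) (gen_a, gen_b)) (g, h)"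
    using F2.pair_eq_trans v by (simp add: F2.pairs.act_append)
  then show ?thesis by blast
qed


section \<open>Powers of primitive elements modulo a normal subgroup\<close>

lemma (in group_hom) hom_conj_by:
  "x \<in> carrier G \<Longrightarrow> y \<in> carrier G \<Longrightarrow> h (G.conj_by x y) = H.conj_by (h x) (h y)"
  by (simp add: G.conj_by_def H.conj_by_def)

lemma (in group_hom) hom_pair_eq:
  "G.pair_eq P P' \<Longrightarrow> H.pair_eq (map_prod h h P) (map_prod h h P')"
  by (cases P; cases P') (auto simp: G.pair_eq_iff H.pair_eq_iff hom_conj_by)

lemma (in group_hom) hom_act:
  assumes "G.pair_eq P P"
  shows "map_prod h h (G.pairs.act w P) = H.pairs.act w (map_prod h h P)"
  using assms
proof (induction w arbitrary: P)
  case (Cons m w)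
  obtain x y where P: "P = (x, y)" "x \<in> carrier G" "y \<in> carrier G"
    using Cons.prems by (cases P) (auto simp: G.pair_eq_iff)
  have "map_prod h h (G.pair_move m P) = H.pair_move m (map_prod h h P)"
    using P by (cases m) simp_all
  then show ?case using Cons.IH[OF G.pair_move_cong[OF Cons.prems]] by simp
qed simp

context group
begin

abbreviation (input) shear_word :: "farey_move list" where
  "shear_word \<equiv> [Turn, Turn, Cross]"

lemma act_shear_word:
  assumes "x \<in> carrier G" "y \<in> carrier G"
  shows "pair_eq (pairs.act shear_word (x, y)) (x, x \<otimes> y)"
  using assms by (auto simp: pair_eq_iff inv_mult_group m_assoc intro!: bexI[of _ \<one>])

text \<open>
  The shear with exponent \<open>n\<close> multiplies the second element of a pair by the \<open>n\<close>-th
  power of the first; it acts trivially if this power is trivial.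
\<close>

lemma act_shear_words:
  assumes "x \<in> carrier G" "y \<in> carrier G"
  shows "pair_eq (pairs.act (concat (replicate n shear_word)) (x, y)) (x, x [^] n \<otimes> y)"
  using assms(2)
proof (induction n arbitrary: y)
  case 0
  then show ?case using assms(1) by (simp add: pair_eq_refl_iff)
next
  case (Suc n)
  have "pair_eq (pairs.act (concat (replicate (Suc n) shear_word)) (x, y))
      (pairs.act (concat (replicate n shear_word)) (x, x \<otimes> y))"
    using pairs.act_cong[OF act_shear_word[OF assms(1) Suc.prems]]
    by (simp add: pairs.act_append)
  moreover have "pair_eq (pairs.act (concat (replicate n shear_word)) (x, x \<otimes> y)) (x, x [^] n \<otimes> (x \<otimes> y))"
    using Suc.prems assms(1) by (intro Suc.IH) simp
  moreover have "x [^] n \<otimes> (x \<otimes> y) = x [^] Suc n \<otimes> y"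
    using Suc.prems assms(1) by (simp add: m_assoc)
  ultimately show ?case
    using pair_eq_trans[of "pairs.act (concat (replicate (Suc n) shear_word)) (x, y)"] by simp
qed

definition torsion :: "nat \<Rightarrow> 'a \<times> 'a \<Rightarrow> bool" where
  "torsion k P \<longleftrightarrow> fst P [^] k = \<one>"

lemma conj_by_eq_one_iff:
  assumes "x \<in> carrier G" "y \<in> carrier G"
  shows "conj_by x y = \<one> \<longleftrightarrow> y = \<one>"
proof
  assume "conj_by x y = \<one>"
  then have "conj_by (inv x) (conj_by x y) = conj_by (inv x) \<one>" by simp
  then show "y = \<one>" using assms by (simp add: conj_by_conj_by) (simp add: conj_by_def)
qed (use assms in \<open>simp add: conj_by_def\<close>)

lemma torsion_pair_eq:
  assumes "pair_eq P P'"
  shows "torsion k P' \<longleftrightarrow> torsion k P"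
proof -
  obtain g h g' h' where P: "P = (g, h)" "P' = (g', h')" by (cases P, cases P')
  then obtain x where x: "g \<in> carrier G" "x \<in> carrier G"
    "g' = conj_by x g \<or> g' = conj_by x (inv g)"
    using assms by (auto simp: pair_eq_iff)
  have "g' [^] k = conj_by x (g [^] k) \<or> g' [^] k = conj_by x (inv (g [^] k))"
    using x by (auto simp: nat_pow_inv simp flip: conj_by_pow)
  then have "g' [^] k = \<one> \<longleftrightarrow> g [^] k = \<one>"
    using conj_by_eq_one_iff[OF x(2), of "g [^] k"] conj_by_eq_one_iff[OF x(2), of "inv (g [^] k)"] x(1)
    by (auto simp: inv_eq_1_iff)
  then show ?thesis using P by (simp add: torsion_def)
qed

text \<open>
  Words whose matrices have the same initial vertex differ by a shear, and shears do not
  change the first element of a pair.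
\<close>

lemma torsion_same_vertex:
  assumes P: "pair_eq P P" and v: "vertex (word_matrix w) = vertex (word_matrix w')"
  shows "torsion k (pairs.act w' P) \<longleftrightarrow> torsion k (pairs.act w P)"
proof -
  have shear: "torsion k (pairs.act (u @ shear_word) P) \<longleftrightarrow> torsion k (pairs.act u P)" for u
  proof -
    obtain x y where xy: "pairs.act u P = (x, y)" "x \<in> carrier G" "y \<in> carrier G"
      using pairs.act_cong[OF P, of u] by (cases "pairs.act u P") (auto simp: pair_eq_iff)
    have "torsion k (x, x \<otimes> y) \<longleftrightarrow> torsion k (pairs.act shear_word (x, y))"
      by (rule torsion_pair_eq[OF act_shear_word[OF xy(2,3)]])
    then show ?thesis using xy(1) by (simp add: pairs.act_append torsion_def del: pairs.act.simps)
  qed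
  have same: "torsion k (pairs.act u P) \<longleftrightarrow> torsion k (pairs.act u' P)"
    if "word_matrix u =\<^sub>\<plusminus> word_matrix u'" for u u'
    using torsion_pair_eq[OF pairs.act_eq_if_matrix_eq[OF P that]] by simp
  have sm: "word_matrix shear_word =\<^sub>\<plusminus> shear 1"
    by (simp add: mat2_one upto_sign_def)
  have append: "word_matrix (u @ shear_word) =\<^sub>\<plusminus> word_matrix u' ** shear (n + 1)"
    if "word_matrix u =\<^sub>\<plusminus> word_matrix u' ** shear n" for u u' n
  proof -
    have "word_matrix (u @ shear_word) =\<^sub>\<plusminus> word_matrix u' ** shear n ** shear 1"
      unfolding word_matrix_append by (intro upto_sign_mult that sm)
    then show ?thesis by (simp add: algebra_simps flip: matrix_mul_assoc)
  qed
  have all: "torsion k (pairs.act w' P) \<longleftrightarrow> torsion k (pairs.act w P)"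
    if "word_matrix w' =\<^sub>\<plusminus> word_matrix w ** shear n" for n w w'
    using that
  proof (induction n arbitrary: w' rule: int_induct[where k = 0])
    case base
    then show ?case by (intro same) (simp flip: mat2_one)
  next
    case (step1 n)
    obtain u where u: "word_matrix w ** shear n =\<^sub>\<plusminus> word_matrix u"
      using ex_word_matrix[of "word_matrix w ** shear n"] by (auto simp: det_mul)
    have "word_matrix (u @ shear_word) =\<^sub>\<plusminus> word_matrix w ** shear (n + 1)"
      by (rule append[OF upto_sign_sym[OF u]])
    from upto_sign_trans[OF step1.prems upto_sign_sym[OF this]]
    have "torsion k (pairs.act w' P) \<longleftrightarrow> torsion k (pairs.act (u @ shear_word) P)" by (rule same)
    then show ?case using shear step1.IH[OF upto_sign_sym[OF u]] by blast
  next
    case (step2 n)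
    have "word_matrix (w' @ shear_word) =\<^sub>\<plusminus> word_matrix w ** shear n"
      using append[OF step2.prems] by simp
    then show ?case using shear step2.IH by blast
  qed
  obtain n where "word_matrix w' =\<^sub>\<plusminus> word_matrix w ** shear n"
    using same_vertex_shear[OF _ _ v] by auto
  then show ?thesis by (rule all)
qed

text \<open>
  By \<open>act_eq_if_matrix_eq\<close> all words with matrix \<open>\<gamma>\<close> up to sign act alike on the class of \<open>P\<close>,
  so this is its stabiliser in $D\mathcal{O}_k$.
\<close>

definition stabilizer_DO :: "nat \<Rightarrow> 'a \<times> 'a \<Rightarrow> (int^2^2) set" where
  "stabilizer_DO k P = {\<gamma> \<in> DO k. \<exists>w. \<gamma> =\<^sub>\<plusminus> word_matrix w \<and> pair_eq (pairs.act w P) P}"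

lemma act_inv_word:
  assumes "pair_eq Q Q"
  shows "pair_eq (pairs.act (inv_word w) (pairs.act w Q)) Q"
  using pairs.act_trivial[OF assms word_matrix_inv_word(1)[of w]] by (simp add: pairs.act_append)

lemma stabilizer_DO_subgroup:
  assumes P: "pair_eq P P"
  shows "subgroup (stabilizer_DO k P) SL2Z"
proof (rule group.subgroupI[OF group_SL2Z])
  show "stabilizer_DO k P \<subseteq> carrier SL2Z" by (auto simp: stabilizer_DO_def DO_det)
  have "mat 1 \<in> stabilizer_DO k P"
    unfolding stabilizer_DO_def
    using P one_in_subgroup[OF DO_subgroup] by (auto intro!: exI[of _ "[]"])
  then show "stabilizer_DO k P \<noteq> {}" by blast
next
  fix \<gamma> assume "\<gamma> \<in> stabilizer_DO k P"
  then obtain w where w: "\<gamma> \<in> DO k" "\<gamma> =\<^sub>\<plusminus> word_matrix w" "pair_eq (pairs.act w P) P"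
    by (auto simp: stabilizer_DO_def)
  have "inv\<^bsub>SL2Z\<^esub> \<gamma> ** \<gamma> ** word_matrix (inv_word w)
     =\<^sub>\<plusminus> inv\<^bsub>SL2Z\<^esub> \<gamma> ** word_matrix w ** word_matrix (inv_word w)"
    by (intro upto_sign_mult w upto_sign_refl)
  also have "inv\<^bsub>SL2Z\<^esub> \<gamma> ** word_matrix w ** word_matrix (inv_word w)
     = inv\<^bsub>SL2Z\<^esub> \<gamma> ** word_matrix (w @ inv_word w)"
    by (simp add: word_matrix_append matrix_mul_assoc)
  finally have "word_matrix (inv_word w) =\<^sub>\<plusminus> inv\<^bsub>SL2Z\<^esub> \<gamma> ** word_matrix (w @ inv_word w)"
    using SL2Z_inverse(1)[OF DO_det[OF w(1)]] by simp
  moreover have "inv\<^bsub>SL2Z\<^esub> \<gamma> ** word_matrix (w @ inv_word w) =\<^sub>\<plusminus> inv\<^bsub>SL2Z\<^esub> \<gamma>"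
    using upto_sign_mult[OF upto_sign_refl[of "inv\<^bsub>SL2Z\<^esub> \<gamma>"] word_matrix_inv_word(1)[of w]] by simp
  ultimately have "inv\<^bsub>SL2Z\<^esub> \<gamma> =\<^sub>\<plusminus> word_matrix (inv_word w)"
    by (rule upto_sign_sym[OF upto_sign_trans])
  moreover have "pair_eq (pairs.act (inv_word w) P) P"
    using pair_eq_trans[OF pairs.act_cong[OF pair_eq_sym[OF w(3)]] act_inv_word[OF P]] .
  ultimately show "inv\<^bsub>SL2Z\<^esub> \<gamma> \<in> stabilizer_DO k P"
    using inv_in_subgroup[OF DO_subgroup w(1)] by (auto simp: stabilizer_DO_def)
next
  fix \<gamma> \<gamma>' assume "\<gamma> \<in> stabilizer_DO k P" "\<gamma>' \<in> stabilizer_DO k P"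
  then obtain w w' where w: "\<gamma> \<in> DO k" "\<gamma> =\<^sub>\<plusminus> word_matrix w" "pair_eq (pairs.act w P) P"
    and w': "\<gamma>' \<in> DO k" "\<gamma>' =\<^sub>\<plusminus> word_matrix w'" "pair_eq (pairs.act w' P) P"
    by (auto simp: stabilizer_DO_def)
  have "\<gamma> ** \<gamma>' =\<^sub>\<plusminus> word_matrix (w @ w')"
    unfolding word_matrix_append by (intro upto_sign_mult w w')
  moreover have "pair_eq (pairs.act (w @ w') P) P"
    using pair_eq_trans[OF pairs.act_cong[OF w(3)] w'(3)] by (simp add: pairs.act_append)
  ultimately show "\<gamma> \<otimes>\<^bsub>SL2Z\<^esub> \<gamma>' \<in> stabilizer_DO k P"
    using mult_in_subgroup[OF DO_subgroup w(1) w'(1)] by (auto simp: stabilizer_DO_def)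
qed

lemma twist_in_stabilizer_DO:
  assumes P: "pair_eq P P" and w: "torsion k (pairs.act w P)"
    and M: "det M = 1" "M =\<^sub>\<plusminus> word_matrix w"
  shows "twist k M \<in> stabilizer_DO k P"
proof -
  let ?u = "concat (replicate k shear_word)"
  obtain x y where xy: "pairs.act w P = (x, y)" "x \<in> carrier G" "y \<in> carrier G"
    using pairs.act_cong[OF P, of w] by (cases "pairs.act w P") (auto simp: pair_eq_iff)
  have "x [^] k \<otimes> y = y" using w xy by (simp add: torsion_def)
  then have "pair_eq (pairs.act ?u (pairs.act w P)) (pairs.act w P)"
    using act_shear_words[OF xy(2,3), of k] xy(1) by simp
  from pair_eq_trans[OF pairs.act_cong[OF this] act_inv_word[OF P]]
  have act: "pair_eq (pairs.act (w @ ?u @ inv_word w) P) P"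
    by (simp add: pairs.act_append)
  have u: "shear (int n) =\<^sub>\<plusminus> word_matrix (concat (replicate n shear_word))" for n
  proof (induction n)
    case (Suc n)
    have "shear 1 ** shear (int n) =\<^sub>\<plusminus> word_matrix shear_word ** word_matrix (concat (replicate n shear_word))"
      by (intro upto_sign_mult Suc.IH) (simp add: mat2_one upto_sign_def)
    then show ?case by (simp add: word_matrix_append[symmetric] add.commute del: word_matrix.simps(2))
  qed (simp add: mat2_one)
  have inv: "inv\<^bsub>SL2Z\<^esub> M =\<^sub>\<plusminus> word_matrix (inv_word w)"
  proof -
    have "inv\<^bsub>SL2Z\<^esub> M ** M ** word_matrix (inv_word w)
     =\<^sub>\<plusminus> inv\<^bsub>SL2Z\<^esub> M ** word_matrix w ** word_matrix (inv_word w)"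
      by (intro upto_sign_mult M upto_sign_refl)
    moreover have "inv\<^bsub>SL2Z\<^esub> M ** word_matrix w ** word_matrix (inv_word w) =\<^sub>\<plusminus> inv\<^bsub>SL2Z\<^esub> M"
      using upto_sign_mult[OF upto_sign_refl[of "inv\<^bsub>SL2Z\<^esub> M"] word_matrix_inv_word(1)[of w]]
      by (simp add: word_matrix_append matrix_mul_assoc)
    ultimately have "inv\<^bsub>SL2Z\<^esub> M ** M ** word_matrix (inv_word w) =\<^sub>\<plusminus> inv\<^bsub>SL2Z\<^esub> M"
      by (rule upto_sign_trans)
    then have "word_matrix (inv_word w) =\<^sub>\<plusminus> inv\<^bsub>SL2Z\<^esub> M" by (simp add: SL2Z_inverse(1)[OF M(1)])
    then show ?thesis by (rule upto_sign_sym)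
  qed
  have "twist k M =\<^sub>\<plusminus> word_matrix (w @ ?u @ inv_word w)"
    unfolding twist_def word_matrix_append matrix_mul_assoc by (intro upto_sign_mult M u inv)
  then show ?thesis using act twist_in_DO[OF M(1)] by (auto simp: stabilizer_DO_def)
qed

end

text \<open>
  Extend the primitive element to a generating pair and, if the determinant is $-1$, invert the
  second element; then Nielsen's theorem applies.
\<close>

lemma primitive_pair:
  assumes "primitive g"
  obtains w h where "F2.pair_eq (F2.pairs.act w (gen_a, gen_b)) (g, h)"
    "vertex (word_matrix w) = qfrac (fst (ab g)) (snd (ab g))" "reduced g"
proof -
  obtain S where S: "S \<subseteq> carrier F2" "card S = 2" "g \<in> S" "generate F2 S = carrier F2"
    using assms unfolding primitive_def by blast
  then obtain h where h: "S = {g, h}" by (auto simp: card_2_iff)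
  then have r: "reduced g" "reduced h" using S by auto
  have gen: "generating_pair (g, h)" using generating_pair_generate S(4) h by simp
  have "\<exists>h'. reduced h' \<and> generating_pair (g, h') \<and> det (pair_matrix (g, h')) = 1"
  proof (cases "det (pair_matrix (g, h)) = 1")
    case True
    then show ?thesis using r gen by blast
  next
    case False
    then have "det (pair_matrix (g, h)) = - 1" using generating_pair_det[OF gen r] by linarith
    then have "det (pair_matrix (g, inv\<^bsub>F2\<^esub> h)) = 1"
      using r by (simp add: pair_matrix_def ab_inv algebra_simps)
    moreover have "h \<in> K" if "subgroup K F2" "inv\<^bsub>F2\<^esub> h \<in> K" for K
      using subgroup.m_inv_closed[OF that] r by simp
    then have "generating_pair (g, inv\<^bsub>F2\<^esub> h)"
      using gen unfolding generating_pair_def by auto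
    ultimately show ?thesis using r by (intro exI[of _ "inv\<^bsub>F2\<^esub> h"]) simp
  qed
  then obtain h' where h': "reduced h'" "generating_pair (g, h')" "det (pair_matrix (g, h')) = 1"
    by blast
  obtain w where w: "F2.pair_eq (F2.pairs.act w (gen_a, gen_b)) (g, h')"
    using nielsen_pairs[OF h'(2) r(1) h'(1,3)] by blast
  have "word_matrix w =\<^sub>\<plusminus> pair_matrix (g, h')"
    using pair_matrix_pair_eq[OF w] pair_matrix_act[OF gens_pair_eq] by (simp add: pair_matrix_gens)
  then have "vertex (word_matrix w) = qfrac (fst (ab g)) (snd (ab g))"
    using vertex_upto_sign[of "word_matrix w" "pair_matrix (g, h')"] by (simp add: pair_matrix_def vertex_mat2)
  then show thesis using that[OF w _ r(1)] by simp
qed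


section \<open>The normal closure of the chosen powers\<close>

lemma moebius_mult:
  assumes "det A = 1" "det B = 1"
  shows "moebius (A ** B) x = moebius A (moebius B x)"
proof -
  obtain p q where "coprime p q" "x = qfrac p q" using qfrac_surj by blast
  then obtain M where M: "det M = 1" "vertex M = x" using ex_vertex by metis
  have "moebius (A ** B) x = vertex (A ** B ** M)"
    using assms M by (simp add: vertex_mult det_mul)
  also have "\<dots> = vertex (A ** (B ** M))" by (simp add: matrix_mul_assoc)
  also have "\<dots> = moebius A (moebius B x)"
    using assms M by (simp add: vertex_mult det_mul)
  finally show ?thesis .
qed

lemma moebius_one: "moebius (mat 1) x = x"
proof -
  obtain p q where "coprime p q" "x = qfrac p q" using qfrac_surj by blast
  then obtain M where M: "det M = 1" "vertex M = x" using ex_vertex by metis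
  then show ?thesis using vertex_mult[of "mat 1" M] by simp
qed

lemma vertex_orbit_iff: "y \<in> vertex_orbit k x \<longleftrightarrow> (\<exists>\<delta>\<in>DO k. y = moebius \<delta> x)"
  by (auto simp: vertex_orbit_def orbit_def)

lemma vertex_orbit_self: "x \<in> vertex_orbit k x"
  unfolding vertex_orbit_iff using one_in_subgroup[OF DO_subgroup] moebius_one by metis

lemma vertex_orbit_moebius:
  assumes \<delta>: "\<delta> \<in> DO k"
  shows "vertex_orbit k (moebius \<delta> x) = vertex_orbit k x"
proof (intro subset_antisym subsetI)
  fix y assume "y \<in> vertex_orbit k (moebius \<delta> x)"
  then obtain \<gamma> where "\<gamma> \<in> DO k" "y = moebius (\<gamma> ** \<delta>) x"
    using \<delta> by (auto simp: vertex_orbit_iff moebius_mult DO_det)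
  then show "y \<in> vertex_orbit k x"
    using mult_in_subgroup[OF DO_subgroup _ \<delta>] by (auto simp: vertex_orbit_iff)
next
  fix y assume "y \<in> vertex_orbit k x"
  then obtain \<gamma> where \<gamma>: "\<gamma> \<in> DO k" "y = moebius \<gamma> x" by (auto simp: vertex_orbit_iff)
  have "y = moebius (\<gamma> ** inv\<^bsub>SL2Z\<^esub> \<delta> ** \<delta>) x"
    using \<gamma> SL2Z_inverse(1)[OF DO_det[OF \<delta>]] by (simp flip: matrix_mul_assoc)
  also have "\<dots> = moebius (\<gamma> ** inv\<^bsub>SL2Z\<^esub> \<delta>) (moebius \<delta> x)"
    using \<gamma>(1) \<delta> SL2Z_inverse(3) by (intro moebius_mult) (simp_all add: det_mul DO_det)
  finally show "y \<in> vertex_orbit k (moebius \<delta> x)"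
    using mult_in_subgroup[OF DO_subgroup \<gamma>(1) inv_in_subgroup[OF DO_subgroup \<delta>]]
    by (auto simp: vertex_orbit_iff)
qed

lemma primitive_conj_by:
  assumes g: "primitive g" and x: "reduced x"
  shows "primitive (F2.conj_by x g)"
proof -
  obtain S where S: "S \<subseteq> carrier F2" "card S = 2" "g \<in> S" "generate F2 S = carrier F2"
    using g unfolding primitive_def by blast
  then obtain h where h: "S = {g, h}" "g \<noteq> h" by (auto simp: card_2_iff)
  then have r: "reduced g" "reduced h" using S by auto
  let ?g = "F2.conj_by x g" and ?h = "F2.conj_by x h"
  have undo: "F2.conj_by (inv\<^bsub>F2\<^esub> x) (F2.conj_by x y) = y" if "reduced y" for y
    using that x by (simp add: F2.conj_by_conj_by)
  have red: "reduced ?g" "reduced ?h"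
    using F2.conj_by_closed[of x g] F2.conj_by_closed[of x h] r x by simp_all
  have "generating_pair (g, h)" using generating_pair_generate S(4) h by simp
  moreover have "F2.pair_eq (g, h) (?g, ?h)" using r x by (auto simp: F2.pair_eq_iff)
  ultimately have gen: "generating_pair (?g, ?h)" by (rule generating_pair_eq)
  have "subgroup (generate F2 {?g, ?h}) F2"
    using red by (intro F2.generate_is_subgroup) simp
  moreover have "?g \<in> generate F2 {?g, ?h}" "?h \<in> generate F2 {?g, ?h}"
    by (auto intro: generate.incl)
  ultimately have "generate F2 {?g, ?h} = carrier F2"
    using gen by (simp add: generating_pair_def)
  moreover have "?g \<noteq> ?h" using undo r h(2) by metis
  ultimately show ?thesis unfolding primitive_def
    using red by (intro exI[of _ "{?g, ?h}"]) simp
qed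

lemma primitive_reduced: "primitive g \<Longrightarrow> reduced g"
  unfolding primitive_def by auto

text \<open>
  Conjugates of primitive elements are primitive.
\<close>

lemma prim_power_subgroup_normal: "prim_power_subgroup k \<lhd> F2"
  unfolding prim_power_subgroup_def
proof (rule F2.normal_generateI)
  show "{g [^]\<^bsub>F2\<^esub> k |g. primitive g} \<subseteq> carrier F2"
    using F2.nat_pow_closed primitive_reduced by auto
  fix u x assume "u \<in> {g [^]\<^bsub>F2\<^esub> k |g. primitive g}" and x: "x \<in> carrier F2"
  then obtain g where g: "u = g [^]\<^bsub>F2\<^esub> k" "primitive g" by blast
  have "x \<otimes>\<^bsub>F2\<^esub> u \<otimes>\<^bsub>F2\<^esub> inv\<^bsub>F2\<^esub> x = F2.conj_by x g [^]\<^bsub>F2\<^esub> k"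
    using g x primitive_reduced[OF g(2)] F2.conj_by_pow[of x g k] by (simp add: F2.conj_by_def)
  then show "x \<otimes>\<^bsub>F2\<^esub> u \<otimes>\<^bsub>F2\<^esub> inv\<^bsub>F2\<^esub> x \<in> {g [^]\<^bsub>F2\<^esub> k |g. primitive g}"
    using primitive_conj_by[OF g(2)] x by auto
qed

theorem corollary2p9:
  fixes k :: nat
    and T :: "(qhat set, qhat set set) mgraph"
    and L :: "(qhat, qhat set) mgraph"
    and \<Lambda> :: "'i set"
    and p q :: "'i \<Rightarrow> int"
    and g :: "'i \<Rightarrow> letter list"
  assumes "k \<ge> 2"
    and "subgraph T (farey_quotient k)"
    and "tree T"
    and "verts T = verts (farey_quotient k)"
    and "is_lift k L T"
    and "\<And>i. i \<in> \<Lambda> \<Longrightarrow> coprime (p i) (q i)"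
    and "verts L = {qfrac (p i) (q i) |i. i \<in> \<Lambda>}"
    and "\<And>i. i \<in> \<Lambda> \<Longrightarrow> g i \<in> prim_class (qfrac (p i) (q i))"
  shows "prim_power_subgroup k = normal_closure F2 {g i [^]\<^bsub>F2\<^esub> k |i. i \<in> \<Lambda>}"
proof
  let ?S = "{g i [^]\<^bsub>F2\<^esub> k |i. i \<in> \<Lambda>}"
  define N where "N = normal_closure F2 ?S"
  have prim: "primitive (g i)" if "i \<in> \<Lambda>" for i
    using assms(8)[OF that] by (simp add: prim_class_def)
  have S: "?S \<subseteq> prim_power_subgroup k"
    using prim unfolding prim_power_subgroup_def by (auto intro: generate.incl)
  then show "normal_closure F2 ?S \<subseteq> prim_power_subgroup k"
    using prim_power_subgroup_normal unfolding normal_closure_def by blast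
  have "?S \<subseteq> carrier F2"
    using prim primitive_reduced F2.nat_pow_closed by auto
  then have N: "N \<lhd> F2" unfolding N_def by (rule F2.normal_closure_normal)
  have S_N: "g i [^]\<^bsub>F2\<^esub> k \<in> N" if "i \<in> \<Lambda>" for i
    using that unfolding N_def normal_closure_def by blast

  interpret N: normal N F2 by (rule N)
  interpret Q: group "F2 Mod N" by (rule N.factorgroup_is_group)
  interpret \<pi>: group_hom F2 "F2 Mod N" "\<lambda>x. N #>\<^bsub>F2\<^esub> x"
    by unfold_locales (rule N.r_coset_hom_Mod)
  let ?\<pi> = "\<lambda>x. N #>\<^bsub>F2\<^esub> x"
  have kernel: "?\<pi> x = \<one>\<^bsub>F2 Mod N\<^esub> \<longleftrightarrow> x \<in> N" if "reduced x" for x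
    using that F2.coset_join1[of N x] N.subgroup_axioms N.rcos_const[of x] N.subset
    by (auto simp: FactGroup_def)
  define P where "P = (?\<pi> gen_a, ?\<pi> gen_b)"
  have P: "Q.pair_eq P P"
    using \<pi>.hom_pair_eq[OF gens_pair_eq] by (simp add: P_def)
  have power: "Q.torsion k (Q.pairs.act w P) \<longleftrightarrow> u [^]\<^bsub>F2\<^esub> k \<in> N"
    if "F2.pair_eq (F2.pairs.act w (gen_a, gen_b)) (u, h)" "reduced u" for w u h
  proof -
    have eq: "Q.pair_eq (Q.pairs.act w P) (?\<pi> u, ?\<pi> h)"
      using \<pi>.hom_pair_eq[OF that(1)] \<pi>.hom_act[OF gens_pair_eq, of w] by (simp add: P_def)
    have "Q.torsion k (Q.pairs.act w P) \<longleftrightarrow> ?\<pi> u [^]\<^bsub>F2 Mod N\<^esub> k = \<one>\<^bsub>F2 Mod N\<^esub>"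
      using Q.torsion_pair_eq[OF eq, of k] by (simp add: Q.torsion_def)
    also have "\<dots> \<longleftrightarrow> ?\<pi> (u [^]\<^bsub>F2\<^esub> k) = \<one>\<^bsub>F2 Mod N\<^esub>"
      using \<pi>.hom_nat_pow[of u k] that(2) by simp
    also have "\<dots> \<longleftrightarrow> u [^]\<^bsub>F2\<^esub> k \<in> N"
      using kernel F2.nat_pow_closed[of u k] that(2) by simp
    finally show ?thesis .
  qed

  \<comment> \<open>The slopes of the primitive elements whose k-th powers lie in N.\<close>
  define good where "good = (\<lambda>x. \<exists>w. vertex (word_matrix w) = x \<and> Q.torsion k (Q.pairs.act w P))"
  have good: "Q.torsion k (Q.pairs.act w P)" if gw: "good (vertex (word_matrix w))" for w
  proof -
    obtain w' where "vertex (word_matrix w') = vertex (word_matrix w)" "Q.torsion k (Q.pairs.act w' P)"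
      using gw by (auto simp: good_def)
    then show ?thesis using Q.torsion_same_vertex[OF P] by blast
  qed
  have good_L: "good v" if v: "v \<in> verts L" for v
  proof -
    obtain i where i: "i \<in> \<Lambda>" "v = qfrac (p i) (q i)" using v assms(7) by auto
    obtain p' q' where pq: "v = qfrac p' q'" "ab (g i) = (p', q') \<or> ab (g i) = (- p', - q')"
      using assms(8)[OF i(1)] i(2) by (auto simp: prim_class_def)
    obtain w h where w: "F2.pair_eq (F2.pairs.act w (gen_a, gen_b)) (g i, h)"
      "vertex (word_matrix w) = qfrac (fst (ab (g i))) (snd (ab (g i)))" "reduced (g i)"
      using primitive_pair[OF prim[OF i(1)]] by blast
    have "vertex (word_matrix w) = v" using w(2) pq qfrac_uminus by auto
    then show ?thesis using power[OF w(1,3)] S_N[OF i(1)] by (auto simp: good_def)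
  qed

  let ?H = "Q.stabilizer_DO k P"
  have L: "subgraph L farey" "connected_graph L" "bij_betw (vertex_orbit k) (verts L) (verts T)"
    using assms(5) by (auto simp: is_lift_def graph_iso_def)
  \<comment> \<open>The lift provides one vertex for each orbit, and twists at good vertices fix the class of P.\<close>
  interpret farey_lift k L ?H
  proof (rule farey_lift.intro)
    show "k \<ge> 2" "subgraph L farey" "connected_graph L" by fact+
    show "u = v" if "u \<in> verts L" "v \<in> verts L" "\<delta> \<in> DO k" "moebius \<delta> u = v" for u v \<delta>
      using that vertex_orbit_moebius[OF that(3), of u] L(3)
      by (metis bij_betw_def inj_onD)
    show "\<exists>\<delta>\<in>DO k. \<exists>v\<in>verts L. x = moebius \<delta> v" for x
    proof -
      have "vertex_orbit k x \<in> vertex_orbit k ` verts L"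
        using L(3) assms(4) by (auto simp: bij_betw_def farey_quotient_def farey_def)
      then obtain v where "v \<in> verts L" "vertex_orbit k x = vertex_orbit k v" by blast
      then show ?thesis using vertex_orbit_self[of x k] vertex_orbit_iff by blast
    qed
    show "subgroup ?H SL2Z" by (rule Q.stabilizer_DO_subgroup[OF P])
    show "?H \<subseteq> DO k" by (auto simp: Q.stabilizer_DO_def)
    show "twist k M \<in> ?H" if M: "det M = 1" "vertex M \<in> verts L" for M
    proof -
      obtain w where w: "M =\<^sub>\<plusminus> word_matrix w" using ex_word_matrix[OF M(1)] by blast
      then have "good (vertex (word_matrix w))" using good_L M(2) vertex_upto_sign by metis
      then show ?thesis using Q.twist_in_stabilizer_DO[OF P good M(1) w] by blast
    qed
  qed

  \<comment> \<open>An element of H fixes the class of P, so prefixing its word does not change the action on P.\<close>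
  have good_all: "good x" for x
  proof -
    obtain \<gamma> v where \<gamma>: "\<gamma> \<in> ?H" "v \<in> verts L" "x = moebius \<gamma> v"
      using H_transitive_on_lifts by blast
    obtain w where w: "\<gamma> =\<^sub>\<plusminus> word_matrix w" "Q.pair_eq (Q.pairs.act w P) P" "\<gamma> \<in> DO k"
      using \<gamma>(1) by (auto simp: Q.stabilizer_DO_def)
    obtain w' where w': "vertex (word_matrix w') = v" "Q.torsion k (Q.pairs.act w' P)"
      using good_L[OF \<gamma>(2)] by (auto simp: good_def)
    have "x = vertex (\<gamma> ** word_matrix w')"
      using \<gamma>(3) w'(1) DO_det[OF w(3)] by (simp add: vertex_mult)
    also have "\<dots> = vertex (word_matrix (w @ w'))"
      using vertex_upto_sign[OF upto_sign_mult[OF w(1) upto_sign_refl]] by (simp add: word_matrix_append)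
    finally have "vertex (word_matrix (w @ w')) = x" by simp
    moreover have "Q.torsion k (Q.pairs.act (w @ w') P)"
      using Q.torsion_pair_eq[OF Q.pairs.act_cong[OF w(2)], of k w'] w'(2)
      by (simp add: Q.pairs.act_append)
    ultimately show ?thesis by (auto simp: good_def)
  qed

  have "u [^]\<^bsub>F2\<^esub> k \<in> N" if u: "primitive u" for u
  proof -
    obtain w h where w: "F2.pair_eq (F2.pairs.act w (gen_a, gen_b)) (u, h)" "reduced u"
      using primitive_pair[OF u] by blast
    show ?thesis using power[OF w] good[OF good_all] by blast
  qed
  then have "generate F2 {u [^]\<^bsub>F2\<^esub> k |u. primitive u} \<subseteq> N"
    by (intro F2.generate_subgroup_incl N.subgroup_axioms) auto
  then show "prim_power_subgroup k \<subseteq> normal_closure F2 ?S"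
    by (simp add: prim_power_subgroup_def N_def)
qed

end
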